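(* Let $h_s,g_s$ be scaling filters of length $M$ whose scaling functions are bounded in absolute value by a constant $B\ge1$, and suppose that for some $0<\varepsilon<1$, \[ |h_s(k)-e^{\mathrm ik/2}g_s(k)|\le\varepsilon\quad\text{for all }k\in(-\pi,\pi). \] Let $\mathcal L\ge1$, $N\ge1$, and let $f_1,\dots,f_{2N}\in\ell^2(\mathbb Z)$ with $\lVert f_i\rVert_2\le1$ and $D(\{f_i\})<\infty$. Then \[ \bigl|G(\{f_i\})_{\omega}-G(\{f_i\})_{\omega_{\mathrm{MERA}}}\bigr|\le24\sqrt N\sqrt{C2^{-\mathcal L/2}+6\varepsilon\log_2^2(C/\varepsilon)},\qquad C=2^{3/2}\sqrt{D(\{f_i\})}\,BM. \] That is, the $2N$-point correlation functions $\langle a^\dagger(f_1)\cdots a^\dagger(f_N)a(f_{N+1})\cdots a(f_{2N})\rangle$ of the exact ground state of $H=-\sum_n a_n^\dagger a_{n+1}+a_{n+1}^\dagger a_n$ and of the state prepared by $\mathcal L$ layers of the wavelet MERA circuit differ by at most this amount.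
   Context: Fourier convention $\hat f(k)=\sum_nf[n]e^{-\mathrm ink}$; $m(\theta)$ is the Fourier multiplier by a bounded $2\pi$-periodic $\theta$; $m(h)$ multiplication by the Fourier transform $h(k)$ of a filter $h$; $\uparrow$ is upsampling $\delta_n\mapsto\delta_{2n}$. A scaling filter of length $M$: sequence $h_s$ supported on $M$ consecutive integers with $|h_s(k)|^2+|h_s(k+\pi)|^2=2$, $h_s(0)=\sqrt2$, whose scaling function $\phi_h$ (solution of $\phi_h(x)=\sqrt2\sum_nh_s[n]\phi_h(2x-n)$, $\int\phi_h=1$) has orthonormal integer translates. Wavelet filter $h_w(k)=e^{\mathrm ik}\overline{h_s(k+\pi)}$ ($k+\pi$ reduced mod $2\pi$ into $(-\pi,\pi)$), likewise $g_w$. $W_h^{(\mathcal L)}:\ell^2(\mathbb Z)\to\ell^2(\mathbb Z)\otimes\mathbb C^{\mathcal L+1}$ is the unitary with $W_h^{(\mathcal L)\dagger}(I\otimes|\ell\rangle)=[m(h_s)\uparrow]^{\ell-1}m(h_w)\uparrow$ ($1\le\ell\le\mathcal L$), $W_h^{(\mathcal L)\dagger}(I\otimes|\mathcal L+1\rangle)=[m(h_s)\uparrow]^{\mathcal L}$; same for $W_g^{(\mathcal L)}$; $p_w^{(\mathcal L)}=I\otimes\sum_{\ell=1}^{\mathcal L}|\ell\rangle\langle\ell|$. $\theta_w(k)=-\mathrm i\,\mathrm{sign}(k)e^{\mathrm ik/2}$ on $(-\pi,\pi)$. $v:\ell^2(\mathbb Z)\otimes\mathbb C^2\to\ell^2(\mathbb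 Z)$, $v(\delta_n\otimes e_1)=(-1)^n\delta_{2n}$, $v(\delta_n\otimes e_2)=(-1)^n\delta_{2n+1}$; $|+\rangle=(e_1+e_2)/\sqrt2$. Ground-state symbol: $\omega=v\begin{bmatrix}I&0\\0&m(\theta_w)\end{bmatrix}(I\otimes|+\rangle\langle+|)\begin{bmatrix}I&0\\0&m(\theta_w)^\dagger\end{bmatrix}v^\dagger$. MERA symbol: $\omega_{\mathrm{MERA}}=v\begin{bmatrix}W_h^{(\mathcal L)\dagger}&0\\0&W_g^{(\mathcal L)\dagger}\end{bmatrix}(p_w^{(\mathcal L)}\otimes|+\rangle\langle+|)\begin{bmatrix}W_h^{(\mathcal L)}&0\\0&W_g^{(\mathcal L)}\end{bmatrix}v^\dagger$. Both are orthogonal projections and are the symbols of pure gauge-invariant quasi-free (generalized free) fermionic states; for such a state with symbol $\psi$, with $a(f)=\sum_nf[n]a_n$, $a^\dagger(f)=\sum_n\overline{f[n]}a_n^\dagger$, the correlation function is $G(\{f_i\})_\psi=\langle a^\dagger(f_1)\cdots a^\dagger(f_N)a(f_{N+1})\cdots a(f_{2N})\rangle_\psi=\det\bigl[\langle f_i,\psi f_{N+1-j}\rangle\bigr]_{i,j=1}^N$. $D(\{f_i\})=\sup_{f\in\mathrm{span}\{f_1,\dots,f_{2N}\}}|\{x\in\mathbb Z:f(x)\neq0\}|$. *)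

theory Defs
  imports "HOL-Analysis.Analysis" "Jordan_Normal_Form.Determinant"
begin

type_synonym seq = "int \<Rightarrow> complex"

definition l2inner :: "seq \<Rightarrow> seq \<Rightarrow> complex" where
  "l2inner f g = infsum (\<lambda>n. cnj (f n) * g n) UNIV"

definition l2norm :: "seq \<Rightarrow> real" where
  "l2norm f = sqrt (infsum (\<lambda>n. (cmod (f n))\<^sup>2) UNIV)"

definition ft :: "seq \<Rightarrow> real \<Rightarrow> complex" where
  "ft h k = infsum (\<lambda>n. h n * exp (- \<i> * of_real (of_int n * k))) UNIV"

text \<open>Fourier coefficients of a 2pi-periodic function theta, so that the
  multiplier m(theta) acts as convolution with them.\<close>
definition fcoeff :: "(real \<Rightarrow> complex) \<Rightarrow> seq" where
  "fcoeff \<theta> n = integral {-pi..pi} (\<lambda>k. \<theta> k * exp (\<i> * of_real (of_int n * k))) / of_real (2 * pi)"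

definition conv :: "seq \<Rightarrow> seq \<Rightarrow> seq" where
  "conv c f n = infsum (\<lambda>j. c (n - j) * f j) UNIV"

text \<open>Fourier multiplier m(theta): (m(theta) f)^ = theta * hat f.\<close>
definition fmult :: "(real \<Rightarrow> complex) \<Rightarrow> seq \<Rightarrow> seq" where
  "fmult \<theta> f = conv (fcoeff \<theta>) f"

definition up :: "seq \<Rightarrow> seq" where
  "up f n = (if even n then f (n div 2) else 0)"

definition down :: "seq \<Rightarrow> seq" where
  "down f n = f (2 * n)"

definition wft :: "seq \<Rightarrow> real \<Rightarrow> complex" where
  "wft h k = exp (\<i> * of_real k) * cnj (ft h (k + pi))"

definition scaling_function :: "seq \<Rightarrow> (real \<Rightarrow> complex) \<Rightarrow> bool" where
  "scaling_function h \<phi> \<longleftrightarrow>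
     integrable lborel \<phi> \<and> (LINT x|lborel. \<phi> x) = 1 \<and>
     (AE x in lborel. \<phi> x = of_real (sqrt 2) * infsum (\<lambda>n. h n * \<phi> (2 * x - of_int n)) UNIV)"

definition orthonormal_translates :: "(real \<Rightarrow> complex) \<Rightarrow> bool" where
  "orthonormal_translates \<phi> \<longleftrightarrow>
     (\<forall>n m :: int. integrable lborel (\<lambda>x. \<phi> (x - of_int n) * cnj (\<phi> (x - of_int m))) \<and>
        (LINT x|lborel. \<phi> (x - of_int n) * cnj (\<phi> (x - of_int m))) = (if n = m then 1 else 0))"

definition scaling_filter :: "nat \<Rightarrow> seq \<Rightarrow> bool" where
  "scaling_filter M h \<longleftrightarrow>
     (\<exists>a::int. \<forall>n. h n \<noteq> 0 \<longrightarrow> a \<le> n \<and> n < a + int M) \<and>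
     (\<forall>k. (cmod (ft h k))\<^sup>2 + (cmod (ft h (k + pi)))\<^sup>2 = 2) \<and>
     ft h 0 = of_real (sqrt 2) \<and>
     (\<exists>\<phi>. scaling_function h \<phi> \<and> orthonormal_translates \<phi>)"

definition msup :: "(real \<Rightarrow> complex) \<Rightarrow> seq \<Rightarrow> seq" where
  "msup \<theta> f = fmult \<theta> (up f)"

definition msup_adj :: "(real \<Rightarrow> complex) \<Rightarrow> seq \<Rightarrow> seq" where
  "msup_adj \<theta> f = down (fmult (\<lambda>k. cnj (\<theta> k)) f)"

text \<open>l2(Z) (x) C^(L+1) is modelled as int => nat => complex, with the C^(L+1) index
  ranging over 1..L+1.  W^dagger and W = (W^dagger)^dagger, written out explicitly.\<close>
definition W_adj :: "seq \<Rightarrow> nat \<Rightarrow> (int \<Rightarrow> nat \<Rightarrow> complex) \<Rightarrow> seq" where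
  "W_adj h L X = (\<lambda>n.
      (\<Sum>l\<in>{1..L}. ((msup (ft h) ^^ (l - 1)) (msup (wft h) (\<lambda>m. X m l))) n)
      + ((msup (ft h) ^^ L) (\<lambda>m. X m (L + 1))) n)"

definition W :: "seq \<Rightarrow> nat \<Rightarrow> seq \<Rightarrow> (int \<Rightarrow> nat \<Rightarrow> complex)" where
  "W h L f = (\<lambda>n l.
      if 1 \<le> l \<and> l \<le> L then msup_adj (wft h) ((msup_adj (ft h) ^^ (l - 1)) f) n
      else if l = L + 1 then ((msup_adj (ft h) ^^ L) f) n
      else 0)"

text \<open>The isometry v : l2(Z) (x) C^2 -> l2(Z) (C^2 factor as a pair) and its adjoint.\<close>
definition sgnpow :: "int \<Rightarrow> complex" where
  "sgnpow n = (if even n then 1 else -1)"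

definition v :: "seq \<times> seq \<Rightarrow> seq" where
  "v xy n = (if even n then sgnpow (n div 2) * fst xy (n div 2)
             else sgnpow ((n - 1) div 2) * snd xy ((n - 1) div 2))"

definition v_adj :: "seq \<Rightarrow> seq \<times> seq" where
  "v_adj f = ((\<lambda>n. sgnpow n * f (2 * n)), (\<lambda>n. sgnpow n * f (2 * n + 1)))"

definition theta_w :: "real \<Rightarrow> complex" where
  "theta_w k = - \<i> * of_real (sgn k) * exp (\<i> * of_real (k / 2))"

text \<open>Ground-state symbol omega = v diag(I,m(theta_w)) (I (x) |+><+|) diag(I,m(theta_w)^dagger) v^dagger.\<close>
definition omega :: "seq \<Rightarrow> seq" where
  "omega f = (let a = fst (v_adj f);
                  b = fmult (\<lambda>k. cnj (theta_w k)) (snd (v_adj f));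
                  s = (\<lambda>n. (a n + b n) / 2)
              in v (s, fmult theta_w s))"

definition omega_MERA :: "seq \<Rightarrow> seq \<Rightarrow> nat \<Rightarrow> seq \<Rightarrow> seq" where
  "omega_MERA h g L f = (let X = W h L (fst (v_adj f));
                             Y = W g L (snd (v_adj f));
                             S = (\<lambda>n l. if 1 \<le> l \<and> l \<le> L then (X n l + Y n l) / 2 else 0)
                         in v (W_adj h L S, W_adj g L S))"

text \<open>Correlation function G({f_i})_psi = det [<f_i, psi f_(2N+1-j)>]_(i,j=1..N)
  (0-based indices in the matrix).\<close>
definition corr :: "(seq \<Rightarrow> seq) \<Rightarrow> (nat \<Rightarrow> seq) \<Rightarrow> nat \<Rightarrow> complex" where
  "corr \<psi> f N = Determinant.det (Matrix.mat N N (\<lambda>(i, j). l2inner (f (i + 1)) (\<psi> (f (2 * N - j)))))"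

definition supp_size :: "seq \<Rightarrow> enat" where
  "supp_size g = (if finite {x. g x \<noteq> 0} then enat (card {x. g x \<noteq> 0}) else \<infinity>)"

definition Dsize :: "(nat \<Rightarrow> seq) \<Rightarrow> nat \<Rightarrow> enat" where
  "Dsize f N = (SUP c :: nat \<Rightarrow> complex. supp_size (\<lambda>x. \<Sum>i\<in>{1..2 * N}. c i * f i x))"

end

theory Submission
  imports Defs
begin

text \<open>
  Let \<open>H\<close>, \<open>G\<close> be the low-pass and \<open>H\<^sub>w\<close>, \<open>G\<^sub>w\<close> the wavelet synthesis operators, and let \<open>T\<close> be the
  multiplier by \<open>theta_w\<close>. On \<open>(-\<pi>, \<pi>)\<close> one has \<open>theta_w k * exp (i k / 2) = theta_w (2 k)\<close> (periodised),
  so closeness of the filters says that \<open>T H \<approx> G T\<close> and \<open>T H\<^sub>w \<approx> G\<^sub>w\<close> up to \<open>\<epsilon>\<close>. Peeling off one level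
  at a time, the form \<open>\<langle>b, T a\<rangle>\<close> agrees with its MERA counterpart up to \<open>2 \<epsilon>\<close> per level plus a remainder
  on the coarse component \<open>H\<^sup>* \<dots> H\<^sup>* a\<close>. The remainder decays like \<open>2 powr (- l / 2)\<close>: the entries of
  the iterated filter are overlaps of an integer translate of the bounded, compactly supported scaling
  function with a stretched copy of it. Stopping after about \<open>2 log 2 (C / \<epsilon>)\<close> levels shows that
  \<open>omega f\<close> and \<open>omega_MERA f\<close> differ in norm by \<open>2 \<delta>\<close>, where \<open>\<delta>\<close> is the expression under the root.

  By Hadamard's inequality both determinants have modulus at most 1, and exchanging one column at a time
  bounds their difference by \<open>2 N \<delta>\<close>; finally \<open>min 2 (2 N \<delta>) \<le> 2 sqrt (N \<delta>)\<close>.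
\<close>

section \<open>Perturbation of cross-Gram determinants\<close>


text \<open>The obstacle is the jump of \<open>theta_w\<close> at 0: its Fourier coefficients decay
  only like 1/n, so images under \<open>omega\<close> are in general neither finitely supported nor
  absolutely summable. No operator on all of l2 is therefore constructed. Every estimate concerns a
  form \<open>l2inner y (\<psi> f)\<close> with \<open>y\<close> and \<open>f\<close> finitely
  supported, where all sums over coordinates are finite and the integrals pair trigonometric
  polynomials with a bounded symbol. Norms of images are recovered at the very end by choosing
  \<open>y\<close>. A scaling function is only given as integrable with an almost everywhere
  refinement equation, so its compact support has to be proved before decay can be. The error
  \<open>2 * \<epsilon>\<close> per level grows without bound in \<open>L\<close>, which forces the
  stopping level. The total is linear in \<open>log 2 (C / \<epsilon>)\<close>; the square in the
  bound comes from estimating this linear term. In \<open>C\<close> the factor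
  \<open>2 powr (3 / 2)\<close> is twice \<open>sqrt 2\<close>: the root comes from M (M + 1) \<le>
  2 M^2 in the decay estimate, and the whole factor keeps the logarithm at least 3/2, where the
  quadratic dominates.\<close>

definition sip :: "'a set \<Rightarrow> ('a \<Rightarrow> complex) \<Rightarrow> ('a \<Rightarrow> complex) \<Rightarrow> complex" where
  "sip S x y = (\<Sum>s\<in>S. cnj (x s) * y s)"

definition snorm :: "'a set \<Rightarrow> ('a \<Rightarrow> complex) \<Rightarrow> real" where
  "snorm S x = L2_set (\<lambda>s. cmod (x s)) S"

definition cross_gram :: "'a set \<Rightarrow> nat \<Rightarrow> (nat \<Rightarrow> 'a \<Rightarrow> complex) \<Rightarrow> (nat \<Rightarrow> 'a \<Rightarrow> complex) \<Rightarrow> complex mat" where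
  "cross_gram S N x y = Matrix.mat N N (\<lambda>(i, j). sip S (x i) (y j))"

lemma cross_gram_carrier [simp]: "cross_gram S N x y \<in> carrier_mat N N"
  by (simp add: cross_gram_def)

lemma snorm_nonneg [simp]: "snorm S x \<ge> 0"
  by (simp add: snorm_def L2_set_nonneg)

lemma sip_self: "sip S x x = of_real ((snorm S x)\<^sup>2)"
  by (simp add: sip_def snorm_def L2_set_def sum_nonneg complex_norm_square mult.commute del: of_real_power)

lemma sip_commute: "sip S y x = cnj (sip S x y)"
  by (simp add: sip_def mult.commute)

lemma sip_cauchy_schwarz: "cmod (sip S x y) \<le> snorm S x * snorm S y"
proof -
  have "cmod (sip S x y) \<le> (\<Sum>s\<in>S. cmod (x s) * cmod (y s))"
    unfolding sip_def by (rule order_trans[OF norm_sum]) (simp add: norm_mult)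
  also have "\<dots> \<le> snorm S x * snorm S y"
    unfolding snorm_def using L2_set_mult_ineq[of "\<lambda>s. cmod (x s)" "\<lambda>s. cmod (y s)" S] by simp
  finally show ?thesis .
qed

text \<open>Laplace expansion along column \<open>k\<close>: the cofactors do not see
  \<open>w\<close>. The witness carries a conjugate because \<open>sip\<close> is conjugate-linear
  on the left.\<close>

lemma det_cross_gram_linear:
  assumes k: "k < N"
  shows "\<exists>z. \<forall>w. Determinant.det (cross_gram S N x (y(k := w))) = sip S z w"
proof (intro exI allI)
  fix w
  define c where "c i = cofactor (cross_gram S N x y) i k" for i
  have cof: "cofactor (cross_gram S N x (y(k := w))) i k = c i" if "i < N" for i
  proof -
    have "mat_delete (cross_gram S N x (y(k := w))) i k = mat_delete (cross_gram S N x y) i k"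
      using that k by (intro eq_matI) (auto simp: mat_delete_def cross_gram_def)
    then show ?thesis by (simp add: c_def cofactor_def)
  qed
  have "Determinant.det (cross_gram S N x (y(k := w))) = (\<Sum>i<N. sip S (x i) w * c i)"
    by (subst laplace_expansion_column[OF cross_gram_carrier k], intro sum.cong refl)
       (use cof k in \<open>auto simp: cross_gram_def\<close>)
  also have "\<dots> = (\<Sum>s\<in>S. \<Sum>i<N. cnj (x i s) * w s * c i)"
    unfolding sip_def sum_distrib_right by (rule sum.swap)
  also have "\<dots> = sip S (\<lambda>s. cnj (\<Sum>i<N. cnj (x i s) * c i)) w"
    by (simp add: sip_def sum_distrib_left sum_distrib_right mult_ac)
  finally show "Determinant.det (cross_gram S N x (y(k := w))) = sip S (\<lambda>s. cnj (\<Sum>i<N. cnj (x i s) * c i)) w" .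
qed

text \<open>
  The determinant is a linear functional \<open>sip S z\<close> of its \<open>k\<close>-th column vector. It vanishes when that vector
  repeats another one, so \<open>z\<close> is orthogonal to the other vectors, and it is largest in the direction of \<open>z\<close>.
\<close>

lemma det_cross_gram_replace:
  assumes k: "k < N" and nz: "Determinant.det (cross_gram S N x y) \<noteq> 0"
  obtains u where "sip S u u = 1" "\<And>j. j < N \<Longrightarrow> j \<noteq> k \<Longrightarrow> sip S u (y j) = 0"
    "cmod (Determinant.det (cross_gram S N x y))
       \<le> snorm S (y k) * cmod (Determinant.det (cross_gram S N x (y(k := u))))"
proof -
  obtain z where z: "\<And>w. Determinant.det (cross_gram S N x (y(k := w))) = sip S z w"
    using det_cross_gram_linear[OF k] by blast
  have eq: "Determinant.det (cross_gram S N x y) = sip S z (y k)"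
    using z[of "y k"] by simp
  have le: "cmod (Determinant.det (cross_gram S N x y)) \<le> snorm S z * snorm S (y k)"
    unfolding eq by (rule sip_cauchy_schwarz)
  with nz have zpos: "snorm S z > 0"
    using snorm_nonneg[of S z] by (cases "snorm S z = 0") (auto simp: less_le)
  define u where "u = (\<lambda>s. z s / of_real (snorm S z))"
  have zu: "sip S z w = of_real (snorm S z) * sip S u w" for w
    using zpos by (simp add: sip_def u_def sum_distrib_left)
  have zz: "sip S z u = of_real (snorm S z)"
  proof -
    have "sip S z u = sip S z z / of_real (snorm S z)"
      by (simp add: sip_def u_def sum_divide_distrib)
    then show ?thesis using zpos by (simp add: sip_self power2_eq_square)
  qed
  show ?thesis
  proof
    show "sip S u u = 1" using zz zu[of u] zpos by simp
    show "sip S u (y j) = 0" if "j < N" "j \<noteq> k" for j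
    proof -
      have "Determinant.det (cross_gram S N x (y(k := y j))) = 0"
        by (rule det_identical_columns[OF cross_gram_carrier that(2) that(1) k])
           (use that k in \<open>auto simp: cross_gram_def intro!: eq_vecI\<close>)
      then have "sip S z (y j) = 0" using z by simp
      then show ?thesis using zu[of "y j"] zpos by simp
    qed
    show "cmod (Determinant.det (cross_gram S N x y))
       \<le> snorm S (y k) * cmod (Determinant.det (cross_gram S N x (y(k := u))))"
      using le zpos by (simp add: z zz mult.commute)
  qed
qed

text \<open>A replacement for Gram-Schmidt driven by the determinant: column \<open>n\<close>
  becomes a unit vector orthogonal to every other current column, so what was achieved for earlier
  columns persists, at the price of the factor \<open>snorm S (y n)\<close>. The inequality itself
  carries the nonvanishing of the determinant to the next step.\<close>

lemma det_cross_gram_orthonormalize_aux: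
  assumes nz: "Determinant.det (cross_gram S N x y) \<noteq> 0" and "n \<le> N"
  shows "\<exists>y'. (\<forall>j\<ge>n. y' j = y j) \<and> (\<forall>i<n. \<forall>j<N. sip S (y' i) (y' j) = (if i = j then 1 else 0)) \<and>
      cmod (Determinant.det (cross_gram S N x y))
        \<le> (\<Prod>j<n. snorm S (y j)) * cmod (Determinant.det (cross_gram S N x y'))"
  using \<open>n \<le> N\<close>
proof (induction n)
  case 0
  show ?case by (intro exI[of _ y]) auto
next
  case (Suc n)
  then obtain y' where y': "\<forall>j\<ge>n. y' j = y j"
     "\<forall>i<n. \<forall>j<N. sip S (y' i) (y' j) = (if i = j then 1 else 0)"
     "cmod (Determinant.det (cross_gram S N x y))
        \<le> (\<Prod>j<n. snorm S (y j)) * cmod (Determinant.det (cross_gram S N x y'))" by auto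
  have "Determinant.det (cross_gram S N x y') \<noteq> 0"
    using y'(3) nz by (auto simp del: zero_less_norm_iff)
  moreover have n: "n < N" using Suc.prems by simp
  ultimately obtain u where u: "sip S u u = 1" "\<And>j. j < N \<Longrightarrow> j \<noteq> n \<Longrightarrow> sip S u (y' j) = 0"
    "cmod (Determinant.det (cross_gram S N x y'))
       \<le> snorm S (y' n) * cmod (Determinant.det (cross_gram S N x (y'(n := u))))"
    using det_cross_gram_replace[of n N S x y'] by blast
  have u2: "sip S (y' j) u = 0" if "j < N" "j \<noteq> n" for j
    using u(2)[OF that] sip_commute[of S "y' j" u] by simp
  have "cmod (Determinant.det (cross_gram S N x y))
     \<le> (\<Prod>j<n. snorm S (y j)) * (snorm S (y' n) * cmod (Determinant.det (cross_gram S N x (y'(n := u)))))"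
    by (rule order_trans[OF y'(3)]) (intro mult_left_mono u(3) prod_nonneg, simp)
  then have "cmod (Determinant.det (cross_gram S N x y))
     \<le> (\<Prod>j<Suc n. snorm S (y j)) * cmod (Determinant.det (cross_gram S N x (y'(n := u))))"
    using y'(1) by (simp add: mult.assoc)
  moreover define y2 where "y2 = y'(n := u)"
  ultimately have le: "cmod (Determinant.det (cross_gram S N x y))
     \<le> (\<Prod>j<Suc n. snorm S (y j)) * cmod (Determinant.det (cross_gram S N x y2))" by simp
  have "\<forall>j\<ge>Suc n. y2 j = y j" using y'(1) by (simp add: y2_def)
  moreover have "\<forall>i<Suc n. \<forall>j<N. sip S (y2 i) (y2 j) = (if i = j then 1 else 0)"
    using y'(2) u(1,2) u2 n by (auto simp: y2_def less_Suc_eq)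
  ultimately show ?case using le by blast
qed

lemma det_cross_gram_orthonormalize:
  assumes "Determinant.det (cross_gram S N x y) \<noteq> 0"
  obtains y' where "\<And>i j. i < N \<Longrightarrow> j < N \<Longrightarrow> sip S (y' i) (y' j) = (if i = j then 1 else 0)"
    "cmod (Determinant.det (cross_gram S N x y))
        \<le> (\<Prod>j<N. snorm S (y j)) * cmod (Determinant.det (cross_gram S N x y'))"
  using det_cross_gram_orthonormalize_aux[OF assms order_refl] by blast

text \<open>\<open>w\<close> is the orthogonal projection of \<open>x\<close> onto the span of the
  \<open>y j\<close>. Both \<open>sip S x w\<close> and \<open>sip S w w\<close> equal the sum of
  the squared coefficients, so Cauchy-Schwarz for \<open>x\<close> and \<open>w\<close> leaves the
  claim after cancelling one factor \<open>t\<close>.\<close>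

lemma bessel_inequality:
  fixes N :: nat
  assumes on: "\<And>i j. i < N \<Longrightarrow> j < N \<Longrightarrow> sip S (y i) (y j) = (if i = j then 1 else 0)"
  shows "snorm {..<N} (\<lambda>j. sip S x (y j)) \<le> snorm S x"
proof -
  define c where "c j = sip S x (y j)" for j
  define w where "w = (\<lambda>s. \<Sum>j<N. cnj (c j) * y j s)"
  define t where "t = snorm {..<N} c"
  have lin: "sip S a w = (\<Sum>j<N. cnj (c j) * sip S a (y j))" for a
    unfolding sip_def w_def sum_distrib_left
    by (subst sum.swap) (simp add: mult_ac)
  have t2: "(\<Sum>j<N. cnj (c j) * c j) = of_real (t\<^sup>2)"
    using sip_self[of "{..<N}" c] by (simp add: sip_def t_def)
  have xw: "sip S x w = of_real (t\<^sup>2)"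
    unfolding lin t2[symmetric] c_def by simp
  have yw: "sip S w (y j) = c j" if "j < N" for j
  proof -
    have "sip S (y j) w = (\<Sum>i<N. if i = j then cnj (c i) else 0)"
      unfolding lin using that on by (intro sum.cong) auto
    also have "\<dots> = cnj (c j)" using that by simp
    finally show ?thesis using sip_commute[of S w "y j"] by simp
  qed
  have "sip S w w = of_real (t\<^sup>2)"
    unfolding lin t2[symmetric] using yw by simp
  then have "(snorm S w)\<^sup>2 = t\<^sup>2"
    using sip_self[of S w] by (simp only: of_real_eq_iff)
  then have wt: "snorm S w = t"
    by (simp add: t_def)
  have "t\<^sup>2 \<le> snorm S x * t"
    using sip_cauchy_schwarz[of S x w] unfolding xw wt by (simp add: norm_power del: of_real_power)
  then have "t \<le> snorm S x"
    using snorm_nonneg[of "{..<N}" c] by (cases "t = 0") (auto simp: power2_eq_square t_def[symmetric])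
  then show ?thesis by (simp add: t_def c_def[abs_def])
qed

lemma cmod_det_orthonormal_columns:
  assumes on: "\<And>i j. i < N \<Longrightarrow> j < N \<Longrightarrow> sip {..<N} (r i) (r j) = (if i = j then 1 else 0)"
  shows "cmod (Determinant.det (Matrix.mat N N (\<lambda>(s, j). r j s))) = 1"
proof -
  define R where "R = Matrix.mat N N (\<lambda>(s, j). r j s)"
  define R' where "R' = Matrix.mat N N (\<lambda>(i, s). cnj (r i s))"
  interpret cnj_hom: comm_ring_hom cnj by standard auto
  have R: "R \<in> carrier_mat N N" and R': "R' \<in> carrier_mat N N" by (auto simp: R_def R'_def)
  have "R' = map_mat cnj (R\<^sup>T)"
    by (intro eq_matI) (auto simp: R_def R'_def)
  then have d: "Determinant.det R' = cnj (Determinant.det R)"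
    using R by (simp add: det_transpose)
  have "R' * R = 1\<^sub>m N"
    using on by (intro eq_matI) (auto simp: R_def R'_def scalar_prod_def sip_def lessThan_atLeast0)
  then have "Determinant.det R' * Determinant.det R = 1"
    using det_mult[OF R' R] by simp
  then have "complex_of_real ((cmod (Determinant.det R))\<^sup>2) = of_real 1"
    unfolding d complex_norm_square by (simp add: mult.commute)
  then have "(cmod (Determinant.det R))\<^sup>2 = 1"
    by (simp only: of_real_eq_iff)
  then have "cmod (Determinant.det R) = 1"
    using norm_ge_zero[of "Determinant.det R"] unfolding power2_eq_1_iff by linarith
  then show ?thesis by (simp add: R_def)
qed

text \<open>The transpose of \<open>A\<close> is the cross-Gram matrix of the standard unit vectors
  with the rows of \<open>A\<close>. Orthonormalising the rows costs the product of their norms and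
  leaves a matrix with orthonormal columns, whose determinant has modulus 1.\<close>

lemma hadamard_rows:
  assumes A: "A \<in> carrier_mat N N"
  shows "cmod (Determinant.det A) \<le> (\<Prod>i<N. snorm {..<N} (\<lambda>j. A $$ (i, j)))"
proof (cases "Determinant.det A = 0")
  case True
  then show ?thesis by (simp add: prod_nonneg)
next
  case False
  define e :: "nat \<Rightarrow> nat \<Rightarrow> complex" where "e i s = (if s = i then 1 else 0)" for i s
  have sip_e: "sip {..<N} (e i) r = r i" if "i < N" for i r
  proof -
    have "sip {..<N} (e i) r = (\<Sum>s<N. if s = i then r s else 0)"
      unfolding sip_def e_def by (intro sum.cong) auto
    then show ?thesis using that by simp
  qed
  define r where "r i = (\<lambda>j. A $$ (i, j))" for i
  have At: "A\<^sup>T = cross_gram {..<N} N e r"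
    using A by (intro eq_matI) (auto simp: cross_gram_def sip_e r_def)
  then have "Determinant.det (cross_gram {..<N} N e r) \<noteq> 0"
    using False A by (metis det_transpose)
  then obtain r' where r': "\<And>i j. i < N \<Longrightarrow> j < N \<Longrightarrow> sip {..<N} (r' i) (r' j) = (if i = j then 1 else 0)"
    "cmod (Determinant.det (cross_gram {..<N} N e r))
        \<le> (\<Prod>j<N. snorm {..<N} (r j)) * cmod (Determinant.det (cross_gram {..<N} N e r'))"
    using det_cross_gram_orthonormalize by blast
  have "cross_gram {..<N} N e r' = Matrix.mat N N (\<lambda>(s, j). r' j s)"
    by (intro eq_matI) (auto simp: cross_gram_def sip_e)
  then have "cmod (Determinant.det (cross_gram {..<N} N e r')) = 1"
    using cmod_det_orthonormal_columns[of N r'] r'(1) by simp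
  then show ?thesis
    using r'(2) A unfolding At[symmetric] by (simp add: det_transpose r_def)
qed

text \<open>After orthonormalising the second family, Bessel bounds the norm of row \<open>i\<close>
  by \<open>snorm S (x i)\<close>, and Hadamard for rows applies. Passing through orthonormal
  vectors avoids any factor depending on \<open>N\<close> or \<open>S\<close>.\<close>

lemma cmod_det_cross_gram_le:
  "cmod (Determinant.det (cross_gram S N x y)) \<le> (\<Prod>i<N. snorm S (x i)) * (\<Prod>j<N. snorm S (y j))"
proof (cases "Determinant.det (cross_gram S N x y) = 0")
  case True
  then show ?thesis by (simp add: prod_nonneg)
next
  case False
  then obtain y' where y': "\<And>i j. i < N \<Longrightarrow> j < N \<Longrightarrow> sip S (y' i) (y' j) = (if i = j then 1 else 0)"
    "cmod (Determinant.det (cross_gram S N x y))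
        \<le> (\<Prod>j<N. snorm S (y j)) * cmod (Determinant.det (cross_gram S N x y'))"
    using det_cross_gram_orthonormalize by blast
  have "cmod (Determinant.det (cross_gram S N x y')) \<le> (\<Prod>i<N. snorm S (x i))"
  proof (rule order_trans[OF hadamard_rows[OF cross_gram_carrier]], intro prod_mono conjI)
    fix i assume i: "i \<in> {..<N}"
    have "snorm {..<N} (\<lambda>j. cross_gram S N x y' $$ (i, j)) = snorm {..<N} (\<lambda>j. sip S (x i) (y' j))"
      unfolding snorm_def using i by (intro L2_set_cong) (auto simp: cross_gram_def)
    also have "\<dots> \<le> snorm S (x i)" using y'(1) by (rule bessel_inequality)
    finally show "snorm {..<N} (\<lambda>j. cross_gram S N x y' $$ (i, j)) \<le> snorm S (x i)" .
  qed simp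
  then have "(\<Prod>j<N. snorm S (y j)) * cmod (Determinant.det (cross_gram S N x y'))
      \<le> (\<Prod>j<N. snorm S (y j)) * (\<Prod>i<N. snorm S (x i))"
    by (intro mult_left_mono prod_nonneg) auto
  with y'(2) show ?thesis by (simp add: mult.commute)
qed

lemma cmod_det_cross_gram_le_1:
  assumes "\<And>i. i < N \<Longrightarrow> snorm S (x i) \<le> 1" "\<And>i. i < N \<Longrightarrow> snorm S (y i) \<le> 1"
  shows "cmod (Determinant.det (cross_gram S N x y)) \<le> 1"
proof -
  have "(\<Prod>i<N. snorm S (x i)) \<le> 1" "(\<Prod>i<N. snorm S (y i)) \<le> 1"
    using assms by (auto intro!: prod_le_1)
  then have "(\<Prod>i<N. snorm S (x i)) * (\<Prod>j<N. snorm S (y j)) \<le> 1"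
    by (intro mult_le_one prod_nonneg) auto
  then show ?thesis using cmod_det_cross_gram_le order_trans by blast
qed

lemma det_cross_gram_perturb:
  assumes x: "\<And>i. i < N \<Longrightarrow> snorm S (x i) \<le> 1"
    and y: "\<And>i. i < N \<Longrightarrow> snorm S (y i) \<le> 1" and y': "\<And>i. i < N \<Longrightarrow> snorm S (y' i) \<le> 1"
    and d: "\<And>i. i < N \<Longrightarrow> snorm S (\<lambda>s. y i s - y' i s) \<le> \<eta>"
  shows "cmod (Determinant.det (cross_gram S N x y) - Determinant.det (cross_gram S N x y')) \<le> real N * \<eta>"
proof -
  define Y where "Y k = (\<lambda>j. if j < k then y' j else y j)" for k
  define D where "D k = Determinant.det (cross_gram S N x (Y k))" for k
  have step: "cmod (D k - D (Suc k)) \<le> \<eta>" if k: "k < N" for k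
  proof -
    obtain z where z: "\<And>w. Determinant.det (cross_gram S N x ((Y k)(k := w))) = sip S z w"
      using det_cross_gram_linear[OF k] by blast
    have e: "(Y k)(k := y k) = Y k" "(Y k)(k := y' k) = Y (Suc k)" by (auto simp: Y_def less_Suc_eq)
    \<comment> \<open>Two determinants that differ in column \<open>k\<close> only differ by a
      cross-Gram determinant with the difference vector as that column. All other columns have norm
      at most 1, so only the norm of the difference survives.\<close>
    have "D k - D (Suc k) = sip S z (\<lambda>s. y k s - y' k s)"
      using z[of "y k"] z[of "y' k"] unfolding e D_def by (simp add: sip_def sum_subtractf algebra_simps)
    also have "\<dots> = Determinant.det (cross_gram S N x ((Y k)(k := (\<lambda>s. y k s - y' k s))))" by (simp add: z)
    finally have eq: "D k - D (Suc k) = \<dots>" .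
    define V where "V = (Y k)(k := (\<lambda>s. y k s - y' k s))"
    have "cmod (D k - D (Suc k)) \<le> (\<Prod>i<N. snorm S (x i)) * (\<Prod>j<N. snorm S (V j))"
      unfolding eq V_def by (rule cmod_det_cross_gram_le)
    also have "\<dots> \<le> 1 * (\<Prod>j<N. snorm S (V j))"
      using x by (intro mult_right_mono prod_le_1 prod_nonneg) auto
    also have "(\<Prod>j<N. snorm S (V j)) = snorm S (V k) * (\<Prod>j\<in>{..<N}-{k}. snorm S (V j))"
      using k by (intro prod.remove) auto
    also have "\<dots> \<le> \<eta> * 1"
    proof (intro mult_mono prod_le_1 prod_nonneg conjI)
      show "snorm S (V k) \<le> \<eta>" using d[OF k] by (simp add: V_def)
      then show "0 \<le> \<eta>" using order_trans snorm_nonneg by blast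
      show "snorm S (V j) \<le> 1" if "j \<in> {..<N}-{k}" for j
        using that y y' by (auto simp: V_def Y_def)
    qed auto
    finally show ?thesis by simp
  qed
  have "cmod (D 0 - D n) \<le> real n * \<eta>" if "n \<le> N" for n
    using that
  proof (induction n)
    case (Suc n)
    have "cmod (D 0 - D (Suc n)) \<le> cmod (D 0 - D n) + cmod (D n - D (Suc n))"
      using norm_triangle_ineq[of "D 0 - D n" "D n - D (Suc n)"] by simp
    then show ?case using Suc step[of n] by (simp add: algebra_simps)
  qed simp
  from this[of N] have "cmod (D 0 - D N) \<le> real N * \<eta>" by simp
  moreover have "cross_gram S N x (Y N) = cross_gram S N x y'"
    by (intro eq_matI) (auto simp: cross_gram_def Y_def)
  ultimately show ?thesis by (simp add: D_def Y_def)
qed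

section \<open>Finitely supported sequences and their Fourier transforms\<close>


text \<open>Finite support collapses the infinite sums in \<open>l2inner\<close>, \<open>ft\<close>
  and \<open>conv\<close>, so no summability conditions arise. Filters preserve this class, whereas
  \<open>fmult theta_w\<close> does not.\<close>

definition fins :: "seq \<Rightarrow> bool" where
  "fins x \<longleftrightarrow> finite {n. x n \<noteq> 0}"

lemma infsum_eq_sum:
  assumes "finite S" "\<And>n. n \<notin> S \<Longrightarrow> g n = 0"
  shows "infsum g UNIV = sum g S"
proof -
  have "infsum g UNIV = infsum g S" using assms(2) by (intro infsum_cong_neutral) auto
  then show ?thesis using assms(1) by simp
qed

text \<open>One finite side is enough; the other may be an image under
  \<open>fmult theta_w\<close>.\<close>

lemma l2inner_eq_sip:
  assumes "finite S" "{n. x n \<noteq> 0} \<subseteq> S \<or> {n. y n \<noteq> 0} \<subseteq> S"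
  shows "l2inner x y = sip S x y"
  unfolding l2inner_def sip_def using assms by (intro infsum_eq_sum) auto

lemma l2norm_eq_snorm:
  assumes "finite S" "{n. x n \<noteq> 0} \<subseteq> S"
  shows "l2norm x = snorm S x"
proof -
  have "(\<Sum>\<^sub>\<infinity>n. (cmod (x n))\<^sup>2) = (\<Sum>n\<in>S. (cmod (x n))\<^sup>2)"
    using assms by (intro infsum_eq_sum) auto
  then show ?thesis by (simp add: l2norm_def snorm_def L2_set_def)
qed

lemma finsE:
  assumes "fins x" "fins y"
  obtains S where "finite S" "{n. x n \<noteq> 0} \<subseteq> S" "{n. y n \<noteq> 0} \<subseteq> S"
  using that[of "{n. x n \<noteq> 0} \<union> {n. y n \<noteq> 0}"] assms by (auto simp: fins_def)

lemma l2inner_cauchy_schwarz: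
  assumes "fins x" "fins y"
  shows "cmod (l2inner x y) \<le> l2norm x * l2norm y"
proof -
  obtain S where "finite S" "{n. x n \<noteq> 0} \<subseteq> S" "{n. y n \<noteq> 0} \<subseteq> S"
    using finsE[OF assms] by blast
  then show ?thesis
    using sip_cauchy_schwarz[of S x y] by (simp add: l2inner_eq_sip l2norm_eq_snorm)
qed

lemma l2inner_self:
  assumes "fins x" shows "l2inner x x = of_real ((l2norm x)\<^sup>2)"
proof -
  have S: "finite {n. x n \<noteq> 0}" using assms by (simp add: fins_def)
  show ?thesis
    unfolding l2inner_eq_sip[OF S disjI1[OF order_refl]] l2norm_eq_snorm[OF S order_refl] by (rule sip_self)
qed

lemma l2norm_nonneg [simp]: "l2norm x \<ge> 0"
  by (simp add: l2norm_def infsum_nonneg)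

lemma l2inner_commute:
  assumes "fins x \<or> fins y" shows "l2inner y x = cnj (l2inner x y)"
proof -
  obtain S where "finite S" "{n. x n \<noteq> 0} \<subseteq> S \<or> {n. y n \<noteq> 0} \<subseteq> S"
    using assms by (auto simp: fins_def)
  then show ?thesis using sip_commute[of S y x]
    using l2inner_eq_sip[of S x y] l2inner_eq_sip[of S y x] by auto
qed

lemma l2inner_add_right:
  assumes "fins x" shows "l2inner x (\<lambda>n. y n + z n) = l2inner x y + l2inner x z"
  using assms l2inner_eq_sip[of "{n. x n \<noteq> 0}" x] 
  by (simp add: fins_def sip_def sum.distrib algebra_simps)

lemma l2inner_diff_right:
  assumes "fins x" shows "l2inner x (\<lambda>n. y n - z n) = l2inner x y - l2inner x z"
  using assms l2inner_eq_sip[of "{n. x n \<noteq> 0}" x] 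
  by (simp add: fins_def sip_def sum_subtractf algebra_simps)

lemma l2inner_divide_right:
  assumes "fins x" shows "l2inner x (\<lambda>n. y n / c) = l2inner x y / c"
  using assms l2inner_eq_sip[of "{n. x n \<noteq> 0}" x] 
  by (simp add: fins_def sip_def sum_divide_distrib)

lemma l2inner_sum_right:
  assumes "fins x" shows "l2inner x (\<lambda>n. \<Sum>l\<in>A. y l n) = (\<Sum>l\<in>A. l2inner x (y l))"
  using assms l2inner_eq_sip[of "{n. x n \<noteq> 0}" x] 
  by (simp add: fins_def sip_def sum_distrib_left) (rule sum.swap)

lemma fins_add: "fins x \<Longrightarrow> fins y \<Longrightarrow> fins (\<lambda>n. x n + y n)"
  unfolding fins_def by (rule finite_subset[of _ "{n. x n \<noteq> 0} \<union> {n. y n \<noteq> 0}"]) auto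

lemma fins_divide: "fins x \<Longrightarrow> fins (\<lambda>n. x n / c)"
  unfolding fins_def by (rule finite_subset[of _ "{n. x n \<noteq> 0}"]) auto

lemma fins_zero [simp]: "fins (\<lambda>n. 0)"
  by (simp add: fins_def)

section \<open>Point masses, upsampling and downsampling\<close>

definition delta :: "int \<Rightarrow> seq" where
  "delta n = (\<lambda>m. if m = n then 1 else 0)"

lemma fins_delta [simp]: "fins (delta n)"
  by (simp add: fins_def delta_def)

lemma l2inner_delta: "l2inner (delta n) x = x n"
  by (subst l2inner_eq_sip[of "{n}"]) (auto simp: sip_def delta_def)

lemma fins_up: assumes "fins x" shows "fins (up x)"
proof -
  have "{n. up x n \<noteq> 0} \<subseteq> (\<lambda>n. 2 * n) ` {n. x n \<noteq> 0}"
  proof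
    fix n assume "n \<in> {n. up x n \<noteq> 0}"
    then show "n \<in> (\<lambda>n. 2 * n) ` {n. x n \<noteq> 0}"
      by (intro image_eqI[of _ _ "n div 2"]) (auto simp: up_def split: if_splits)
  qed
  then show ?thesis using assms unfolding fins_def by (blast intro: finite_subset)
qed

lemma fins_down: assumes "fins x" shows "fins (down x)"
proof -
  have "{n. down x n \<noteq> 0} = (\<lambda>n. 2 * n) -` {n. x n \<noteq> 0}" by (auto simp: down_def)
  moreover have "finite ((\<lambda>n. 2 * n) -` {n. x n \<noteq> 0})"
    using assms by (intro finite_vimageI) (auto simp: fins_def inj_on_def)
  ultimately show ?thesis by (simp only: fins_def)
qed

lemma down_up [simp]: "down (up x) = x"
  by (simp add: down_def up_def fun_eq_iff)

lemma l2inner_up_left: "l2inner (up x) y = l2inner x (down y)"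
proof -
  have "l2inner (up x) y = infsum (\<lambda>n. cnj (up x n) * y n) (range (\<lambda>n. 2 * n))"
    unfolding l2inner_def by (intro infsum_cong_neutral) (auto simp: up_def elim!: evenE)
  also have "\<dots> = l2inner x (down y)"
    unfolding l2inner_def by (subst infsum_reindex) (auto simp: inj_on_def o_def up_def down_def)
  finally show ?thesis .
qed

lemma l2inner_up_right: "l2inner y (up x) = l2inner (down y) x"
proof -
  have "l2inner y (up x) = infsum (\<lambda>n. cnj (y n) * up x n) (range (\<lambda>n. 2 * n))"
    unfolding l2inner_def by (intro infsum_cong_neutral) (auto simp: up_def elim!: evenE)
  also have "\<dots> = l2inner (down y) x"
    unfolding l2inner_def by (subst infsum_reindex) (auto simp: inj_on_def o_def up_def down_def)
  finally show ?thesis .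
qed

lemma l2inner_up_up: "l2inner (up x) (up y) = l2inner x y"
  by (simp add: l2inner_up_left)

lemma l2norm_up: assumes "fins x" shows "l2norm (up x) = l2norm x"
proof -
  have "complex_of_real ((l2norm (up x))\<^sup>2) = of_real ((l2norm x)\<^sup>2)"
    using l2inner_self[OF fins_up[OF assms]] l2inner_self[OF assms] l2inner_up_up[of x x]
    by simp
  then show ?thesis by (simp only: of_real_eq_iff) (simp add: power2_eq_iff_nonneg)
qed

section \<open>Fourier transforms of finitely supported sequences\<close>

lemma ft_eq_sum:
  assumes "finite S" "{n. x n \<noteq> 0} \<subseteq> S"
  shows "ft x k = (\<Sum>n\<in>S. x n * exp (- \<i> * of_real (of_int n * k)))"
  unfolding ft_def using assms by (intro infsum_eq_sum) auto

lemma exp_int_periodic: "exp (- \<i> * of_real (of_int n * (k + 2 * pi))) = exp (- \<i> * of_real (of_int n * k))"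
proof -
  have "exp (- \<i> * of_real (of_int n * (k + 2 * pi)))
      = exp (- \<i> * of_real (of_int n * k)) * exp (of_int (2 * (- n)) * of_real pi * \<i>)"
    unfolding exp_add[symmetric] by (rule arg_cong[where f = exp]) (simp add: algebra_simps)
  also have "exp (of_int (2 * (- n)) * of_real pi * \<i>) = 1"
    using exp_integer_2pi[of "of_int (- n)"] by (simp add: algebra_simps)
  finally show ?thesis by simp
qed

lemma ft_periodic:
  assumes "fins x" shows "ft x (k + 2 * pi) = ft x k"
  using ft_eq_sum[of "{n. x n \<noteq> 0}" x] assms by (simp only: exp_int_periodic fins_def)

lemma exp_int_pi: "exp (- \<i> * of_real (of_int n * (k + pi))) = sgnpow n * exp (- \<i> * of_real (of_int n * k))"
proof -
  have "exp (- \<i> * of_real (of_int n * (k + pi)))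
      = exp (- \<i> * of_real (of_int n * k)) * cis (- (of_int n * pi))"
    unfolding cis_conv_exp exp_add[symmetric] by (rule arg_cong[where f = exp]) (simp add: algebra_simps)
  also have "cis (- (of_int n * pi)) = sgnpow n"
    using cos_int_times_real[of n pi] by (auto simp: complex_eq_iff sgnpow_def cos_npi_int sin_npi_int mult.commute)
  finally show ?thesis by simp
qed

lemma sgnpow_simps [simp]: "sgnpow n * sgnpow n = 1" "cnj (sgnpow n) = sgnpow n" "sgnpow n \<noteq> 0"
  by (auto simp: sgnpow_def)

lemma fins_sgnpow: "fins x \<Longrightarrow> fins (\<lambda>n. sgnpow n * x n)"
  by (simp add: fins_def)

lemma ft_shift_pi:
  assumes "fins x" shows "ft x (k + pi) = ft (\<lambda>n. sgnpow n * x n) k"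
proof -
  let ?S = "{n. x n \<noteq> 0}"
  have S: "finite ?S" using assms by (simp add: fins_def)
  show ?thesis
    unfolding ft_eq_sum[OF S order_refl]
    by (subst ft_eq_sum[OF S]) (auto simp: exp_int_pi[simplified] mult_ac intro!: sum.cong)
qed

lemma ft_add: 
  assumes "fins x" "fins y" shows "ft (\<lambda>n. x n + y n) k = ft x k + ft y k"
proof -
  obtain S where S: "finite S" "{n. x n \<noteq> 0} \<subseteq> S" "{n. y n \<noteq> 0} \<subseteq> S"
    using finsE[OF assms] by blast
  have "{n. x n + y n \<noteq> 0} \<subseteq> {n. x n \<noteq> 0} \<union> {n. y n \<noteq> 0}" by auto
  then have "{n. x n + y n \<noteq> 0} \<subseteq> S" using S(2,3) by blast
  then show ?thesis using S by (simp add: ft_eq_sum[of S] sum.distrib algebra_simps)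
qed

lemma ft_divide: 
  assumes "fins x" shows "ft (\<lambda>n. x n / c) k = ft x k / c"
proof -
  have S: "finite {n. x n \<noteq> 0}" using assms by (simp add: fins_def)
  then show ?thesis
    by (subst (1 2) ft_eq_sum[OF S]) (auto simp: sum_divide_distrib)
qed

lemma up_down: "up (down x) = (\<lambda>n. (x n + sgnpow n * x n) / 2)"
  by (auto simp: up_def down_def sgnpow_def fun_eq_iff)

lemma ft_up_down:
  assumes "fins x" shows "ft (up (down x)) k = (ft x k + ft x (k + pi)) / 2"
  using assms fins_sgnpow[OF assms] fins_add[OF assms fins_sgnpow[OF assms]]
  by (simp add: up_down ft_divide ft_add ft_shift_pi)

lemma ft_cnj:
  assumes "fins h"
  shows "cnj (ft h k) = ft (\<lambda>n. cnj (h (- n))) k" and "fins (\<lambda>n. cnj (h (- n)))"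
proof -
  let ?S = "{n. h n \<noteq> 0}"
  have S: "finite ?S" using assms by (simp add: fins_def)
  have sub: "{n. cnj (h (- n)) \<noteq> 0} \<subseteq> uminus ` ?S"
    by (auto intro!: image_eqI[of _ uminus "- _"])
  then show "fins (\<lambda>n. cnj (h (- n)))" using S unfolding fins_def by (blast intro: finite_subset)
  have "ft (\<lambda>n. cnj (h (- n))) k = (\<Sum>n\<in>uminus ` ?S. cnj (h (- n)) * exp (- \<i> * of_real (of_int n * k)))"
    using S sub by (intro ft_eq_sum) auto
  also have "\<dots> = (\<Sum>n\<in>?S. cnj (h n * exp (- \<i> * of_real (of_int n * k))))"
    by (subst sum.reindex) (auto simp: exp_cnj)
  also have "\<dots> = cnj (ft h k)" unfolding cnj_sum[symmetric] using S by (subst ft_eq_sum[OF S]) auto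
  finally show "cnj (ft h k) = ft (\<lambda>n. cnj (h (- n))) k" ..
qed

lemma ft_shift:
  assumes "fins h"
  shows "exp (\<i> * of_real k) * ft h k = ft (\<lambda>n. h (n + 1)) k" and "fins (\<lambda>n. h (n + 1))"
proof -
  let ?S = "{n. h n \<noteq> 0}"
  have S: "finite ?S" using assms by (simp add: fins_def)
  have sub: "{n. h (n + 1) \<noteq> 0} \<subseteq> (\<lambda>n. n - 1) ` ?S"
    by (auto intro!: image_eqI[of _ _ "_ + 1"])
  then show "fins (\<lambda>n. h (n + 1))" using S unfolding fins_def by (blast intro: finite_subset)
  have "ft (\<lambda>n. h (n + 1)) k = (\<Sum>n\<in>(\<lambda>n. n - 1) ` ?S. h (n + 1) * exp (- \<i> * of_real (of_int n * k)))"
    using S sub by (intro ft_eq_sum) auto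
  also have "\<dots> = (\<Sum>n\<in>?S. exp (\<i> * of_real k) * (h n * exp (- \<i> * of_real (of_int n * k))))"
    by (subst sum.reindex) (auto simp: inj_on_def exp_add[symmetric] algebra_simps intro!: sum.cong)
  also have "\<dots> = exp (\<i> * of_real k) * ft h k"
    unfolding sum_distrib_left[symmetric] by (subst ft_eq_sum[OF S]) auto
  finally show "exp (\<i> * of_real k) * ft h k = ft (\<lambda>n. h (n + 1)) k" ..
qed

text \<open>Symbols of finite filters, that is, trigonometric polynomials. They are closed under
  conjugation and their multipliers keep sequences finitely supported, so adjoints can be read off
  from transforms.\<close>

definition trig :: "(real \<Rightarrow> complex) \<Rightarrow> bool" where
  "trig \<theta> \<longleftrightarrow> (\<exists>c. fins c \<and> \<theta> = ft c)"

lemma trig_ft: "fins h \<Longrightarrow> trig (ft h)"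
  by (auto simp: trig_def)

lemma trig_cnj: "trig \<theta> \<Longrightarrow> trig (\<lambda>k. cnj (\<theta> k))"
  unfolding trig_def using ft_cnj by (metis (no_types, lifting) ext)

lemma trig_wft: assumes "fins h" shows "trig (wft h)"
proof -
  have "wft h = (\<lambda>k. exp (\<i> * of_real k) * ft (\<lambda>n. cnj (sgnpow (- n) * h (- n))) k)"
    using assms by (simp add: wft_def fun_eq_iff ft_shift_pi ft_cnj(1)[OF fins_sgnpow])
  then show ?thesis
    using ft_shift[OF ft_cnj(2)[OF fins_sgnpow[OF assms]]] unfolding trig_def by (metis (no_types, lifting) ext)
qed


section \<open>Fourier coefficients and multipliers in weak form\<close>

lemma has_integral_exp_real:
  assumes "\<alpha> \<noteq> 0" "a \<le> b"
  shows "((\<lambda>k. exp (\<i> * of_real (\<alpha> * k))) has_integral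
    (exp (\<i> * of_real (\<alpha> * b)) - exp (\<i> * of_real (\<alpha> * a))) / (\<i> * of_real \<alpha>)) {a..b}"
proof -
  have "((\<lambda>k. exp (\<i> * of_real (\<alpha> * k)) / (\<i> * of_real \<alpha>)) has_vector_derivative exp (\<i> * of_real (\<alpha> * x)))
      (at x within {a..b})" for x
  proof -
    have "((\<lambda>z. exp (\<i> * (of_real \<alpha> * z)) / (\<i> * of_real \<alpha>)) has_field_derivative exp (\<i> * (of_real \<alpha> * of_real x)))
      (at (of_real x))"
      using assms(1) by (auto intro!: derivative_eq_intros simp: field_simps)
    then have "((\<lambda>k. exp (\<i> * (of_real \<alpha> * of_real k)) / (\<i> * of_real \<alpha>)) has_vector_derivative exp (\<i> * (of_real \<alpha> * of_real x)))
      (at x within {a..b})"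
      by (rule has_vector_derivative_real_field)
    then show ?thesis by simp
  qed
  from fundamental_theorem_of_calculus[OF assms(2) this] show ?thesis
    by (simp add: diff_divide_distrib)
qed

lemma exp_i_pi_int: "exp (\<i> * of_real (of_int n * pi)) = sgnpow n"
  using exp_int_pi[of "-n" 0] by (simp add: sgnpow_def)

lemma exp_i_minus_pi_int: "exp (- (\<i> * of_real (of_int n * pi))) = sgnpow n"
  using exp_int_pi[of n 0] by simp

lemma has_integral_exp_int:
  "((\<lambda>k. exp (\<i> * of_real (of_int n * k))) has_integral (if n = 0 then of_real (2 * pi) else 0)) {-pi..pi}"
proof (cases "n = 0")
  case True
  then show ?thesis using has_integral_const_real[of "1 :: complex" "-pi" pi] by (simp add: scaleR_conv_of_real)
next
  case False
  show ?thesis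
    using False has_integral_exp_real[of "of_int n" "-pi" pi] exp_i_pi_int[of n] exp_i_minus_pi_int[of n] by simp
qed

lemma fcoeff_moment:
  assumes "((\<lambda>k. \<theta> k * exp (\<i> * of_real (of_int n * k))) has_integral \<mu>) {-pi..pi}"
  shows "fcoeff \<theta> n = \<mu> / of_real (2 * pi)"
  using integral_unique[OF assms] by (simp add: fcoeff_def)

lemma conv_eq_sum:
  assumes "finite S" "{n. x n \<noteq> 0} \<subseteq> S"
  shows "conv c x n = (\<Sum>j\<in>S. c (n - j) * x j)"
  unfolding conv_def using assms by (intro infsum_eq_sum) auto

text \<open>Weak form of the multiplier rule: it asks only for the moments of the symbol, and
  \<open>fmult \<theta> y\<close> itself is never Fourier transformed. This covers
  \<open>theta_w\<close>, where the series defining \<open>ft\<close> of the image need not be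
  summable.\<close>

lemma has_integral_fmult:
  assumes int: "\<And>n. (\<lambda>k. \<theta> k * exp (\<i> * of_real (of_int n * k))) integrable_on {-pi..pi}"
    and x: "fins x" and y: "fins y"
  shows "((\<lambda>k. cnj (ft x k) * (\<theta> k * ft y k)) has_integral of_real (2 * pi) * l2inner x (fmult \<theta> y)) {-pi..pi}"
proof -
  obtain S where S: "finite S" "{n. x n \<noteq> 0} \<subseteq> S" "{n. y n \<noteq> 0} \<subseteq> S"
    using finsE[OF x y] by blast
  have mom: "((\<lambda>k. \<theta> k * exp (\<i> * of_real (of_int n * k))) has_integral of_real (2 * pi) * fcoeff \<theta> n) {-pi..pi}" for n
    using fcoeff_moment[OF integrable_integral[OF int[of n]]] integrable_integral[OF int[of n]] by simp
  have "((\<lambda>k. \<Sum>n\<in>S. \<Sum>m\<in>S. cnj (x n) * y m * (\<theta> k * exp (\<i> * of_real (of_int (n - m) * k)))) has_integral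
     (\<Sum>n\<in>S. \<Sum>m\<in>S. cnj (x n) * y m * (of_real (2 * pi) * fcoeff \<theta> (n - m)))) {-pi..pi}"
    using S(1) by (intro has_integral_sum has_integral_mult_right mom) auto
  moreover have "(\<Sum>n\<in>S. \<Sum>m\<in>S. cnj (x n) * y m * (\<theta> k * exp (\<i> * of_real (of_int (n - m) * k))))
     = cnj (ft x k) * (\<theta> k * ft y k)" for k
  proof -
    have "cnj (x n) * y m * (\<theta> k * exp (\<i> * of_real (of_int (n - m) * k)))
      = cnj (x n * exp (- \<i> * of_real (of_int n * k))) * (\<theta> k * (y m * exp (- \<i> * of_real (of_int m * k))))" for n m
      by (simp add: exp_cnj left_diff_distrib right_diff_distrib exp_diff exp_minus divide_inverse)
    then show ?thesis
      by (simp only: ft_eq_sum[OF S(1,2)] ft_eq_sum[OF S(1,3)] sum_distrib_left sum_distrib_right cnj_sum)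
         (rule sum.swap)
  qed
  moreover have "(\<Sum>n\<in>S. \<Sum>m\<in>S. cnj (x n) * y m * (of_real (2 * pi) * fcoeff \<theta> (n - m)))
     = of_real (2 * pi) * l2inner x (fmult \<theta> y)"
    using S by (simp add: l2inner_eq_sip sip_def fmult_def conv_eq_sum sum_distrib_left mult_ac)
  ultimately show ?thesis by simp
qed

lemma fcoeff_ft:
  assumes "fins c" shows "fcoeff (ft c) = c"
    and "(\<lambda>k. ft c k * exp (\<i> * of_real (of_int n * k))) integrable_on {-pi..pi}"
proof -
  let ?S = "{n. c n \<noteq> 0}"
  have S: "finite ?S" using assms by (simp add: fins_def)
  have "((\<lambda>k. \<Sum>m\<in>?S. c m * exp (\<i> * of_real (of_int (n - m) * k))) has_integral
      (\<Sum>m\<in>?S. c m * (if n - m = 0 then of_real (2 * pi) else 0))) {-pi..pi}" for n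
    by (intro has_integral_sum has_integral_mult_right has_integral_exp_int S)
  moreover have "(\<Sum>m\<in>?S. c m * exp (\<i> * of_real (of_int (n - m) * k))) = ft c k * exp (\<i> * of_real (of_int n * k))" for n k
    unfolding ft_eq_sum[OF S order_refl] sum_distrib_right
    by (intro sum.cong refl) (simp add: left_diff_distrib right_diff_distrib exp_diff exp_minus divide_inverse)
  moreover have "(\<Sum>m\<in>?S. c m * (if n - m = 0 then of_real (2 * pi) else 0)) = of_real (2 * pi) * c n" for n
  proof -
    have "(\<Sum>m\<in>?S. c m * (if n - m = 0 then of_real (2 * pi) else 0)) = (\<Sum>m\<in>?S. if m = n then of_real (2 * pi) * c m else 0)"
      by (intro sum.cong) auto
    then show ?thesis using S by simp
  qed
  ultimately have m: "((\<lambda>k. ft c k * exp (\<i> * of_real (of_int n * k))) has_integral of_real (2 * pi) * c n) {-pi..pi}" for n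
    by simp
  show "fcoeff (ft c) = c" using fcoeff_moment[OF m] by (simp add: fun_eq_iff)
  show "(\<lambda>k. ft c k * exp (\<i> * of_real (of_int n * k))) integrable_on {-pi..pi}"
    using m by (auto simp: integrable_on_def)
qed

lemma ft_shift_int:
  assumes "fins c"
  shows "ft (\<lambda>n. c (n - j)) k = exp (- \<i> * of_real (of_int j * k)) * ft c k" and "fins (\<lambda>n. c (n - j))"
proof -
  let ?S = "{n. c n \<noteq> 0}"
  have S: "finite ?S" using assms by (simp add: fins_def)
  have sub: "{n. c (n - j) \<noteq> 0} \<subseteq> (\<lambda>n. n + j) ` ?S"
    by (auto intro!: image_eqI[of _ _ "_ - j"])
  then show "fins (\<lambda>n. c (n - j))" using S unfolding fins_def by (blast intro: finite_subset)
  have "ft (\<lambda>n. c (n - j)) k = (\<Sum>n\<in>(\<lambda>n. n + j) ` ?S. c (n - j) * exp (- \<i> * of_real (of_int n * k)))"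
    using S sub by (intro ft_eq_sum) auto
  also have "\<dots> = (\<Sum>n\<in>?S. exp (- \<i> * of_real (of_int j * k)) * (c n * exp (- \<i> * of_real (of_int n * k))))"
    by (subst sum.reindex) (auto simp: inj_on_def distrib_left distrib_right exp_add exp_minus intro!: sum.cong)
  also have "\<dots> = exp (- \<i> * of_real (of_int j * k)) * ft c k"
    unfolding sum_distrib_left[symmetric] ft_eq_sum[OF S order_refl] ..
  finally show "ft (\<lambda>n. c (n - j)) k = exp (- \<i> * of_real (of_int j * k)) * ft c k" .
qed

lemma ft_cmult: assumes "fins c" shows "ft (\<lambda>n. a * c n) k = a * ft c k" "fins (\<lambda>n. a * c n)"
proof -
  have S: "finite {n. c n \<noteq> 0}" using assms by (simp add: fins_def)
  show "fins (\<lambda>n. a * c n)" unfolding fins_def by (rule finite_subset[OF _ S]) auto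
  show "ft (\<lambda>n. a * c n) k = a * ft c k"
    by (subst (1 2) ft_eq_sum[OF S]) (auto simp: sum_distrib_left mult.assoc)
qed

lemma ft_sum:
  assumes "finite S" "\<And>j. j \<in> S \<Longrightarrow> fins (g j)"
  shows "fins (\<lambda>n. \<Sum>j\<in>S. g j n) \<and> ft (\<lambda>n. \<Sum>j\<in>S. g j n) k = (\<Sum>j\<in>S. ft (g j) k)"
  using assms
proof (induction S rule: finite_induct)
  case empty
  have "ft (\<lambda>n. 0) k = 0" by (simp add: ft_def)
  then show ?case by simp
next
  case (insert x F)
  then show ?case by (simp add: ft_add fins_add)
qed

lemma fmult_trig:
  assumes "trig \<theta>" "fins x"
  shows "fins (fmult \<theta> x)" and "ft (fmult \<theta> x) k = \<theta> k * ft x k"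
    and "(\<lambda>k. \<theta> k * exp (\<i> * of_real (of_int n * k))) integrable_on {-pi..pi}"
proof -
  obtain c where c: "fins c" "\<theta> = ft c" using assms(1) by (auto simp: trig_def)
  let ?S = "{n. x n \<noteq> 0}"
  have S: "finite ?S" using assms by (simp add: fins_def)
  have eq: "fmult \<theta> x = (\<lambda>n. \<Sum>j\<in>?S. x j * c (n - j))"
    using conv_eq_sum[OF S order_refl] by (simp add: fmult_def c fcoeff_ft fun_eq_iff mult.commute)
  have fin: "fins (\<lambda>n. x j * c (n - j))" for j
    by (intro ft_cmult ft_shift_int c)
  show "fins (fmult \<theta> x)" unfolding eq using ft_sum[OF S, of "\<lambda>j n. x j * c (n - j)"] fin by simp
  show "ft (fmult \<theta> x) k = \<theta> k * ft x k"
    unfolding eq using ft_sum[OF S, of "\<lambda>j n. x j * c (n - j)"] fin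
    by (simp add: ft_cmult ft_shift_int c ft_eq_sum[OF S order_refl] sum_distrib_left mult_ac)
  show "(\<lambda>k. \<theta> k * exp (\<i> * of_real (of_int n * k))) integrable_on {-pi..pi}"
    unfolding c(2) by (rule fcoeff_ft(2)[OF c(1)])
qed

lemma trig_1: "trig (\<lambda>k. 1)" and fmult_1: "fins x \<Longrightarrow> fmult (\<lambda>k. 1) x = x"
proof -
  have d: "ft (delta 0) = (\<lambda>k. 1)"
    by (rule ext, subst ft_eq_sum[of "{0}"]) (auto simp: delta_def)
  then show "trig (\<lambda>k. 1)" unfolding trig_def by (metis fins_delta)
  assume x: "fins x"
  show "fmult (\<lambda>k. 1) x = x"
  proof
    fix n
    have S: "finite {n. x n \<noteq> 0}" using x by (simp add: fins_def)
    have "conv (delta 0) x n = (\<Sum>j\<in>{n. x n \<noteq> 0}. if j = n then x j else 0)"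
      unfolding conv_eq_sum[OF S order_refl] by (intro sum.cong) (auto simp: delta_def)
    then show "fmult (\<lambda>k. 1) x n = x n"
      using S unfolding fmult_def d[symmetric] fcoeff_ft(1)[OF fins_delta] by simp
  qed
qed

text \<open>The multiplier rule for the constant symbol 1, whose multiplier is the identity.\<close>

lemma parseval:
  assumes "fins x" "fins y"
  shows "((\<lambda>k. cnj (ft x k) * ft y k) has_integral of_real (2 * pi) * l2inner x y) {-pi..pi}"
  using has_integral_fmult[OF fmult_trig(3)[OF trig_1 fins_zero] assms] assms by (simp add: fmult_1)

lemma has_integral_unique_2pi:
  assumes "(F has_integral of_real (2 * pi) * a) {-pi..pi}" "(F has_integral of_real (2 * pi) * b) {-pi..pi}"
  shows "a = (b :: complex)"
  using has_integral_unique[OF assms] by simp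

lemma l2inner_fmult_left:
  assumes "trig \<theta>" "fins x" "fins y"
  shows "l2inner x (fmult \<theta> y) = l2inner (fmult (\<lambda>k. cnj (\<theta> k)) x) y"
proof (rule has_integral_unique_2pi)
  show "((\<lambda>k. cnj (ft x k) * (\<theta> k * ft y k)) has_integral of_real (2 * pi) * l2inner x (fmult \<theta> y)) {-pi..pi}"
    using parseval[OF assms(2) fmult_trig(1)[OF assms(1,3)]] assms by (simp add: fmult_trig)
  show "((\<lambda>k. cnj (ft x k) * (\<theta> k * ft y k)) has_integral of_real (2 * pi) * l2inner (fmult (\<lambda>k. cnj (\<theta> k)) x) y) {-pi..pi}"
    using parseval[OF fmult_trig(1)[OF trig_cnj[OF assms(1)] assms(2)] assms(3)] assms
    by (simp add: fmult_trig trig_cnj mult_ac)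
qed

lemma fins_msup: "trig \<theta> \<Longrightarrow> fins x \<Longrightarrow> fins (msup \<theta> x)"
  by (simp add: msup_def fmult_trig fins_up)

lemma fins_msup_adj: "trig \<theta> \<Longrightarrow> fins x \<Longrightarrow> fins (msup_adj \<theta> x)"
  by (simp add: msup_adj_def fmult_trig fins_down trig_cnj)

lemma ft_msup: "trig \<theta> \<Longrightarrow> fins x \<Longrightarrow> ft (msup \<theta> x) k = \<theta> k * ft (up x) k"
  by (simp add: msup_def fmult_trig fins_up)

lemma l2inner_msup:
  assumes "trig \<theta>" "fins x" "fins y"
  shows "l2inner y (msup \<theta> x) = l2inner (msup_adj \<theta> y) x"
  using assms by (simp add: msup_def msup_adj_def l2inner_fmult_left fins_up l2inner_up_right)

lemma wft_shift_pi: "fins h \<Longrightarrow> wft h (k + pi) = - (exp (\<i> * of_real k) * cnj (ft h k))"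
  using ft_periodic[of h k] by (simp add: wft_def exp_add algebra_simps)

text \<open>
  Downsampling averages a Fourier transform over \<open>k\<close> and \<open>k + pi\<close>; the aliasing terms of the two filters cancel.
\<close>

lemma qmf_decomposition:
  assumes h: "fins h" and qmf: "\<And>k. (cmod (ft h k))\<^sup>2 + (cmod (ft h (k + pi)))\<^sup>2 = 2"
    and x: "fins x" and y: "fins y"
  shows "l2inner (msup_adj (ft h) x) (msup_adj (ft h) y) + l2inner (msup_adj (wft h) x) (msup_adj (wft h) y)
    = l2inner x y"
proof -
  define X where "X \<theta> k = (cnj (\<theta> k) * ft x k + cnj (\<theta> (k + pi)) * ft x (k + pi)) / 2" for \<theta> k
  define Y where "Y \<theta> k = (cnj (\<theta> k) * ft y k + cnj (\<theta> (k + pi)) * ft y (k + pi)) / 2" for \<theta> k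
  \<comment> \<open>Upsampling preserves inner products, so downsampled sequences may be paired
    after upsampling them again; \<open>ft_up_down\<close> then produces the averages
    \<open>X\<close> and \<open>Y\<close>.\<close>
  have one: "((\<lambda>k. cnj (X \<theta> k) * Y \<theta> k) has_integral of_real (2 * pi) * l2inner (msup_adj \<theta> x) (msup_adj \<theta> y)) {-pi..pi}"
    if t: "trig \<theta>" for \<theta>
  proof -
    have f: "fins (msup_adj \<theta> x)" "fins (msup_adj \<theta> y)" using t x y fins_msup_adj by auto
    have "ft (up (msup_adj \<theta> x)) k = X \<theta> k" "ft (up (msup_adj \<theta> y)) k = Y \<theta> k" for k
      using t x y by (simp_all add: msup_adj_def ft_up_down fmult_trig trig_cnj X_def Y_def)
    then show ?thesis
      using parseval[OF fins_up[OF f(1)] fins_up[OF f(2)]] by (simp add: l2inner_up_up f)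
  qed
  \<comment> \<open>The right-hand side is brought to the same symmetric shape: modulation by
    \<open>sgnpow\<close> preserves \<open>l2inner\<close> and shifts transforms by
    \<open>pi\<close>.\<close>
  have two: "((\<lambda>k. (cnj (ft x k) * ft y k + cnj (ft x (k + pi)) * ft y (k + pi)) / 2) has_integral of_real (2 * pi) * l2inner x y) {-pi..pi}"
  proof -
    have "l2inner (\<lambda>n. sgnpow n * x n) (\<lambda>n. sgnpow n * y n) = l2inner x y"
      unfolding l2inner_def by (intro infsum_cong) (auto simp: sgnpow_def)
    then have "((\<lambda>k. cnj (ft x (k + pi)) * ft y (k + pi)) has_integral of_real (2 * pi) * l2inner x y) {-pi..pi}"
      using parseval[OF fins_sgnpow[OF x] fins_sgnpow[OF y]] by (simp add: ft_shift_pi x y)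
    from has_integral_divide[OF has_integral_add[OF parseval[OF x y] this], of 2] show ?thesis by (simp add: mult.assoc)
  qed
  have "cnj (X (ft h) k) * Y (ft h) k + cnj (X (wft h) k) * Y (wft h) k
      = (cnj (ft x k) * ft y k + cnj (ft x (k + pi)) * ft y (k + pi)) / 2" for k
  proof -
    define a where "a = ft h k"
    define b where "b = ft h (k + pi)"
    define e where "e = exp (\<i> * of_real k)"
    have ab: "a * cnj a + b * cnj b = 2"
      using arg_cong[OF qmf[of k], of complex_of_real] unfolding a_def b_def of_real_add complex_norm_square by simp
    have e: "e * cnj e = 1" by (simp add: e_def exp_cnj exp_add[symmetric])
    have w: "wft h k = e * cnj b" "wft h (k + pi) = - (e * cnj a)"
      by (simp_all add: wft_shift_pi[OF h]) (simp_all add: wft_def a_def b_def e_def)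
    define p q r t where "p = cnj (ft x k)" "q = cnj (ft x (k + pi))" "r = ft y k" "t = ft y (k + pi)"
    have "cnj (X (ft h) k) * Y (ft h) k = (a * p + b * q) * (cnj a * r + cnj b * t) / 4"
      by (simp add: X_def Y_def a_def b_def p_q_r_t_def)
    moreover have "cnj (X (wft h) k) * Y (wft h) k = (e * cnj e) * ((cnj b * p - cnj a * q) * (b * r - a * t)) / 4"
      unfolding X_def Y_def w p_q_r_t_def by (simp add: algebra_simps)
    ultimately have "cnj (X (ft h) k) * Y (ft h) k + cnj (X (wft h) k) * Y (wft h) k
        = (a * cnj a + b * cnj b) * (p * r + q * t) / 4"
      unfolding e by (simp add: algebra_simps)
    also have "\<dots> = (p * r + q * t) / 2" unfolding ab by simp
    finally show ?thesis unfolding p_q_r_t_def .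
  qed
  with has_integral_add[OF one[OF trig_ft[OF h]] one[OF trig_wft[OF h]]]
  have "((\<lambda>k. (cnj (ft x k) * ft y k + cnj (ft x (k + pi)) * ft y (k + pi)) / 2) has_integral
    of_real (2 * pi) * (l2inner (msup_adj (ft h) x) (msup_adj (ft h) y) + l2inner (msup_adj (wft h) x) (msup_adj (wft h) y))) {-pi..pi}"
    by (simp add: distrib_left)
  then show ?thesis using two has_integral_unique_2pi by blast
qed

section \<open>Quadrature mirror filters and the multiplier by theta_w\<close>


text \<open>The algebraic half of \<open>scaling_filter\<close>. Operator identities and contraction
  bounds rest on it alone; the scaling function enters only through decay.\<close>

definition qmf :: "seq \<Rightarrow> bool" where
  "qmf h \<longleftrightarrow> fins h \<and> (\<forall>k. (cmod (ft h k))\<^sup>2 + (cmod (ft h (k + pi)))\<^sup>2 = 2)"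

lemma qmf_trig: "qmf h \<Longrightarrow> trig (ft h)" "qmf h \<Longrightarrow> trig (wft h)"
  by (simp_all add: qmf_def trig_ft trig_wft)

lemma fins_qmf: 
  assumes "qmf h" "fins x" 
  shows "fins (msup_adj (ft h) x)" "fins (msup_adj (wft h) x)" "fins (msup (ft h) x)" "fins (msup (wft h) x)"
    "fins ((msup_adj (ft h) ^^ l) x)" "fins ((msup (ft h) ^^ l) x)"
proof -
  show "fins (msup_adj (ft h) x)" "fins (msup_adj (wft h) x)" "fins (msup (ft h) x)" "fins (msup (wft h) x)"
    using assms qmf_trig fins_msup fins_msup_adj by auto
  show "fins ((msup_adj (ft h) ^^ l) x)"
    using assms by (induction l) (auto intro: fins_msup_adj qmf_trig)
  show "fins ((msup (ft h) ^^ l) x)"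
    using assms by (induction l) (auto intro: fins_msup qmf_trig)
qed

lemma qmf_l2inner:
  assumes "qmf h" "fins x" "fins y"
  shows "l2inner (msup_adj (ft h) x) (msup_adj (ft h) y) + l2inner (msup_adj (wft h) x) (msup_adj (wft h) y)
    = l2inner x y"
  using assms qmf_decomposition[of h x y] by (simp add: qmf_def)

lemma qmf_pythagoras:
  assumes "qmf h" "fins x"
  shows "(l2norm (msup_adj (ft h) x))\<^sup>2 + (l2norm (msup_adj (wft h) x))\<^sup>2 = (l2norm x)\<^sup>2"
proof -
  have "complex_of_real ((l2norm (msup_adj (ft h) x))\<^sup>2 + (l2norm (msup_adj (wft h) x))\<^sup>2) = of_real ((l2norm x)\<^sup>2)"
    using qmf_l2inner[OF assms assms(2)] fins_qmf[OF assms] assms(2)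
    unfolding of_real_add by (simp only: l2inner_self)
  then show ?thesis by (simp only: of_real_eq_iff)
qed

lemma qmf_contraction:
  assumes "qmf h" "fins x"
  shows "l2norm (msup_adj (ft h) x) \<le> l2norm x" "l2norm (msup_adj (wft h) x) \<le> l2norm x"
    "l2norm ((msup_adj (ft h) ^^ l) x) \<le> l2norm x"
proof -
  have 1: "l2norm (msup_adj (ft h) x) \<le> l2norm x" if "fins x" for x
    by (rule power2_le_imp_le) (use qmf_pythagoras[OF assms(1) that] in \<open>simp_all flip: qmf_pythagoras[OF assms(1) that]\<close>)
  show "l2norm (msup_adj (ft h) x) \<le> l2norm x" using 1 assms by blast
  show "l2norm (msup_adj (wft h) x) \<le> l2norm x"
    by (rule power2_le_imp_le) (simp_all flip: qmf_pythagoras[OF assms])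
  show "l2norm ((msup_adj (ft h) ^^ l) x) \<le> l2norm x"
  proof (induction l)
    case (Suc l)
    then show ?case using 1[OF fins_qmf(5)[OF assms]] order_trans by fastforce
  qed simp
qed

text \<open>The polarised energy identity \<open>qmf_l2inner\<close>, tested against
  \<open>delta n\<close>, gives the value at \<open>n\<close> once each \<open>msup_adj\<close> is
  moved to the other side as \<open>msup\<close>.\<close>

lemma qmf_reconstruction:
  assumes "qmf h" "fins x"
  shows "x = (\<lambda>n. msup (ft h) (msup_adj (ft h) x) n + msup (wft h) (msup_adj (wft h) x) n)"
proof
  fix n
  show "x n = msup (ft h) (msup_adj (ft h) x) n + msup (wft h) (msup_adj (wft h) x) n"
    using qmf_l2inner[OF assms(1) fins_delta[of n] assms(2)]
      l2inner_msup[OF qmf_trig(1)[OF assms(1)] fins_qmf(1)[OF assms] fins_delta[of n]]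
      l2inner_msup[OF qmf_trig(2)[OF assms(1)] fins_qmf(2)[OF assms] fins_delta[of n]]
    by (simp add: l2inner_delta)
qed

text \<open>The form \<open>\<langle>b, W_g\<^sup>* p\<^sub>w W_h a\<rangle>\<close>; level \<open>l\<close> here is level \<open>l + 1\<close> of \<open>W\<close>.\<close>

definition wform :: "seq \<Rightarrow> seq \<Rightarrow> nat \<Rightarrow> seq \<Rightarrow> seq \<Rightarrow> complex" where
  "wform g h L b a = (\<Sum>l<L. l2inner (msup_adj (wft g) ((msup_adj (ft g) ^^ l) b)) (msup_adj (wft h) ((msup_adj (ft h) ^^ l) a)))"

lemma wform_add:
  "wform g h (m + n) b a = wform g h m b a + wform g h n ((msup_adj (ft g) ^^ m) b) ((msup_adj (ft h) ^^ m) a)"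
proof -
  have split: "(\<Sum>l<m + n. F l) = (\<Sum>l<m. F l) + (\<Sum>l<n. F (l + m))" for F :: "nat \<Rightarrow> complex"
    by (induction n) (simp_all add: add_ac)
  show ?thesis
    unfolding wform_def by (subst split) (simp add: funpow_add)
qed

lemma wform_0 [simp]: "wform g h 0 b a = 0"
  by (simp add: wform_def)

lemma wform_Suc:
  "wform g h (Suc L) b a = l2inner (msup_adj (wft g) b) (msup_adj (wft h) a)
     + wform g h L (msup_adj (ft g) b) (msup_adj (ft h) a)"
  using wform_add[of g h 1 L b a] by (simp add: wform_def)

lemma cauchy_schwarz_2:
  fixes a b c d p q :: real
  assumes "a\<^sup>2 + b\<^sup>2 = p\<^sup>2" "c\<^sup>2 + d\<^sup>2 = q\<^sup>2" "p \<ge> 0" "q \<ge> 0"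
  shows "a * c + b * d \<le> p * q"
proof (rule power2_le_imp_le)
  have "(p * q)\<^sup>2 = (a\<^sup>2 + b\<^sup>2) * (c\<^sup>2 + d\<^sup>2)" using assms by (simp add: power_mult_distrib)
  also have "\<dots> = (a * c + b * d)\<^sup>2 + (a * d - b * c)\<^sup>2" by (simp add: power2_eq_square algebra_simps)
  finally show "(a * c + b * d)\<^sup>2 \<le> (p * q)\<^sup>2" by simp
qed (use assms in simp)

text \<open>Fine and coarse parts share the squared norm at each level, so two-dimensional
  Cauchy-Schwarz absorbs a level without loss and the bound is uniform in \<open>L\<close>.\<close>

lemma wform_bound:
  assumes "qmf g" "qmf h" "fins b" "fins a"
  shows "cmod (wform g h L b a) \<le> l2norm b * l2norm a"
  using assms(3,4)
proof (induction L arbitrary: b a)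
  case (Suc L)
  have "cmod (wform g h (Suc L) b a) \<le> l2norm (msup_adj (wft g) b) * l2norm (msup_adj (wft h) a)
      + l2norm (msup_adj (ft g) b) * l2norm (msup_adj (ft h) a)"
    unfolding wform_Suc using Suc assms(1,2)
    by (intro order_trans[OF norm_triangle_ineq] add_mono l2inner_cauchy_schwarz) (auto intro: fins_qmf)
  also have "\<dots> \<le> l2norm b * l2norm a"
    using qmf_pythagoras[OF assms(1) Suc.prems(1)] qmf_pythagoras[OF assms(2) Suc.prems(2)]
    by (intro cauchy_schwarz_2) auto
  finally show ?case .
qed simp

text \<open>With the same filter on both sides \<open>qmf_l2inner\<close> telescopes. Hence the
  diagonal blocks of the MERA symbol miss those of \<open>omega\<close> by the coarse remainder
  only, with no contribution of \<epsilon>.\<close>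

lemma wform_self:
  assumes "qmf h" "fins b" "fins a"
  shows "wform h h L b a = l2inner b a - l2inner ((msup_adj (ft h) ^^ L) b) ((msup_adj (ft h) ^^ L) a)"
  using assms(2,3)
proof (induction L arbitrary: b a)
  case (Suc L)
  then show ?case
    using qmf_l2inner[OF assms(1) Suc.prems] fins_qmf[OF assms(1)]
    by (simp add: wform_Suc funpow_swap1 algebra_simps)
qed simp

lemma l2norm_eq_0D:
  assumes "fins x" "l2norm x = 0" shows "x = (\<lambda>_. 0)"
proof
  fix n
  have "cmod (l2inner (delta n) x) \<le> 0"
    using l2inner_cauchy_schwarz[of "delta n" x] assms by simp
  then show "x n = 0" by (simp add: l2inner_delta)
qed

text \<open>Cauchy-Schwarz for the integral by means of the arithmetic-geometric mean inequality
  with weight \<open>t\<close>: both squares integrate by Parseval, and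
  \<open>t = l2norm y / l2norm b\<close> is optimal. If a norm vanishes there is no such
  \<open>t\<close>, but then a transform vanishes as well. The points 0, \<open>-pi\<close> and
  \<open>pi\<close> are cut out because the filters are compared on the open interval only and the
  wavelet comparison fails to cover the jump of \<open>theta_w\<close> at 0.\<close>

lemma multiplier_bound:
  assumes b: "fins b" and y: "fins y" and F: "(F has_integral of_real (2 * pi) * I) {-pi..pi}"
    and bd: "\<And>k. -pi < k \<Longrightarrow> k < pi \<Longrightarrow> k \<noteq> 0 \<Longrightarrow> cmod (F k) \<le> \<epsilon> * (cmod (ft b k) * cmod (ft y k))"
    and \<epsilon>: "\<epsilon> \<ge> 0"
  shows "cmod I \<le> \<epsilon> * (l2norm b * l2norm y)"
proof -
  define F' where "F' k = (if k \<in> {-pi, 0, pi} then 0 else F k)" for k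
  have F': "(F' has_integral of_real (2 * pi) * I) {-pi..pi}"
    by (rule has_integral_spike_finite[OF _ _ F, of "{-pi, 0, pi}"]) (auto simp: F'_def)
  have sq: "((\<lambda>k. (cmod (ft x k))\<^sup>2) has_integral 2 * pi * (l2norm x)\<^sup>2) {-pi..pi}" if "fins x" for x
  proof -
    have e: "Re (cnj z * z) = (cmod z)\<^sup>2" for z :: complex
      unfolding cmod_power2 by (simp add: power2_eq_square)
    have "Re (of_real (2 * pi) * l2inner x x) = 2 * pi * (l2norm x)\<^sup>2"
      unfolding l2inner_self[OF that] of_real_mult[symmetric] by (rule Re_complex_of_real)
    then show ?thesis
      using has_integral_linear[OF parseval[OF that that] bounded_linear_Re] by (simp only: o_def e)
  qed
  have *: "2 * cmod I \<le> \<epsilon> * (t * (l2norm b)\<^sup>2 + (l2norm y)\<^sup>2 / t)" if t: "t > 0" for t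
  proof -
    let ?G = "\<lambda>k. \<epsilon> * ((t * (cmod (ft b k))\<^sup>2 + (cmod (ft y k))\<^sup>2 / t) / 2)"
    have G: "(?G has_integral \<epsilon> * ((t * (2 * pi * (l2norm b)\<^sup>2) + 2 * pi * (l2norm y)\<^sup>2 / t) / 2)) {-pi..pi}"
      by (intro has_integral_mult_right has_integral_divide has_integral_add sq b y)
    have "norm (F' k) \<le> ?G k" if k: "k \<in> {-pi..pi}" for k
    proof -
      have "cmod (F' k) \<le> \<epsilon> * (cmod (ft b k) * cmod (ft y k))"
        using bd[of k] k \<epsilon> by (auto simp: F'_def)
      moreover have "cmod (ft b k) * cmod (ft y k) \<le> (t * (cmod (ft b k))\<^sup>2 + (cmod (ft y k))\<^sup>2 / t) / 2"
      proof -
        have "0 \<le> (t * cmod (ft b k) - cmod (ft y k))\<^sup>2 / t" using t by simp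
        also have "\<dots> = t * (cmod (ft b k))\<^sup>2 + (cmod (ft y k))\<^sup>2 / t - 2 * (cmod (ft b k) * cmod (ft y k))"
          using t by (simp add: power2_eq_square field_simps)
        finally show ?thesis by simp
      qed
      ultimately show ?thesis using \<epsilon> by (elim order_trans) (rule mult_left_mono)
    qed
    then have "norm (integral {-pi..pi} F') \<le> integral {-pi..pi} ?G"
      using F' G by (intro integral_norm_bound_integral) (auto simp: integrable_on_def)
    then have "2 * pi * cmod I \<le> \<epsilon> * ((t * (2 * pi * (l2norm b)\<^sup>2) + 2 * pi * (l2norm y)\<^sup>2 / t) / 2)"
      unfolding integral_unique[OF F'] integral_unique[OF G] by (simp add: norm_mult)
    also have "\<dots> = 2 * pi * (\<epsilon> * (t * (l2norm b)\<^sup>2 + (l2norm y)\<^sup>2 / t) / 2)" using t by (simp add: field_simps)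
    finally have "cmod I \<le> \<epsilon> * (t * (l2norm b)\<^sup>2 + (l2norm y)\<^sup>2 / t) / 2"
      by (rule mult_left_le_imp_le) simp
    then show ?thesis by simp
  qed
  show ?thesis
  proof (cases "l2norm b = 0 \<or> l2norm y = 0")
    case True
    then have "ft b = (\<lambda>_. 0) \<or> ft y = (\<lambda>_. 0)"
      using l2norm_eq_0D[OF b] l2norm_eq_0D[OF y] by (auto simp: ft_def fun_eq_iff)
    then have "F' k = 0" if "k \<in> {-pi..pi}" for k using bd[of k] that by (auto simp: F'_def)
    then have "(F' has_integral 0) {-pi..pi}" by (intro has_integral_is_0) auto
    from has_integral_unique[OF F' this] have "I = 0" by simp
    then show ?thesis using \<epsilon> by simp
  next
    case False
    then have pos: "l2norm b > 0" "l2norm y > 0" by (auto simp: less_le)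
    show ?thesis using *[of "l2norm y / l2norm b"] pos by (simp add: power2_eq_square field_simps)
  qed
qed

section \<open>Fourier coefficients of \<open>theta_w\<close> and their behaviour under
  upsampling\<close>

lemma has_integral_sgn_exp:
  "((\<lambda>k. - \<i> * of_real (sgn k) * exp (\<i> * of_real (\<alpha> * k))) has_integral of_real ((2 - 2 * cos (\<alpha> * pi)) / \<alpha>)) {-pi..pi}"
proof -
  have "((\<lambda>k. - \<i> * of_real (sgn k) * exp (\<i> * of_real (\<alpha> * k))) has_integral
     (\<i> * u + - \<i> * w)) {-pi..pi}"
    if u: "((\<lambda>k. exp (\<i> * of_real (\<alpha> * k))) has_integral u) {-pi..0}"
      and w: "((\<lambda>k. exp (\<i> * of_real (\<alpha> * k))) has_integral w) {0..pi}" for u w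
  proof (rule has_integral_combine[of "-pi" 0])
    show "((\<lambda>k. - \<i> * of_real (sgn k) * exp (\<i> * of_real (\<alpha> * k))) has_integral \<i> * u) {-pi..0}"
      by (rule has_integral_spike_finite[OF _ _ has_integral_mult_right[OF u, of \<i>], of "{0}"]) auto
    show "((\<lambda>k. - \<i> * of_real (sgn k) * exp (\<i> * of_real (\<alpha> * k))) has_integral - \<i> * w) {0..pi}"
      by (rule has_integral_spike_finite[OF _ _ has_integral_mult_right[OF w, of "- \<i>"], of "{0}"]) auto
  qed auto
  note comb = this
  show ?thesis
  proof (cases "\<alpha> = 0")
    \<comment> \<open>Division by zero makes the claimed value 0, which is correct: the integrand is
      then a multiple of the odd function \<open>sgn\<close>.\<close>
    case True
    then show ?thesis
      using comb[of "of_real pi" "of_real pi"] has_integral_const_real[of "1 :: complex" "-pi" 0]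
        has_integral_const_real[of "1 :: complex" 0 pi] by (simp add: scaleR_conv_of_real)
  next
    case False
    have "\<i> * ((exp (\<i> * of_real (\<alpha> * 0)) - exp (\<i> * of_real (\<alpha> * - pi))) / (\<i> * of_real \<alpha>)) +
       - \<i> * ((exp (\<i> * of_real (\<alpha> * pi)) - exp (\<i> * of_real (\<alpha> * 0))) / (\<i> * of_real \<alpha>))
      = (2 - (exp (\<i> * of_real (\<alpha> * pi)) + exp (- (\<i> * of_real (\<alpha> * pi))))) / of_real \<alpha>"
      using False by (simp add: field_simps)
    also have "exp (\<i> * of_real (\<alpha> * pi)) + exp (- (\<i> * of_real (\<alpha> * pi))) = of_real (2 * cos (\<alpha> * pi))"
      by (simp add: cos_exp_eq flip: cos_of_real)
    finally show ?thesis
      using comb[OF has_integral_exp_real has_integral_exp_real] False by simp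
  qed
qed

text \<open>The \<open>2 pi\<close>-periodic extension of \<open>theta_w\<close>, evaluated at \<open>2 k\<close>, for \<open>k\<close> in \<open>(-pi, pi)\<close>.\<close>

definition theta_two :: "real \<Rightarrow> complex" where
  "theta_two k = - \<i> * of_real (sgn k) * exp (\<i> * of_real k)"

lemma theta_w_moment:
  "((\<lambda>k. theta_w k * exp (\<i> * of_real (of_int n * k))) has_integral of_real (4 / (2 * of_int n + 1))) {-pi..pi}"
proof -
  have eq: "(\<lambda>k. theta_w k * exp (\<i> * of_real (of_int n * k)))
      = (\<lambda>k. - \<i> * of_real (sgn k) * exp (\<i> * of_real ((of_int n + 1 / 2) * k)))"
    by (auto simp: theta_w_def fun_eq_iff exp_add[symmetric] algebra_simps)
  have "cos ((of_int n + 1 / 2) * pi) = 0"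
    unfolding cos_zero_iff_int by (intro exI[of _ "2 * n + 1"]) (simp add: field_simps)
  moreover have "of_int n + 1 / 2 \<noteq> (0 :: real)" 
  proof
    assume "of_int n + 1 / 2 = (0 :: real)"
    then have "real_of_int (2 * n + 1) = of_int 0" by simp
    then show False unfolding of_int_eq_iff by presburger
  qed
  ultimately show ?thesis
    unfolding eq using has_integral_sgn_exp[of "of_int n + 1 / 2"] by (simp add: field_simps)
qed

lemma theta_two_moment:
  "((\<lambda>k. theta_two k * exp (\<i> * of_real (of_int n * k))) has_integral
     (if even n then of_real (4 / (of_int n + 1)) else 0)) {-pi..pi}"
proof -
  have eq: "(\<lambda>k. theta_two k * exp (\<i> * of_real (of_int n * k)))
      = (\<lambda>k. - \<i> * of_real (sgn k) * exp (\<i> * of_real (of_int (n + 1) * k)))"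
    by (auto simp: theta_two_def fun_eq_iff exp_add[symmetric] algebra_simps)
  have "cos (of_int (n + 1) * pi) = (if even n then - 1 else 1 :: real)"
    using cos_npi_int[of "n + 1"] by (simp add: mult.commute)
  then show ?thesis
    unfolding eq using has_integral_sgn_exp[of "of_int (n + 1)"] by auto
qed

lemma theta_w_integrable: "(\<lambda>k. theta_w k * exp (\<i> * of_real (of_int n * k))) integrable_on {-pi..pi}"
  using theta_w_moment by (auto simp: integrable_on_def)

lemma theta_two_integrable: "(\<lambda>k. theta_two k * exp (\<i> * of_real (of_int n * k))) integrable_on {-pi..pi}"
  using theta_two_moment by (auto simp: integrable_on_def)

lemma fcoeff_theta_w: "fcoeff theta_w n = of_real (2 / (pi * (2 * of_int n + 1)))"
  using fcoeff_moment[OF theta_w_moment[of n]] by simp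

lemma fcoeff_theta_two: "fcoeff theta_two n = (if even n then fcoeff theta_w (n div 2) else 0)"
  using fcoeff_moment[OF theta_two_moment[of n]] by (auto simp: fcoeff_theta_w elim!: evenE)

text \<open>The coefficients of \<open>theta_two\<close> are those of \<open>theta_w\<close> spread
  over the even integers: upsampling replaces a periodic symbol at \<open>k\<close> by the same
  symbol at \<open>2 k\<close>. This links the multiplier on one level with the multiplier on the
  next coarser one.\<close>

lemma fmult_theta_two_up:
  assumes "fins x" shows "fmult theta_two (up x) = up (fmult theta_w x)"
proof
  fix n
  have S: "finite {n. x n \<noteq> 0}" using assms by (simp add: fins_def)
  have "fmult theta_two (up x) n = infsum (\<lambda>j. fcoeff theta_two (n - j) * up x j) (range (\<lambda>j. 2 * j))"
    unfolding fmult_def conv_def by (intro infsum_cong_neutral) (auto simp: up_def elim!: evenE)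
  also have "\<dots> = infsum (\<lambda>j. fcoeff theta_two (n - 2 * j) * x j) UNIV"
    by (subst infsum_reindex) (auto simp: inj_on_def o_def up_def)
  also have "\<dots> = up (fmult theta_w x) n"
    by (auto simp: fcoeff_theta_two up_def fmult_def conv_def elim!: evenE intro!: infsum_cong)
  finally show "fmult theta_two (up x) n = up (fmult theta_w x) n" .
qed


section \<open>Unitarity of the multiplier by \<open>theta_w\<close>\<close>

lemma has_sum_int_split:
  fixes g :: "int \<Rightarrow> real"
  assumes "((\<lambda>n. g (int n)) has_sum a) UNIV" "((\<lambda>n. g (- 1 - int n)) has_sum b) UNIV"
  shows "(g has_sum (a + b)) UNIV"
proof -
  have "(g has_sum a) {0..}"
    using assms(1) by (subst has_sum_reindex_bij_witness[of "{0..}" int nat UNIV "\<lambda>n. g (int n)" g a a]) auto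
  moreover have "(g has_sum b) {..<0}"
    using assms(2)
    by (subst has_sum_reindex_bij_witness[of "{..<0}" "\<lambda>n. - 1 - int n" "\<lambda>i. nat (- 1 - i)" UNIV "\<lambda>n. g (- 1 - int n)" g b b]) auto
  ultimately have "(g has_sum (a + b)) ({0..} \<union> {..<0})" by (intro has_sum_Un_disjoint) auto
  moreover have "{0..} \<union> {..<0::int} = UNIV" by auto
  ultimately show ?thesis by simp
qed

text \<open>The Basel series is grouped in pairs; the even terms are a quarter of the whole, which
  leaves three quarters of pi^2/6.\<close>

lemma odd_inverse_squares_sums: "(\<lambda>n. 1 / (2 * real n + 1)\<^sup>2) sums (pi\<^sup>2 / 8)"
proof -
  have "(\<lambda>n. \<Sum>i\<in>{n * 2..<n * 2 + 2}. 1 / real ((i + 1)\<^sup>2)) sums (pi\<^sup>2 / 6)"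
    by (rule sums_group[OF inverse_squares_sums]) simp
  moreover have "(\<Sum>i\<in>{n * 2..<n * 2 + 2}. 1 / real ((i + 1)\<^sup>2)) = 1 / (2 * real n + 1)\<^sup>2 + 1 / 4 * (1 / real ((n + 1)\<^sup>2))" for n
  proof -
    have s: "{n * 2..<n * 2 + 2} = {n * 2, n * 2 + 1}" by auto
    have "1 / real ((n * 2 + 1 + 1)\<^sup>2) = 1 / 4 * (1 / real ((n + 1)\<^sup>2))"
      by (simp add: power2_eq_square field_simps)
    then show ?thesis unfolding s by (simp add: mult.commute)
  qed
  ultimately have "(\<lambda>n. 1 / (2 * real n + 1)\<^sup>2 + 1 / 4 * (1 / real ((n + 1)\<^sup>2))) sums (pi\<^sup>2 / 6)" by simp
  from sums_diff[OF this sums_mult[OF inverse_squares_sums, of "1/4"]] show ?thesis by (simp add: algebra_simps)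
qed

lemma odd_int_neq_0: "2 * real_of_int i + 1 \<noteq> 0"
proof
  assume "2 * real_of_int i + 1 = 0"
  then have "real_of_int (2 * i + 1) = of_int 0" by simp
  then show False unfolding of_int_eq_iff by presburger
qed

lemma has_sum_odd_inverse_squares: "((\<lambda>i::int. 1 / (2 * real_of_int i + 1)\<^sup>2) has_sum (pi\<^sup>2 / 4)) UNIV"
proof -
  have "((\<lambda>n. 1 / (2 * real n + 1)\<^sup>2) has_sum (pi\<^sup>2 / 8)) UNIV"
    by (rule sums_nonneg_imp_has_sum[OF odd_inverse_squares_sums]) simp
  moreover have "(2 * (- 1 - real n) + 1)\<^sup>2 = (2 * real n + 1)\<^sup>2" for n
    by (simp add: power2_eq_square algebra_simps)
  ultimately show ?thesis
    using has_sum_int_split[of "\<lambda>i. 1 / (2 * real_of_int i + 1)\<^sup>2" "pi\<^sup>2 / 8" "pi\<^sup>2 / 8"] by simp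
qed

lemma has_sum_telescope_step:
  "((\<lambda>i. 1 / (2 * real_of_int i + 1) - 1 / (2 * real_of_int (i + 1) + 1)) has_sum 0) UNIV"
proof -
  have lim: "(\<lambda>n. 1 / (2 * real n + 1)) \<longlonglongrightarrow> 0" by real_asymp
  have lim': "(\<lambda>n. - (1 / (1 - 2 * real n))) \<longlonglongrightarrow> 0" by real_asymp
  have 1: "((\<lambda>n. 1 / (2 * real n + 1) - 1 / (2 * real (Suc n) + 1)) has_sum 1) UNIV"
    using telescope_sums'[OF lim] by (intro sums_nonneg_imp_has_sum) (auto simp: field_simps)
  \<comment> \<open>The term \<open>n = 0\<close>, that is \<open>i = - 1\<close>, equals -2.
    Nonnegativity from \<open>n = 1\<close> on upgrades the ordered \<open>sums\<close> to the
    unconditional \<open>has_sum\<close>.\<close>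
  have nonneg: "- (1 / (1 - 2 * real n)) - - (1 / (1 - 2 * real (Suc n))) \<ge> 0" if "n \<ge> 1" for n
  proof -
    have m: "- (1 / (1 - 2 * real n)) = 1 / (2 * real n - 1)" for n
      by (metis minus_diff_eq minus_divide_right)
    show ?thesis unfolding m using that by (simp add: frac_le)
  qed
  have 2: "((\<lambda>n. - (1 / (1 - 2 * real n)) - - (1 / (1 - 2 * real (Suc n)))) has_sum - 1) UNIV"
    using telescope_sums'[OF lim'] nonneg
    by (intro sums_nonneg_imp_has_sum_strong eventually_sequentiallyI[of 1]) auto
  have "- (1 / (1 - 2 * real n)) - - (1 / (1 - 2 * real (Suc n)))
     = 1 / (2 * real_of_int (- 1 - int n) + 1) - 1 / (2 * real_of_int (- 1 - int n + 1) + 1)" for n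
    by (simp add: algebra_simps)
  with 2 have "((\<lambda>n. 1 / (2 * real_of_int (- 1 - int n) + 1) - 1 / (2 * real_of_int (- 1 - int n + 1) + 1)) has_sum - 1) UNIV"
    by simp
  then show ?thesis
    using has_sum_int_split[of "\<lambda>i. 1 / (2 * real_of_int i + 1) - 1 / (2 * real_of_int (i + 1) + 1)" 1 "- 1"] 1
    by (simp add: add.commute)
qed

lemma has_sum_telescope:
  "((\<lambda>i. 1 / (2 * real_of_int i + 1) - 1 / (2 * real_of_int (i + int d) + 1)) has_sum 0) UNIV"
proof (induction d)
  case (Suc d)
  have "((\<lambda>i. 1 / (2 * real_of_int (i + int d) + 1) - 1 / (2 * real_of_int (i + int d + 1) + 1)) has_sum 0) UNIV"
    using has_sum_telescope_step
    by (subst has_sum_reindex_bij_witness[of UNIV "\<lambda>i. i - int d" "\<lambda>i. i + int d" UNIV "\<lambda>i. 1 / (2 * real_of_int i + 1) - 1 / (2 * real_of_int (i + 1) + 1)" _ 0 0]) auto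
  from has_sum_add[OF Suc this] show ?case by (simp add: add_ac)
qed simp

text \<open>Partial fractions: the product is \<open>1 / (2 * real d)\<close> times a telescoping
  difference.\<close>

lemma has_sum_odd_product_pos:
  assumes "d > 0"
  shows "((\<lambda>i. 1 / (2 * real_of_int i + 1) * (1 / (2 * real_of_int (i + int d) + 1))) has_sum 0) UNIV"
proof -
  have "1 / (2 * real d) * (1 / (2 * real_of_int i + 1) - 1 / (2 * real_of_int (i + int d) + 1))
     = 1 / (2 * real_of_int i + 1) * (1 / (2 * real_of_int (i + int d) + 1))" for i
    using odd_int_neq_0[of i] odd_int_neq_0[of "i + int d"] assms
    by (simp add: field_simps)
  with has_sum_cmult_right[OF has_sum_telescope[of d], of "1 / (2 * real d)"] show ?thesis by simp
qed

lemma has_sum_odd_product: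
  "((\<lambda>j. 1 / (2 * real_of_int (n - j) + 1) * (1 / (2 * real_of_int (m - j) + 1))) has_sum (if n = m then pi\<^sup>2 / 4 else 0)) UNIV"
proof -
  have *: "((\<lambda>j. 1 / (2 * real_of_int (n - j) + 1) * (1 / (2 * real_of_int (m - j) + 1))) has_sum (if n = m then pi\<^sup>2 / 4 else 0)) UNIV"
    if "n \<le> m" for n m
  proof -
    have "((\<lambda>i. 1 / (2 * real_of_int i + 1) * (1 / (2 * real_of_int (i + int (nat (m - n))) + 1))) has_sum (if n = m then pi\<^sup>2 / 4 else 0)) UNIV"
      using has_sum_odd_product_pos[of "nat (m - n)"] has_sum_odd_inverse_squares that by (auto simp: power2_eq_square)
    then show ?thesis
      using that
      by (subst has_sum_reindex_bij_witness[of UNIV "\<lambda>i. n - i" "\<lambda>j. n - j" UNIV "\<lambda>i. 1 / (2 * real_of_int i + 1) * (1 / (2 * real_of_int (i + int (nat (m - n))) + 1))" _ "if n = m then pi\<^sup>2 / 4 else 0"]) auto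
  qed
  show ?thesis
  proof (cases "n \<le> m")
    case False
    then show ?thesis using *[of m n] by (simp add: mult.commute eq_commute)
  qed (rule *)
qed

lemma fcoeff_cnj: "fcoeff (\<lambda>k. cnj (\<theta> k)) n = cnj (fcoeff \<theta> (- n))"
proof -
  have "integral {-pi..pi} (\<lambda>k. cnj (\<theta> k) * exp (\<i> * of_real (of_int n * k)))
     = integral {-pi..pi} (\<lambda>k. cnj (\<theta> k * exp (\<i> * of_real (of_int (- n) * k))))"
    by (simp add: exp_cnj)
  then show ?thesis unfolding fcoeff_def integral_cnj[symmetric] by simp
qed

text \<open>Entry \<open>(n, m)\<close> of the product of the multiplier by \<open>theta_w\<close>
  with its adjoint, which is the identity as \<open>theta_w\<close> has modulus 1 away from 0. The
  sum runs over all integers, so it is evaluated from the explicit coefficients, with unconditional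
  convergence.\<close>

lemma theta_w_kernel:
  "((\<lambda>j. fcoeff theta_w (n - j) * fcoeff (\<lambda>k. cnj (theta_w k)) (j - m)) has_sum (if n = m then 1 else 0)) UNIV"
proof -
  have "fcoeff theta_w (n - j) * fcoeff (\<lambda>k. cnj (theta_w k)) (j - m)
     = of_real (4 / pi\<^sup>2 * (1 / (2 * real_of_int (n - j) + 1) * (1 / (2 * real_of_int (m - j) + 1))))" for j
    unfolding fcoeff_cnj fcoeff_theta_w by (simp add: power2_eq_square)
  moreover have "((\<lambda>j. complex_of_real (4 / pi\<^sup>2 * (1 / (2 * real_of_int (n - j) + 1) * (1 / (2 * real_of_int (m - j) + 1)))))
     has_sum of_real (4 / pi\<^sup>2 * (if n = m then pi\<^sup>2 / 4 else 0))) UNIV"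
    by (intro has_sum_of_real has_sum_cmult_right has_sum_odd_product)
  moreover have "4 / pi\<^sup>2 * (if n = m then pi\<^sup>2 / 4 else 0) = (if n = m then 1 else 0)" by simp
  ultimately show ?thesis by (simp only:) (simp split: if_splits)
qed

lemma fmult_eq_sum:
  assumes "finite S" "{n. x n \<noteq> 0} \<subseteq> S"
  shows "fmult \<theta> x n = (\<Sum>j\<in>S. fcoeff \<theta> (n - j) * x j)"
  unfolding fmult_def by (rule conv_eq_sum[OF assms])

lemma has_sum_fmult:
  assumes "fins x"
  shows "((\<lambda>j. fcoeff \<theta> (n - j) * x j) has_sum fmult \<theta> x n) UNIV"
proof -
  have S: "finite {n. x n \<noteq> 0}" using assms by (simp add: fins_def)
  have "((\<lambda>j. fcoeff \<theta> (n - j) * x j) has_sum fmult \<theta> x n) {n. x n \<noteq> 0}"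
    using fmult_eq_sum[OF S order_refl] S by (intro has_sum_finiteI) auto
  then show ?thesis by (subst has_sum_cong_neutral[of "{n. x n \<noteq> 0}" _ _ "\<lambda>j. fcoeff \<theta> (n - j) * x j"]) auto
qed

lemma has_sum_Sum:
  fixes f :: "'a \<Rightarrow> 'b \<Rightarrow> complex"
  assumes "finite S" "\<And>m. m \<in> S \<Longrightarrow> (f m has_sum s m) A"
  shows "((\<lambda>j. \<Sum>m\<in>S. f m j) has_sum (\<Sum>m\<in>S. s m)) A"
  using assms by (induction S rule: finite_induct) (auto intro!: has_sum_add)

lemma has_sum_theta_theta_adj:
  assumes "fins b"
  shows "((\<lambda>j. fcoeff theta_w (n - j) * fmult (\<lambda>k. cnj (theta_w k)) b j) has_sum b n) UNIV"
proof -
  let ?S = "{n. b n \<noteq> 0}"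
  have S: "finite ?S" using assms by (simp add: fins_def)
  have "((\<lambda>j. \<Sum>m\<in>?S. fcoeff theta_w (n - j) * fcoeff (\<lambda>k. cnj (theta_w k)) (j - m) * b m) has_sum
     (\<Sum>m\<in>?S. (if n = m then 1 else 0) * b m)) UNIV"
    by (intro has_sum_Sum S has_sum_cmult_left theta_w_kernel)
  moreover have "(\<Sum>m\<in>?S. (if n = m then 1 else 0) * b m) = b n"
  proof -
    have "(\<Sum>m\<in>?S. (if n = m then 1 else 0) * b m) = (\<Sum>m\<in>?S. if m = n then b m else 0)"
      by (intro sum.cong) auto
    then show ?thesis using S by simp
  qed
  ultimately show ?thesis by (simp add: fmult_eq_sum[OF S order_refl] sum_distrib_left mult.assoc)
qed

text \<open>In \<open>omega\<close> the multiplier acts on a sequence of infinite support, since its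
  argument contains the adjoint multiplier applied to \<open>b\<close>. Unitarity removes this
  composition; afterwards multipliers meet finitely supported sequences only.\<close>

lemma fmult_theta_omega:
  assumes "fins a" "fins b"
  shows "fmult theta_w (\<lambda>n. (a n + fmult (\<lambda>k. cnj (theta_w k)) b n) / 2) n = (fmult theta_w a n + b n) / 2"
proof -
  have "((\<lambda>j. (fcoeff theta_w (n - j) * a j + fcoeff theta_w (n - j) * fmult (\<lambda>k. cnj (theta_w k)) b j) / 2)
      has_sum (fmult theta_w a n + b n) / 2) UNIV"
    by (intro has_sum_divide_const has_sum_add has_sum_fmult has_sum_theta_theta_adj assms)
  then have "((\<lambda>j. fcoeff theta_w (n - j) * ((a j + fmult (\<lambda>k. cnj (theta_w k)) b j) / 2))
      has_sum (fmult theta_w a n + b n) / 2) UNIV"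
    by (simp add: distrib_left)
  then show ?thesis unfolding fmult_def[of _ "\<lambda>n. (a n + _ n) / 2"] conv_def by (rule infsumI)
qed

lemma l2inner_fmult_cnj:
  assumes "fins x" "fins y"
  shows "l2inner x (fmult (\<lambda>k. cnj (\<theta> k)) y) = cnj (l2inner y (fmult \<theta> x))"
proof -
  obtain S where S: "finite S" "{n. x n \<noteq> 0} \<subseteq> S" "{n. y n \<noteq> 0} \<subseteq> S"
    using finsE[OF assms] by blast
  have "l2inner x (fmult (\<lambda>k. cnj (\<theta> k)) y) = (\<Sum>n\<in>S. \<Sum>m\<in>S. cnj (x n) * (cnj (fcoeff \<theta> (m - n)) * y m))"
    using S by (simp add: l2inner_eq_sip sip_def fmult_eq_sum[of S] fcoeff_cnj sum_distrib_left)
  also have "\<dots> = (\<Sum>m\<in>S. \<Sum>n\<in>S. cnj (x n) * (cnj (fcoeff \<theta> (m - n)) * y m))" by (rule sum.swap)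
  also have "\<dots> = cnj (l2inner y (fmult \<theta> x))"
    using S by (simp add: l2inner_eq_sip sip_def fmult_eq_sum[of S] sum_distrib_left mult_ac)
  finally show ?thesis .
qed

lemma fmult_add:
  assumes "fins x" "fins y"
  shows "fmult \<theta> (\<lambda>n. x n + y n) = (\<lambda>n. fmult \<theta> x n + fmult \<theta> y n)"
proof
  fix n
  show "fmult \<theta> (\<lambda>n. x n + y n) n = fmult \<theta> x n + fmult \<theta> y n"
    using infsumI[OF has_sum_add[OF has_sum_fmult[OF assms(1), of \<theta> n] has_sum_fmult[OF assms(2), of \<theta> n]]]
    by (simp add: fmult_def conv_def distrib_left)
qed

lemma cmod_theta_w_le: "cmod (theta_w k) \<le> 1"
  by (auto simp: theta_w_def norm_mult sgn_real_def)

lemma theta_form_bound: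
  assumes "fins b" "fins a"
  shows "cmod (l2inner b (fmult theta_w a)) \<le> l2norm b * l2norm a"
proof -
  have "cmod (l2inner b (fmult theta_w a)) \<le> 1 * (l2norm b * l2norm a)"
  proof (rule multiplier_bound[OF assms has_integral_fmult[OF theta_w_integrable assms]])
    fix k :: real
    have "cmod (ft b k) * (cmod (theta_w k) * cmod (ft a k)) \<le> cmod (ft b k) * (1 * cmod (ft a k))"
      by (intro mult_left_mono mult_right_mono cmod_theta_w_le) auto
    then show "cmod (cnj (ft b k) * (theta_w k * ft a k)) \<le> 1 * (cmod (ft b k) * cmod (ft a k))"
      by (simp add: norm_mult)
  qed simp
  then show ?thesis by simp
qed

section \<open>Closeness of the filters and peeling off levels\<close>

definition half_shift_close :: "real \<Rightarrow> seq \<Rightarrow> seq \<Rightarrow> bool" where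
  "half_shift_close \<epsilon> h g \<longleftrightarrow> \<epsilon> \<ge> 0 \<and> (\<forall>k\<in>{-pi<..<pi}. cmod (ft h k - exp (\<i> * of_real (k / 2)) * ft g k) \<le> \<epsilon>)"

lemma theta_scaling_close:
  assumes "half_shift_close \<epsilon> h g" "-pi < k" "k < pi"
  shows "cmod (theta_w k * ft h k - theta_two k * ft g k) \<le> \<epsilon>"
proof -
  have "theta_two k = theta_w k * exp (\<i> * of_real (k / 2))"
    by (simp add: theta_w_def theta_two_def exp_add[symmetric] mult.assoc flip: distrib_left)
  then have "theta_w k * ft h k - theta_two k * ft g k = theta_w k * (ft h k - exp (\<i> * of_real (k / 2)) * ft g k)"
    by (simp add: algebra_simps)
  then have "cmod (theta_w k * ft h k - theta_two k * ft g k)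
      = cmod (theta_w k) * cmod (ft h k - exp (\<i> * of_real (k / 2)) * ft g k)"
    by (simp only: norm_mult)
  also have "\<dots> \<le> 1 * \<epsilon>"
    using assms by (intro mult_mono cmod_theta_w_le) (auto simp: half_shift_close_def)
  finally show ?thesis by simp
qed

text \<open>Here lies the origin of \<open>theta_w\<close>. The wavelet filter samples the conjugate
  scaling filter at \<open>k + pi\<close>, reduced to \<open>k'\<close>, where the half shift
  contributes the phase \<open>exp (- (\<i> * of_real (k' / 2)))\<close>. The reduction jumps at
  \<open>k = 0\<close>, and \<open>theta_w\<close> with its factor \<open>sgn k\<close> is exactly
  the inverse of this phase. At \<open>k = 0\<close> the reduced point would be an endpoint of the
  interval.\<close>

lemma theta_wavelet_close:
  assumes c: "half_shift_close \<epsilon> h g" and fin: "fins h" "fins g" and k: "-pi < k" "k < pi" "k \<noteq> 0"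
  shows "cmod (theta_w k * wft h k - wft g k) \<le> \<epsilon>"
proof -
  define k' where "k' = (if k < 0 then k + pi else k - pi)"
  have k': "k' \<in> {-pi<..<pi}" using k by (auto simp: k'_def)
  have per: "ft x (k + pi) = ft x k'" if "fins x" for x
    using ft_periodic[OF that, of "k - pi"] by (auto simp: k'_def add.commute)
  have e: "theta_w k * exp (- (\<i> * of_real (k' / 2))) = 1"
  proof (cases "k < 0")
    case True
    have "exp (\<i> * of_real (k / 2)) * exp (- (\<i> * of_real ((k + pi) / 2))) = exp (- (\<i> * of_real (pi / 2)))"
      unfolding exp_add[symmetric] by (rule arg_cong[where f = exp]) (simp add: field_simps)
    also have "\<dots> = - \<i>" using cis_minus_pi_half by (simp add: cis_conv_exp)
    finally show ?thesis using True by (simp only: theta_w_def k'_def mult.assoc) simp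
  next
    case False
    have "exp (\<i> * of_real (k / 2)) * exp (- (\<i> * of_real ((k - pi) / 2))) = exp (\<i> * of_real (pi / 2))"
      unfolding exp_add[symmetric] by (rule arg_cong[where f = exp]) (simp add: field_simps)
    also have "\<dots> = \<i>" using cis_pi_half by (simp add: cis_conv_exp)
    finally show ?thesis using False k by (simp only: theta_w_def k'_def mult.assoc) simp
  qed
  define D where "D = ft h k' - exp (\<i> * of_real (k' / 2)) * ft g k'"
  have D: "cmod D \<le> \<epsilon>" using c k' by (auto simp: half_shift_close_def D_def)
  have "cnj (ft h k') = cnj D + exp (- (\<i> * of_real (k' / 2))) * cnj (ft g k')"
    by (simp add: D_def exp_cnj)
  moreover have w: "wft x k = exp (\<i> * of_real k) * cnj (ft x k')" if "fins x" for x
    by (simp only: wft_def per[OF that])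
  ultimately have "theta_w k * wft h k = exp (\<i> * of_real k) * (theta_w k * cnj D
      + (theta_w k * exp (- (\<i> * of_real (k' / 2)))) * cnj (ft g k'))"
    unfolding w[OF fin(1)] by (simp only: distrib_left mult_ac)
  then have "theta_w k * wft h k - wft g k = exp (\<i> * of_real k) * (theta_w k * cnj D)"
    unfolding e w[OF fin(2)] by (simp only: distrib_left mult_1 add_diff_cancel_right')
  then have "cmod (theta_w k * wft h k - wft g k) = cmod (theta_w k) * cmod D"
    by (simp add: norm_mult)
  also have "\<dots> \<le> 1 * \<epsilon>" using D cmod_theta_w_le by (intro mult_mono) auto
  finally show ?thesis by simp
qed

lemma theta_form_scaling:
  assumes c: "half_shift_close \<epsilon> h g" and q: "qmf h" "qmf g" and b: "fins b" and x: "fins x"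
  shows "cmod (l2inner b (fmult theta_w (msup (ft h) x)) - l2inner (msup_adj (ft g) b) (fmult theta_w x))
     \<le> \<epsilon> * (l2norm b * l2norm x)"
proof -
  let ?b = "fmult (\<lambda>k. cnj (ft g k)) b"
  have fb: "fins ?b" and ftb: "\<And>k. ft ?b k = cnj (ft g k) * ft b k"
    using fmult_trig(1,2)[OF trig_cnj[OF qmf_trig(1)[OF q(2)]] b] by auto
  \<comment> \<open>Downsampling in \<open>msup_adj\<close> moves to the other side as upsampling of
    \<open>fmult theta_w x\<close>, which turns \<open>theta_w\<close> into
    \<open>theta_two\<close>; both forms then pair transforms of \<open>b\<close> and
    \<open>up x\<close>.\<close>
  have eq: "l2inner (msup_adj (ft g) b) (fmult theta_w x) = l2inner ?b (fmult theta_two (up x))"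
    by (simp add: fmult_theta_two_up x l2inner_up_right msup_adj_def)
  have int: "((\<lambda>k. cnj (ft b k) * (theta_w k * (ft h k * ft (up x) k)) - cnj (ft ?b k) * (theta_two k * ft (up x) k))
    has_integral of_real (2 * pi) * (l2inner b (fmult theta_w (msup (ft h) x)) - l2inner (msup_adj (ft g) b) (fmult theta_w x)))
    {-pi..pi}"
    unfolding right_diff_distrib eq
    using has_integral_diff[OF has_integral_fmult[OF theta_w_integrable b fins_qmf(3)[OF q(1) x]]
      has_integral_fmult[OF theta_two_integrable fb fins_up[OF x]]]
    by (simp add: ft_msup[OF qmf_trig(1)[OF q(1)] x])
  have "cmod (l2inner b (fmult theta_w (msup (ft h) x)) - l2inner (msup_adj (ft g) b) (fmult theta_w x))
     \<le> \<epsilon> * (l2norm b * l2norm (up x))"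
  proof (rule multiplier_bound[OF b fins_up[OF x] int])
    show "\<epsilon> \<ge> 0" using c by (simp add: half_shift_close_def)
    fix k assume k: "-pi < k" "k < pi"
    have "cnj (ft b k) * (theta_w k * (ft h k * ft (up x) k)) - cnj (ft ?b k) * (theta_two k * ft (up x) k)
      = (theta_w k * ft h k - theta_two k * ft g k) * (cnj (ft b k) * ft (up x) k)"
      by (simp add: ftb algebra_simps)
    then show "cmod (cnj (ft b k) * (theta_w k * (ft h k * ft (up x) k)) - cnj (ft ?b k) * (theta_two k * ft (up x) k))
       \<le> \<epsilon> * (cmod (ft b k) * cmod (ft (up x) k))"
      using theta_scaling_close[OF c k] by (simp add: norm_mult mult_right_mono)
  qed
  then show ?thesis by (simp add: l2norm_up x)
qed

lemma theta_form_wavelet: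
  assumes c: "half_shift_close \<epsilon> h g" and q: "qmf h" "qmf g" and b: "fins b" and x: "fins x"
  shows "cmod (l2inner b (fmult theta_w (msup (wft h) x)) - l2inner (msup_adj (wft g) b) x)
     \<le> \<epsilon> * (l2norm b * l2norm x)"
proof -
  have eq: "l2inner (msup_adj (wft g) b) x = l2inner b (msup (wft g) x)"
    using l2inner_msup[OF qmf_trig(2)[OF q(2)] x b] by simp
  have int: "((\<lambda>k. cnj (ft b k) * (theta_w k * (wft h k * ft (up x) k)) - cnj (ft b k) * (wft g k * ft (up x) k))
    has_integral of_real (2 * pi) * (l2inner b (fmult theta_w (msup (wft h) x)) - l2inner (msup_adj (wft g) b) x))
    {-pi..pi}"
    unfolding right_diff_distrib eq
    using has_integral_diff[OF has_integral_fmult[OF theta_w_integrable b fins_qmf(4)[OF q(1) x]]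
      parseval[OF b fins_qmf(4)[OF q(2) x]]]
    by (simp add: ft_msup[OF qmf_trig(2)[OF q(1)] x] ft_msup[OF qmf_trig(2)[OF q(2)] x])
  have "cmod (l2inner b (fmult theta_w (msup (wft h) x)) - l2inner (msup_adj (wft g) b) x)
     \<le> \<epsilon> * (l2norm b * l2norm (up x))"
  proof (rule multiplier_bound[OF b fins_up[OF x] int])
    show "\<epsilon> \<ge> 0" using c by (simp add: half_shift_close_def)
    fix k :: real assume k: "-pi < k" "k < pi" "k \<noteq> 0"
    have "cnj (ft b k) * (theta_w k * (wft h k * ft (up x) k)) - cnj (ft b k) * (wft g k * ft (up x) k)
      = (theta_w k * wft h k - wft g k) * (cnj (ft b k) * ft (up x) k)"
      by (simp add: algebra_simps)
    moreover have "fins h" "fins g" using q by (auto simp: qmf_def)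
    ultimately show "cmod (cnj (ft b k) * (theta_w k * (wft h k * ft (up x) k)) - cnj (ft b k) * (wft g k * ft (up x) k))
       \<le> \<epsilon> * (cmod (ft b k) * cmod (ft (up x) k))"
      using theta_wavelet_close[OF c _ _ k] by (simp add: norm_mult mult_right_mono)
  qed
  then show ?thesis by (simp add: l2norm_up x)
qed


text \<open>Only \<open>a\<close> is split into its coarse and wavelet parts; each part costs one
  \<epsilon>, and the adjoint filters of \<open>g\<close> appear on \<open>b\<close> when the
  operators are moved across.\<close>

lemma theta_form_step:
  assumes c: "half_shift_close \<epsilon> h g" and q: "qmf h" "qmf g" and b: "fins b" and a: "fins a"
  shows "cmod (l2inner b (fmult theta_w a) - (l2inner (msup_adj (wft g) b) (msup_adj (wft h) a)
     + l2inner (msup_adj (ft g) b) (fmult theta_w (msup_adj (ft h) a)))) \<le> 2 * \<epsilon> * (l2norm b * l2norm a)"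
proof -
  let ?x = "msup_adj (ft h) a" and ?y = "msup_adj (wft h) a"
  note fa = fins_qmf[OF q(1) a]
  have eps: "\<epsilon> \<ge> 0" using c by (simp add: half_shift_close_def)
  have "fmult theta_w a = fmult theta_w (\<lambda>n. msup (ft h) ?x n + msup (wft h) ?y n)"
    using qmf_reconstruction[OF q(1) a] by simp
  also have "\<dots> = (\<lambda>n. fmult theta_w (msup (ft h) ?x) n + fmult theta_w (msup (wft h) ?y) n)"
    by (rule fmult_add[OF fins_qmf(3)[OF q(1) fa(1)] fins_qmf(4)[OF q(1) fa(2)]])
  finally have eq: "l2inner b (fmult theta_w a) = l2inner b (fmult theta_w (msup (ft h) ?x)) + l2inner b (fmult theta_w (msup (wft h) ?y))"
    by (simp add: l2inner_add_right b)
  have 1: "cmod (l2inner b (fmult theta_w (msup (ft h) ?x)) - l2inner (msup_adj (ft g) b) (fmult theta_w ?x)) \<le> \<epsilon> * (l2norm b * l2norm a)"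
    by (rule order_trans[OF theta_form_scaling[OF c q b fa(1)]])
       (intro mult_left_mono qmf_contraction(1)[OF q(1) a] eps l2norm_nonneg)
  have 2: "cmod (l2inner b (fmult theta_w (msup (wft h) ?y)) - l2inner (msup_adj (wft g) b) ?y) \<le> \<epsilon> * (l2norm b * l2norm a)"
    by (rule order_trans[OF theta_form_wavelet[OF c q b fa(2)]])
       (intro mult_left_mono qmf_contraction(2)[OF q(1) a] eps l2norm_nonneg)
  have *: "cmod (p + r - (w + u)) \<le> 2 * \<epsilon> * e"
    if "cmod (p - u) \<le> \<epsilon> * e" "cmod (r - w) \<le> \<epsilon> * e" for p r u w e
    using norm_triangle_le[OF add_mono[OF that]] by (simp add: algebra_simps)
  show ?thesis unfolding eq by (rule *[OF 1 2])
qed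

lemma theta_form_levels:
  assumes c: "half_shift_close \<epsilon> h g" and q: "qmf h" "qmf g" and b: "fins b" and a: "fins a"
  shows "cmod (l2inner b (fmult theta_w a) - (wform g h L b a
     + l2inner ((msup_adj (ft g) ^^ L) b) (fmult theta_w ((msup_adj (ft h) ^^ L) a)))) \<le> 2 * \<epsilon> * real L * (l2norm b * l2norm a)"
  using a b
proof (induction L arbitrary: a b)
  case (Suc L)
  let ?b = "msup_adj (ft g) b" and ?a = "msup_adj (ft h) a"
  have eps: "\<epsilon> \<ge> 0" using c by (simp add: half_shift_close_def)
  have f: "fins ?a" "fins ?b" using fins_qmf q Suc.prems by auto
  have "l2norm ?b * l2norm ?a \<le> l2norm b * l2norm a"
    by (intro mult_mono qmf_contraction(1) q Suc.prems l2norm_nonneg)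
  then have "2 * \<epsilon> * real L * (l2norm ?b * l2norm ?a) \<le> 2 * \<epsilon> * real L * (l2norm b * l2norm a)"
    using eps by (intro mult_left_mono) auto
  with Suc.IH[OF f] have 1: "cmod (l2inner ?b (fmult theta_w ?a) - (wform g h L ?b ?a
     + l2inner ((msup_adj (ft g) ^^ L) ?b) (fmult theta_w ((msup_adj (ft h) ^^ L) ?a)))) \<le> 2 * \<epsilon> * real L * (l2norm b * l2norm a)"
    by linarith
  have eq: "l2inner b (fmult theta_w a) - (wform g h (Suc L) b a
     + l2inner ((msup_adj (ft g) ^^ Suc L) b) (fmult theta_w ((msup_adj (ft h) ^^ Suc L) a)))
    = (l2inner b (fmult theta_w a) - (l2inner (msup_adj (wft g) b) (msup_adj (wft h) a) + l2inner ?b (fmult theta_w ?a)))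
     + (l2inner ?b (fmult theta_w ?a) - (wform g h L ?b ?a
     + l2inner ((msup_adj (ft g) ^^ L) ?b) (fmult theta_w ((msup_adj (ft h) ^^ L) ?a))))"
    by (simp only: wform_Suc funpow_Suc_right o_apply) (simp add: algebra_simps)
  have sum: "2 * \<epsilon> * (l2norm b * l2norm a) + 2 * \<epsilon> * real L * (l2norm b * l2norm a)
      = 2 * \<epsilon> * real (Suc L) * (l2norm b * l2norm a)"
    by (simp add: distrib_left distrib_right)
  show ?case
    unfolding eq sum[symmetric]
    by (rule norm_triangle_le, rule add_mono[OF theta_form_step[OF c q Suc.prems(2,1)] 1])
qed simp

text \<open>The comparison stops at a level \<open>m\<close> of choice. Beyond it, the remaining
  \<open>L - m\<close> levels and the multiplier on the coarse components are not compared but each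
  bounded by the product of the coarse norms, hence the factor 2.\<close>

lemma theta_wform_close:
  assumes c: "half_shift_close \<epsilon> h g" and q: "qmf h" "qmf g" and b: "fins b" and a: "fins a" and "m \<le> L"
  shows "cmod (l2inner b (fmult theta_w a) - wform g h L b a)
    \<le> 2 * \<epsilon> * real m * (l2norm b * l2norm a) + 2 * (l2norm ((msup_adj (ft g) ^^ m) b) * l2norm ((msup_adj (ft h) ^^ m) a))"
proof -
  let ?b = "(msup_adj (ft g) ^^ m) b" and ?a = "(msup_adj (ft h) ^^ m) a"
  have f: "fins ?b" "fins ?a" using fins_qmf q a b by auto
  have "wform g h L b a = wform g h m b a + wform g h (L - m) ?b ?a"
    using wform_add[of g h m "L - m" b a] \<open>m \<le> L\<close> by simp
  then have eq: "l2inner b (fmult theta_w a) - wform g h L b a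
     = (l2inner b (fmult theta_w a) - (wform g h m b a + l2inner ?b (fmult theta_w ?a)))
       + (l2inner ?b (fmult theta_w ?a) - wform g h (L - m) ?b ?a)"
    by simp
  have "cmod (l2inner ?b (fmult theta_w ?a) - wform g h (L - m) ?b ?a) \<le> l2norm ?b * l2norm ?a + l2norm ?b * l2norm ?a"
    by (rule order_trans[OF norm_triangle_ineq4 add_mono[OF theta_form_bound[OF f] wform_bound[OF q(2,1) f]]])
  then have "cmod (l2inner ?b (fmult theta_w ?a) - wform g h (L - m) ?b ?a) \<le> 2 * (l2norm ?b * l2norm ?a)"
    by simp
  then show ?thesis
    unfolding eq by (rule norm_triangle_le[OF add_mono[OF theta_form_levels[OF c q b a, of m]]])
qed

section \<open>The two symbols as sesquilinear forms\<close>

lemma l2inner_even_odd: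
  assumes "fins y"
  shows "l2inner y z = l2inner (\<lambda>n. y (2 * n)) (\<lambda>n. z (2 * n)) + l2inner (\<lambda>n. y (2 * n + 1)) (\<lambda>n. z (2 * n + 1))"
proof -
  define F where "F n = cnj (y n) * z n" for n
  have S: "finite {n. F n \<noteq> 0}"
    using assms unfolding fins_def by (rule rev_finite_subset) (auto simp: F_def)
  have summ: "F summable_on A" for A
  proof -
    have "F summable_on A \<longleftrightarrow> F summable_on (A \<inter> {n. F n \<noteq> 0})"
      by (rule summable_on_cong_neutral) auto
    then show ?thesis using S by (simp add: summable_on_finite)
  qed
  have U: "(UNIV :: int set) = range (\<lambda>n. 2 * n) \<union> range (\<lambda>n. 2 * n + 1)"
    by (auto elim!: evenE oddE) (metis evenE oddE rangeI)
  have "infsum F UNIV = infsum F (range (\<lambda>n. 2 * n)) + infsum F (range (\<lambda>n. 2 * n + 1))"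
  proof -
    have "range (\<lambda>n::int. 2 * n) \<inter> range (\<lambda>n. 2 * n + 1) = {}" by (auto, presburger)
    from infsum_Un_disjoint[OF summ summ this] show ?thesis unfolding U[symmetric] .
  qed
  also have "infsum F (range (\<lambda>n. 2 * n)) = l2inner (\<lambda>n. y (2 * n)) (\<lambda>n. z (2 * n))"
    by (subst infsum_reindex) (auto simp: inj_on_def F_def o_def l2inner_def)
  also have "infsum F (range (\<lambda>n. 2 * n + 1)) = l2inner (\<lambda>n. y (2 * n + 1)) (\<lambda>n. z (2 * n + 1))"
    by (subst infsum_reindex) (auto simp: inj_on_def F_def o_def l2inner_def)
  finally show ?thesis by (simp add: l2inner_def F_def)
qed

lemma l2inner_v:
  assumes "fins y"
  shows "l2inner y (v (p, q)) = l2inner (fst (v_adj y)) p + l2inner (snd (v_adj y)) q"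
  unfolding l2inner_even_odd[OF assms] by (simp add: v_def v_adj_def l2inner_def mult_ac)

lemma fins_even_odd:
  assumes "fins y" shows "fins (\<lambda>n. y (2 * n))" "fins (\<lambda>n. y (2 * n + 1))"
proof -
  show "fins (\<lambda>n. y (2 * n))" using fins_down[OF assms] by (simp add: down_def[abs_def])
  have "fins (down (\<lambda>n. y (n + 1)))" by (intro fins_down ft_shift(2) assms)
  then show "fins (\<lambda>n. y (2 * n + 1))" by (simp add: down_def[abs_def])
qed

lemma fins_v_adj:
  assumes "fins y" shows "fins (fst (v_adj y))" "fins (snd (v_adj y))"
  using fins_even_odd[OF assms] by (auto simp: v_adj_def intro: fins_sgnpow)

lemma v_adj_norm:
  assumes "fins y" shows "(l2norm (fst (v_adj y)))\<^sup>2 + (l2norm (snd (v_adj y)))\<^sup>2 = (l2norm y)\<^sup>2"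
proof -
  have "y = v (v_adj y)"
    by (auto simp: v_def v_adj_def fun_eq_iff sgnpow_def)
  then have "l2inner y y = l2inner y (v (fst (v_adj y), snd (v_adj y)))" by simp
  also have "\<dots> = l2inner (fst (v_adj y)) (fst (v_adj y)) + l2inner (snd (v_adj y)) (snd (v_adj y))"
    by (rule l2inner_v[OF assms])
  finally have "complex_of_real ((l2norm y)\<^sup>2) = of_real ((l2norm (fst (v_adj y)))\<^sup>2 + (l2norm (snd (v_adj y)))\<^sup>2)"
    unfolding l2inner_self[OF assms] l2inner_self[OF fins_v_adj(1)[OF assms]] l2inner_self[OF fins_v_adj(2)[OF assms]]
    by simp
  then show ?thesis by (simp only: of_real_eq_iff)
qed

text \<open>The upper off-diagonal block is written as the conjugate of a form with
  \<open>theta_w\<close>, arguments swapped, so that \<open>theta_wform_close\<close> serves both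
  off-diagonal blocks.\<close>

lemma l2inner_omega:
  assumes f: "fins f" and y: "fins y"
  defines "a \<equiv> fst (v_adj f)" and "b \<equiv> snd (v_adj f)" and "a' \<equiv> fst (v_adj y)" and "b' \<equiv> snd (v_adj y)"
  shows "l2inner y (omega f) = (l2inner a' a + cnj (l2inner b (fmult theta_w a')) + (l2inner b' (fmult theta_w a) + l2inner b' b)) / 2"
proof -
  have fin: "fins a" "fins b" "fins a'" "fins b'" unfolding a_def b_def a'_def b'_def using fins_v_adj f y by auto
  let ?s = "\<lambda>n. (a n + fmult (\<lambda>k. cnj (theta_w k)) b n) / 2"
  have "omega f = v (?s, fmult theta_w ?s)"
    by (simp add: omega_def a_def b_def Let_def)
  also have "fmult theta_w ?s = (\<lambda>n. (fmult theta_w a n + b n) / 2)"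
    using fmult_theta_omega[OF fin(1,2)] by blast
  finally have "l2inner y (omega f) = l2inner a' ?s + l2inner b' (\<lambda>n. (fmult theta_w a n + b n) / 2)"
    using l2inner_v[OF y] by (simp add: a'_def b'_def)
  then show ?thesis
    using fin by (simp add: l2inner_divide_right l2inner_add_right l2inner_fmult_cnj add_divide_distrib)
qed

lemma l2inner_msup_funpow:
  assumes "qmf h" "fins x" "fins y"
  shows "l2inner y ((msup (ft h) ^^ l) x) = l2inner ((msup_adj (ft h) ^^ l) y) x"
  using assms(3)
proof (induction l arbitrary: y)
  case (Suc l)
  have "l2inner y ((msup (ft h) ^^ Suc l) x) = l2inner (msup_adj (ft h) y) ((msup (ft h) ^^ l) x)"
    using l2inner_msup[OF qmf_trig(1)[OF assms(1)] fins_qmf(6)[OF assms(1,2)] Suc.prems] by simp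
  also have "\<dots> = l2inner ((msup_adj (ft h) ^^ l) (msup_adj (ft h) y)) x"
    by (rule Suc.IH) (rule fins_qmf(1)[OF assms(1) Suc.prems])
  finally show ?case by (simp add: funpow_swap1)
qed simp

lemma msup_zero: "msup \<theta> (\<lambda>n. 0) = (\<lambda>n. 0)"
  by (simp add: msup_def fmult_def conv_def up_def fun_eq_iff)

lemma msup_funpow_zero: "(msup \<theta> ^^ l) (\<lambda>n. 0) = (\<lambda>n. 0)"
  by (induction l) (simp_all add: msup_zero)

lemma l2inner_W_adj:
  assumes q: "qmf h" and y: "fins y" and S: "\<And>l. fins (\<lambda>m. X m l)" and top: "\<And>m. X m (L + 1) = 0"
  shows "l2inner y (W_adj h L X) = (\<Sum>l<L. l2inner (msup_adj (wft h) ((msup_adj (ft h) ^^ l) y)) (\<lambda>m. X m (l + 1)))"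
proof -
  have "W_adj h L X = (\<lambda>n. \<Sum>l\<in>{1..L}. ((msup (ft h) ^^ (l - 1)) (msup (wft h) (\<lambda>m. X m l))) n)"
    using top by (simp add: W_adj_def msup_funpow_zero)
  then have "l2inner y (W_adj h L X) = (\<Sum>l\<in>{1..L}. l2inner y ((msup (ft h) ^^ (l - 1)) (msup (wft h) (\<lambda>m. X m l))))"
    by (simp add: l2inner_sum_right y)
  also have "\<dots> = (\<Sum>l<L. l2inner y ((msup (ft h) ^^ l) (msup (wft h) (\<lambda>m. X m (l + 1)))))"
    using sum.atLeast1_atMost_eq[of "\<lambda>l. l2inner y ((msup (ft h) ^^ (l - 1)) (msup (wft h) (\<lambda>m. X m l)))" L] by simp
  also have "\<dots> = (\<Sum>l<L. l2inner (msup_adj (wft h) ((msup_adj (ft h) ^^ l) y)) (\<lambda>m. X m (l + 1)))"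
    using q y S by (intro sum.cong refl)
      (simp add: l2inner_msup_funpow fins_qmf l2inner_msup[OF qmf_trig(2)[OF q]])
  finally show ?thesis .
qed

lemma wform_cnj:
  assumes "qmf h" "qmf g" "fins b" "fins a"
  shows "wform h g L a b = cnj (wform g h L b a)"
  unfolding wform_def cnj_sum using assms by (intro sum.cong refl l2inner_commute disjI1 fins_qmf)

lemma l2inner_omega_MERA:
  assumes q: "qmf h" "qmf g" and f: "fins f" and y: "fins y"
  defines "a \<equiv> fst (v_adj f)" and "b \<equiv> snd (v_adj f)" and "a' \<equiv> fst (v_adj y)" and "b' \<equiv> snd (v_adj y)"
  shows "l2inner y (omega_MERA h g L f)
     = (wform h h L a' a + cnj (wform g h L b a') + (wform g h L b' a + wform g g L b' b)) / 2"
proof -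
  have fin: "fins a" "fins b" "fins a'" "fins b'" unfolding a_def b_def a'_def b'_def using fins_v_adj f y by auto
  define S where "S = (\<lambda>n l. if 1 \<le> l \<and> l \<le> L then (W h L a n l + W g L b n l) / 2 else 0)"
  have S: "(\<lambda>m. S m (l + 1)) = (\<lambda>m. (msup_adj (wft h) ((msup_adj (ft h) ^^ l) a) m + msup_adj (wft g) ((msup_adj (ft g) ^^ l) b) m) / 2)"
    if "l < L" for l
    using that by (simp add: S_def W_def fun_eq_iff)
  have finS: "fins (\<lambda>m. S m l)" for l
  proof (cases "1 \<le> l \<and> l \<le> L")
    case True
    then obtain k where "l = k + 1" "k < L" by (metis Suc_eq_plus1 Suc_le_D Suc_le_lessD One_nat_def)
    then show ?thesis using S[of k] fin q by (simp add: fins_divide fins_add fins_qmf)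
  next
    case False
    then have "(\<lambda>m. S m l) = (\<lambda>m. 0)" unfolding S_def by (simp only: if_False)
    then show ?thesis by simp
  qed
  have top: "S m (L + 1) = 0" for m by (simp add: S_def)
  have "l2inner y (omega_MERA h g L f) = l2inner a' (W_adj h L S) + l2inner b' (W_adj g L S)"
    unfolding omega_MERA_def Let_def a_def b_def a'_def b'_def S_def by (rule l2inner_v[OF y])
  also have "l2inner a' (W_adj h L S) = (wform h h L a' a + wform h g L a' b) / 2"
    unfolding l2inner_W_adj[of h a' S L, OF q(1) fin(3) finS top] wform_def sum.distrib[symmetric] sum_divide_distrib
    using S fin q by (intro sum.cong refl) (simp add: l2inner_divide_right l2inner_add_right fins_qmf)
  also have "l2inner b' (W_adj g L S) = (wform g h L b' a + wform g g L b' b) / 2"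
    unfolding l2inner_W_adj[of g b' S L, OF q(2) fin(4) finS top] wform_def sum.distrib[symmetric] sum_divide_distrib
    using S fin q by (intro sum.cong refl) (simp add: l2inner_divide_right l2inner_add_right fins_qmf)
  finally show ?thesis using wform_cnj[OF q fin(2,3)] by (simp add: add_divide_distrib)
qed

text \<open>This is the operator norm 1 of the projection \<open>|+><+|\<close>, applied to the
  norms of the even and odd components.\<close>

lemma four_products_le:
  fixes a b a' b' x y :: real
  assumes "a\<^sup>2 + b\<^sup>2 = x\<^sup>2" "a'\<^sup>2 + b'\<^sup>2 = y\<^sup>2" "x \<ge> 0" "y \<ge> 0"
  shows "(a' * a + b * a' + (b' * a + b' * b)) / 2 \<le> y * x"
proof -
  have "(a' * a + b * a' + (b' * a + b' * b)) = (a' * a + b' * b) + (a' * b + b' * a)"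
    by (simp add: algebra_simps)
  also have "\<dots> \<le> y * x + y * x"
    using assms by (intro add_mono cauchy_schwarz_2) (auto simp: add.commute)
  finally show ?thesis by (simp add: mult.commute)
qed

lemma omega_form_bound:
  assumes f: "fins f" and y: "fins y"
  shows "cmod (l2inner y (omega f)) \<le> l2norm y * l2norm f"
proof -
  note fin = fins_v_adj[OF f] fins_v_adj[OF y]
  have "cmod (l2inner y (omega f)) \<le> (l2norm (fst (v_adj y)) * l2norm (fst (v_adj f)) + l2norm (snd (v_adj f)) * l2norm (fst (v_adj y))
      + (l2norm (snd (v_adj y)) * l2norm (fst (v_adj f)) + l2norm (snd (v_adj y)) * l2norm (snd (v_adj f)))) / 2"
    unfolding l2inner_omega[OF f y] norm_divide
    using fin by (intro divide_mono norm_triangle_le add_mono) (auto intro: l2inner_cauchy_schwarz theta_form_bound)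
  also have "\<dots> \<le> l2norm y * l2norm f"
    by (rule four_products_le[OF v_adj_norm[OF f] v_adj_norm[OF y]]) auto
  finally show ?thesis .
qed

lemma omega_MERA_form_bound:
  assumes q: "qmf h" "qmf g" and f: "fins f" and y: "fins y"
  shows "cmod (l2inner y (omega_MERA h g L f)) \<le> l2norm y * l2norm f"
proof -
  note fin = fins_v_adj[OF f] fins_v_adj[OF y]
  have "cmod (l2inner y (omega_MERA h g L f)) \<le> (l2norm (fst (v_adj y)) * l2norm (fst (v_adj f)) + l2norm (snd (v_adj f)) * l2norm (fst (v_adj y))
      + (l2norm (snd (v_adj y)) * l2norm (fst (v_adj f)) + l2norm (snd (v_adj y)) * l2norm (snd (v_adj f)))) / 2"
    unfolding l2inner_omega_MERA[OF q f y] norm_divide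
    using fin q by (intro divide_mono norm_triangle_le add_mono) (auto intro: wform_bound)
  also have "\<dots> \<le> l2norm y * l2norm f"
    by (rule four_products_le[OF v_adj_norm[OF f] v_adj_norm[OF y]]) auto
  finally show ?thesis .
qed

text \<open>The diagonal blocks are compared at the full depth \<open>L\<close>, by
  \<open>wform_self\<close>, and cost \<kappa>'. The off-diagonal ones are stopped at
  \<open>m\<close> and cost the \<epsilon> term and \<kappa>. Each kind occurs twice, which cancels
  the factor 1/2 in \<open>|+><+|\<close>. Decay is used only for the components of
  \<open>f\<close>; those of the arbitrary test vector \<open>y\<close> are merely
  contracted.\<close>

lemma omega_difference_bound:
  assumes c: "half_shift_close \<epsilon> h g" and q: "qmf h" "qmf g" and f: "fins f" "l2norm f \<le> 1" and y: "fins y"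
    and m: "m \<le> L" and \<kappa>: "\<kappa> \<ge> 0" "\<kappa>' \<ge> 0"
    and decay: "l2norm ((msup_adj (ft h) ^^ m) (fst (v_adj f))) \<le> \<kappa>" "l2norm ((msup_adj (ft g) ^^ m) (snd (v_adj f))) \<le> \<kappa>"
      "l2norm ((msup_adj (ft h) ^^ L) (fst (v_adj f))) \<le> \<kappa>'" "l2norm ((msup_adj (ft g) ^^ L) (snd (v_adj f))) \<le> \<kappa>'"
  shows "cmod (l2inner y (omega f) - l2inner y (omega_MERA h g L f)) \<le> (\<kappa>' + 2 * \<epsilon> * real m + 2 * \<kappa>) * l2norm y"
proof -
  define a b a' b' where "a = fst (v_adj f)" "b = snd (v_adj f)" "a' = fst (v_adj y)" "b' = snd (v_adj y)"
  note ab = a_b_a'_b'_def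
  have fin: "fins a" "fins b" "fins a'" "fins b'" unfolding ab using fins_v_adj f y by auto
  have eps: "\<epsilon> \<ge> 0" using c by (simp add: half_shift_close_def)
  have "(l2norm a)\<^sup>2 \<le> (l2norm f)\<^sup>2" "(l2norm b)\<^sup>2 \<le> (l2norm f)\<^sup>2"
    "(l2norm a')\<^sup>2 \<le> (l2norm y)\<^sup>2" "(l2norm b')\<^sup>2 \<le> (l2norm y)\<^sup>2"
    unfolding v_adj_norm[OF f(1), symmetric] v_adj_norm[OF y, symmetric] ab by simp_all
  then have le: "l2norm a \<le> 1" "l2norm b \<le> 1" "l2norm a' \<le> l2norm y" "l2norm b' \<le> l2norm y"
    using power2_le_imp_le[OF _ l2norm_nonneg] f(2) order_trans by blast+
  have diag: "cmod (l2inner x' x - wform w w L x' x) \<le> l2norm y * \<kappa>'"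
    if "qmf w" "fins x'" "fins x" "l2norm x' \<le> l2norm y" "l2norm ((msup_adj (ft w) ^^ L) x) \<le> \<kappa>'" for w x x'
  proof -
    have "cmod (l2inner x' x - wform w w L x' x) = cmod (l2inner ((msup_adj (ft w) ^^ L) x') ((msup_adj (ft w) ^^ L) x))"
      by (simp add: wform_self[OF that(1-3)])
    also have "\<dots> \<le> l2norm ((msup_adj (ft w) ^^ L) x') * l2norm ((msup_adj (ft w) ^^ L) x)"
      by (intro l2inner_cauchy_schwarz fins_qmf that)
    also have "\<dots> \<le> l2norm y * \<kappa>'"
      by (intro mult_mono that l2norm_nonneg order_trans[OF qmf_contraction(3)[OF that(1,2)]])
    finally show ?thesis .
  qed
  have off1: "cmod (l2inner b' (fmult theta_w a) - wform g h L b' a) \<le> 2 * \<epsilon> * real m * l2norm y + 2 * (l2norm y * \<kappa>)"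
  proof (rule order_trans[OF theta_wform_close[OF c q fin(4,1) m]])
    have "l2norm b' * l2norm a \<le> l2norm y * 1" by (intro mult_mono le) auto
    then have "2 * \<epsilon> * real m * (l2norm b' * l2norm a) \<le> 2 * \<epsilon> * real m * (l2norm y * 1)"
      using eps by (intro mult_left_mono) auto
    moreover have "l2norm ((msup_adj (ft g) ^^ m) b') * l2norm ((msup_adj (ft h) ^^ m) a) \<le> l2norm y * \<kappa>"
      using decay by (intro mult_mono order_trans[OF qmf_contraction(3)[OF q(2) fin(4)]] le) (auto simp: ab)
    ultimately show "2 * \<epsilon> * real m * (l2norm b' * l2norm a) + 2 * (l2norm ((msup_adj (ft g) ^^ m) b') * l2norm ((msup_adj (ft h) ^^ m) a))
      \<le> 2 * \<epsilon> * real m * l2norm y + 2 * (l2norm y * \<kappa>)" by simp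
  qed
  have off2: "cmod (l2inner b (fmult theta_w a') - wform g h L b a') \<le> 2 * \<epsilon> * real m * l2norm y + 2 * (l2norm y * \<kappa>)"
  proof (rule order_trans[OF theta_wform_close[OF c q fin(2,3) m]])
    have "l2norm b * l2norm a' \<le> 1 * l2norm y" by (intro mult_mono le) auto
    then have "2 * \<epsilon> * real m * (l2norm b * l2norm a') \<le> 2 * \<epsilon> * real m * (1 * l2norm y)"
      using eps by (intro mult_left_mono) auto
    moreover have "l2norm ((msup_adj (ft g) ^^ m) b) * l2norm ((msup_adj (ft h) ^^ m) a') \<le> \<kappa> * l2norm y"
      using decay \<kappa> by (intro mult_mono order_trans[OF qmf_contraction(3)[OF q(1) fin(3)]] le) (auto simp: ab)
    ultimately show "2 * \<epsilon> * real m * (l2norm b * l2norm a') + 2 * (l2norm ((msup_adj (ft g) ^^ m) b) * l2norm ((msup_adj (ft h) ^^ m) a'))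
      \<le> 2 * \<epsilon> * real m * l2norm y + 2 * (l2norm y * \<kappa>)"
      unfolding mult_1 mult.commute[of \<kappa> "l2norm y"] by linarith
  qed
  have eq: "l2inner y (omega f) - l2inner y (omega_MERA h g L f)
     = ((l2inner a' a - wform h h L a' a) + cnj (l2inner b (fmult theta_w a') - wform g h L b a')
       + ((l2inner b' (fmult theta_w a) - wform g h L b' a) + (l2inner b' b - wform g g L b' b))) / 2"
    unfolding l2inner_omega[OF f(1) y] l2inner_omega_MERA[OF q f(1) y] ab by (simp add: field_simps)
  have "cmod (l2inner y (omega f) - l2inner y (omega_MERA h g L f))
      \<le> ((l2norm y * \<kappa>' + (2 * \<epsilon> * real m * l2norm y + 2 * (l2norm y * \<kappa>)))
       + ((2 * \<epsilon> * real m * l2norm y + 2 * (l2norm y * \<kappa>)) + l2norm y * \<kappa>')) / 2"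
    unfolding eq norm_divide
  proof (intro divide_mono norm_triangle_le add_mono)
    show "cmod (l2inner a' a - wform h h L a' a) \<le> l2norm y * \<kappa>'"
      using decay(3) by (intro diag q fin le) (simp add: ab)
    show "cmod (l2inner b' b - wform g g L b' b) \<le> l2norm y * \<kappa>'"
      using decay(4) by (intro diag q fin le) (simp add: ab)
    show "cmod (cnj (l2inner b (fmult theta_w a') - wform g h L b a')) \<le> 2 * \<epsilon> * real m * l2norm y + 2 * (l2norm y * \<kappa>)"
      unfolding complex_mod_cnj by (rule off2)
  qed (use off1 \<kappa> eps in auto)
  then show ?thesis by (simp add: algebra_simps)
qed

section \<open>Decay of the coarse component\<close>


text \<open>This is the image of \<open>delta 0\<close> under \<open>L\<close> synthesis steps.\<close>

primrec level_filter :: "seq \<Rightarrow> nat \<Rightarrow> seq" where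
  "level_filter h 0 = delta 0"
| "level_filter h (Suc L) = (\<lambda>p. \<Sum>n | h n \<noteq> 0. h n * level_filter h L (p - 2 ^ L * n))"

definition supported_in :: "int \<Rightarrow> nat \<Rightarrow> seq \<Rightarrow> bool" where
  "supported_in a M h \<longleftrightarrow> (\<forall>n. h n \<noteq> 0 \<longrightarrow> a \<le> n \<and> n < a + int M)"

text \<open>The copies of \<open>h\<close> are dilated by 1, 2, ..., 2^(L - 1), and these factors
  add up to 2^L - 1.\<close>

lemma level_filter_support:
  assumes "supported_in a M h" "level_filter h L p \<noteq> 0"
  shows "(2 ^ L - 1) * a \<le> p \<and> p \<le> (2 ^ L - 1) * (a + int M - 1)"
  using assms(2)
proof (induction L arbitrary: p)
  case (Suc L)
  from Suc.prems obtain n where n: "h n \<noteq> 0" "level_filter h L (p - 2 ^ L * n) \<noteq> 0"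
    by (auto elim: sum.not_neutral_contains_not_neutral)
  have an: "a \<le> n" "n \<le> a + int M - 1" using n(1) assms(1) by (auto simp: supported_in_def)
  have "2 ^ L * a \<le> 2 ^ L * n" "2 ^ L * n \<le> 2 ^ L * (a + int M - 1)" using an by auto
  moreover have e: "(2 ^ Suc L - 1) * c = 2 ^ L * c + (2 ^ L - 1) * c" for c :: int
    by (simp add: algebra_simps)
  ultimately show ?case unfolding e using Suc.IH[OF n(2)] by linarith
qed (auto simp: delta_def split: if_splits)

lemma fins_level_filter:
  assumes "supported_in a M h" shows "fins (level_filter h L)"
  unfolding fins_def
  by (rule finite_subset[of _ "{(2 ^ L - 1) * a..(2 ^ L - 1) * (a + int M - 1)}"])
     (use level_filter_support[OF assms] in auto)

lemma msup_adj_eq_sum: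
  assumes "fins h" "fins y"
  shows "msup_adj (ft h) y n = (\<Sum>i | h i \<noteq> 0. cnj (h i) * y (i + 2 * n))"
proof -
  have Y: "finite {n. y n \<noteq> 0}" and H: "finite {n. h n \<noteq> 0}" using assms by (auto simp: fins_def)
  have "msup_adj (ft h) y n = (\<Sum>j | y j \<noteq> 0. cnj (h (j - 2 * n)) * y j)"
    by (simp add: msup_adj_def down_def fmult_eq_sum[OF Y order_refl] fcoeff_cnj fcoeff_ft(1)[OF assms(1)])
  also have "\<dots> = (\<Sum>j \<in> (\<lambda>i. i + 2 * n) ` {i. h i \<noteq> 0}. cnj (h (j - 2 * n)) * y j)"
  proof (rule sum.mono_neutral_cong)
    show "cnj (h (j - 2 * n)) * y j = 0" if "j \<in> {j. y j \<noteq> 0} - (\<lambda>i. i + 2 * n) ` {i. h i \<noteq> 0}" for j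
    proof -
      have "h (j - 2 * n) = 0"
      proof (rule ccontr)
        assume "h (j - 2 * n) \<noteq> 0"
        then have "j \<in> (\<lambda>i. i + 2 * n) ` {i. h i \<noteq> 0}" by (intro image_eqI[of _ _ "j - 2 * n"]) auto
        with that show False by blast
      qed
      then show ?thesis by simp
    qed
  qed (use Y H in auto)
  also have "\<dots> = (\<Sum>i | h i \<noteq> 0. cnj (h i) * y (i + 2 * n))"
    by (subst sum.reindex) (auto simp: inj_on_def)
  finally show ?thesis .
qed

text \<open>The recursion of \<open>level_filter\<close> adds the new copy of \<open>h\<close> at
  the coarsest scale, which is what the outermost \<open>msup_adj\<close> contributes. The same
  order fits the substitution of \<open>2 * x - of_int n\<close> into the refinement equation
  below.\<close>

lemma msup_adj_funpow_eq_sum: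
  assumes q: "qmf h" and x: "fins x"
  shows "(msup_adj (ft h) ^^ L) x n = (\<Sum>m | x m \<noteq> 0. cnj (level_filter h L (m - 2 ^ L * n)) * x m)"
proof (induction L arbitrary: n)
  case 0
  have "finite {n. x n \<noteq> 0}" using x by (simp add: fins_def)
  moreover have "(\<Sum>m | x m \<noteq> 0. cnj (level_filter h 0 (m - 2 ^ 0 * n)) * x m) = (\<Sum>m | x m \<noteq> 0. if m = n then x m else 0)"
    by (intro sum.cong) (auto simp: delta_def)
  ultimately show ?case by simp
next
  case (Suc L)
  have h: "fins h" using q by (simp add: qmf_def)
  have "(msup_adj (ft h) ^^ Suc L) x n
      = (\<Sum>i | h i \<noteq> 0. \<Sum>m | x m \<noteq> 0. cnj (h i * level_filter h L (m - 2 ^ L * (i + 2 * n))) * x m)"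
    by (simp add: msup_adj_eq_sum[OF h fins_qmf(5)[OF q x]] Suc.IH sum_distrib_left mult.assoc)
  also have "\<dots> = (\<Sum>m | x m \<noteq> 0. \<Sum>i | h i \<noteq> 0. cnj (h i * level_filter h L (m - 2 ^ L * (i + 2 * n))) * x m)"
    by (rule sum.swap)
  also have "\<dots> = (\<Sum>m | x m \<noteq> 0. cnj (level_filter h (Suc L) (m - 2 ^ Suc L * n)) * x m)"
    by (simp add: cnj_sum sum_distrib_left algebra_simps)
  finally show ?case .
qed

lemma l2norm_delta: "l2norm (delta n) = 1"
proof -
  have "l2inner (delta n) (delta n) = 1" by (simp add: l2inner_delta) (simp add: delta_def)
  then have "complex_of_real ((l2norm (delta n))\<^sup>2) = of_real 1" by (simp only: l2inner_self[OF fins_delta] of_real_1)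
  then have "(l2norm (delta n))\<^sup>2 = 1" by (simp only: of_real_eq_iff)
  then show ?thesis using l2norm_nonneg[of "delta n"] unfolding power2_eq_1_iff by linarith
qed

lemma l2norm_level_filter:
  assumes q: "qmf h" and s: "supported_in a M h"
  shows "l2norm (level_filter h L) \<le> 1"
proof -
  define u where "u = level_filter h L"
  have u: "fins u" unfolding u_def by (rule fins_level_filter[OF s])
  have U: "finite {m. u m \<noteq> 0}" using u by (simp add: fins_def)
  \<comment> \<open>The value at 0 of the contraction \<open>msup_adj (ft h) ^^ L\<close> on \<open>u\<close> itself is the squared norm of \<open>u\<close>.\<close>
  have "(msup_adj (ft h) ^^ L) u 0 = l2inner u u"
    using msup_adj_funpow_eq_sum[OF q u, of L 0] l2inner_eq_sip[OF U, of u u] by (simp add: sip_def u_def[symmetric])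
  then have "complex_of_real ((l2norm u)\<^sup>2) = l2inner (delta 0) ((msup_adj (ft h) ^^ L) u)"
    using l2inner_self[OF u] by (simp add: l2inner_delta)
  then have "cmod (complex_of_real ((l2norm u)\<^sup>2)) \<le> l2norm (delta 0) * l2norm ((msup_adj (ft h) ^^ L) u)"
    using l2inner_cauchy_schwarz[OF fins_delta[of 0] fins_qmf(5)[OF q u, of L]] by (simp only:)
  also have "\<dots> \<le> l2norm u" using qmf_contraction(3)[OF q u, of L] by (simp add: l2norm_delta)
  finally have "(l2norm u)\<^sup>2 \<le> l2norm u" unfolding norm_of_real by simp
  then show ?thesis
    using l2norm_nonneg[of u] unfolding u_def[symmetric]
    by (cases "l2norm u = 0") (auto simp: power2_eq_square less_le)
qed

lemma refinement_iterate:
  assumes \<phi>: "scaling_function h \<phi>" and s: "supported_in a M h" and h: "fins h"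
  shows "AE x in lborel. \<phi> x = of_real (sqrt 2 ^ L) * (\<Sum>m | level_filter h L m \<noteq> 0. level_filter h L m * \<phi> (2 ^ L * x - of_int m))"
proof (induction L)
  case 0
  have "{m. level_filter h 0 m \<noteq> 0} = {0}" by (auto simp: delta_def)
  then show ?case by (simp add: delta_def)
next
  case (Suc L)
  let ?u = "level_filter h L" and ?A = "{n. h n \<noteq> 0}"
  have A: "finite ?A" using h by (simp add: fins_def)
  have T: "finite {m. ?u m \<noteq> 0}" using fins_level_filter[OF s] by (simp add: fins_def)
  have meas[measurable]: "\<phi> \<in> borel_measurable borel"
    using \<phi> by (auto simp: scaling_function_def dest: borel_measurable_integrable)
  have ref: "AE x in lborel. \<phi> x = of_real (sqrt 2) * (\<Sum>n\<in>?A. h n * \<phi> (2 * x - of_int n))"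
    using \<phi> infsum_eq_sum[OF A, of "\<lambda>n. h n * \<phi> (2 * _ - of_int n)"] by (simp add: scaling_function_def)
  \<comment> \<open>The induction hypothesis is needed at the points
    \<open>2 * x - of_int n\<close>: preimages of null sets under affine maps are null, and only
    finitely many \<open>n\<close> occur.\<close>
  have "AE x in lborel. \<forall>n\<in>?A. \<phi> (2 * x - of_int n) = of_real (sqrt 2 ^ L) * (\<Sum>m | ?u m \<noteq> 0. ?u m * \<phi> (2 ^ L * (2 * x - of_int n) - of_int m))"
  proof (rule AE_finite_allI[OF A])
    fix n
    let ?P = "\<lambda>y. \<phi> y = of_real (sqrt 2 ^ L) * (\<Sum>m | ?u m \<noteq> 0. ?u m * \<phi> (2 ^ L * y - of_int m))"
    have "AE x in lborel. ?P (- of_int n + 2 * x)"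
      by (rule AE_borel_affine[OF _ _ Suc]) (simp, measurable)
    then show "AE x in lborel. \<phi> (2 * x - of_int n) = of_real (sqrt 2 ^ L) * (\<Sum>m | ?u m \<noteq> 0. ?u m * \<phi> (2 ^ L * (2 * x - of_int n) - of_int m))"
      by (simp add: algebra_simps)
  qed
  with ref show ?case
  proof eventually_elim
    case (elim x)
    let ?F = "\<lambda>p. \<phi> (2 ^ Suc L * x - of_int p)"
    \<comment> \<open>A common index set for all shifted copies of \<open>?u\<close>, possibly
      larger than the support of the next filter because of cancellation; it permits swapping the
      sums.\<close>
    define S where "S = (\<lambda>(n, m). m + 2 ^ L * n) ` (?A \<times> {m. ?u m \<noteq> 0})"
    have S: "finite S" using A T by (simp add: S_def)
    have sub: "{p. level_filter h (Suc L) p \<noteq> 0} \<subseteq> S"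
    proof
      fix p assume "p \<in> {p. level_filter h (Suc L) p \<noteq> 0}"
      then obtain n where n: "h n \<noteq> 0" "?u (p - 2 ^ L * n) \<noteq> 0"
        by (auto elim: sum.not_neutral_contains_not_neutral)
      then show "p \<in> S" unfolding S_def by (intro image_eqI[of _ _ "(n, p - 2 ^ L * n)"]) auto
    qed
    have inner: "(\<Sum>p\<in>S. ?u (p - 2 ^ L * n) * ?F p) = (\<Sum>m | ?u m \<noteq> 0. ?u m * \<phi> (2 ^ L * (2 * x - of_int n) - of_int m))"
      if n: "n \<in> ?A" for n
    proof -
      have "(\<Sum>p\<in>S. ?u (p - 2 ^ L * n) * ?F p) = (\<Sum>p\<in>(\<lambda>m. m + 2 ^ L * n) ` {m. ?u m \<noteq> 0}. ?u (p - 2 ^ L * n) * ?F p)"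
      proof (rule sum.mono_neutral_right[OF S])
        show "(\<lambda>m. m + 2 ^ L * n) ` {m. ?u m \<noteq> 0} \<subseteq> S" using n by (auto simp: S_def)
        show "\<forall>p\<in>S - (\<lambda>m. m + 2 ^ L * n) ` {m. ?u m \<noteq> 0}. ?u (p - 2 ^ L * n) * ?F p = 0"
        proof
          fix p assume p: "p \<in> S - (\<lambda>m. m + 2 ^ L * n) ` {m. ?u m \<noteq> 0}"
          have "?u (p - 2 ^ L * n) = 0"
          proof (rule ccontr)
            assume "?u (p - 2 ^ L * n) \<noteq> 0"
            then have "p \<in> (\<lambda>m. m + 2 ^ L * n) ` {m. ?u m \<noteq> 0}"
              by (intro image_eqI[of _ _ "p - 2 ^ L * n"]) auto
            with p show False by blast
          qed
          then show "?u (p - 2 ^ L * n) * ?F p = 0" by simp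
        qed
      qed
      also have "\<dots> = (\<Sum>m | ?u m \<noteq> 0. ?u m * \<phi> (2 ^ L * (2 * x - of_int n) - of_int m))"
        by (subst sum.reindex) (auto simp: inj_on_def algebra_simps)
      finally show ?thesis .
    qed
    have "(\<Sum>p | level_filter h (Suc L) p \<noteq> 0. level_filter h (Suc L) p * ?F p) = (\<Sum>p\<in>S. level_filter h (Suc L) p * ?F p)"
      by (rule sum.mono_neutral_left[OF S sub]) auto
    also have "\<dots> = (\<Sum>n\<in>?A. \<Sum>p\<in>S. h n * (?u (p - 2 ^ L * n) * ?F p))"
      by (subst sum.swap) (simp add: sum_distrib_right mult.assoc)
    also have "\<dots> = (\<Sum>n\<in>?A. h n * (\<Sum>m | ?u m \<noteq> 0. ?u m * \<phi> (2 ^ L * (2 * x - of_int n) - of_int m)))"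
      by (intro sum.cong refl) (simp only: sum_distrib_left[symmetric] inner)
    finally have eq: "(\<Sum>p | level_filter h (Suc L) p \<noteq> 0. level_filter h (Suc L) p * ?F p)
       = (\<Sum>n\<in>?A. h n * (\<Sum>m | ?u m \<noteq> 0. ?u m * \<phi> (2 ^ L * (2 * x - of_int n) - of_int m)))" .
    have "\<phi> x = of_real (sqrt 2) * (\<Sum>n\<in>?A. h n * \<phi> (2 * x - of_int n))" by (rule elim(1))
    also have "(\<Sum>n\<in>?A. h n * \<phi> (2 * x - of_int n)) = of_real (sqrt 2 ^ L) * (\<Sum>p | level_filter h (Suc L) p \<noteq> 0. level_filter h (Suc L) p * ?F p)"
      unfolding eq sum_distrib_left using elim(2) by (intro sum.cong refl) (simp add: sum_distrib_left mult_ac)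
    finally show ?case by (simp only: power_Suc of_real_mult mult.assoc)
  qed
qed


section \<open>Compact support of the scaling function\<close>

definition off_interval :: "real \<Rightarrow> real \<Rightarrow> real \<Rightarrow> real set" where
  "off_interval c d r = {..<c - r} \<union> {d + r<..}"

lemma off_interval_borel [measurable]: "off_interval c d r \<in> sets borel"
  by (simp add: off_interval_def)

lemma card_level_filter_support:
  assumes s: "supported_in a M h" and M: "M \<ge> 1"
  shows "real (card {m. level_filter h L m \<noteq> 0}) \<le> 2 ^ L * real M"
proof -
  have "{m. level_filter h L m \<noteq> 0} \<subseteq> {(2 ^ L - 1) * a..(2 ^ L - 1) * (a + int M - 1)}"
    using level_filter_support[OF s] by auto
  then have "card {m. level_filter h L m \<noteq> 0} \<le> card {(2 ^ L - 1) * a..(2 ^ L - 1) * (a + int M - 1)}"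
    by (rule card_mono[rotated]) simp
  moreover have "(2 ^ L - 1) * (a + int M - 1) - (2 ^ L - 1) * a + 1 \<le> 2 ^ L * int M"
  proof -
    have "(2 ^ L - 1) * (a + int M - 1) - (2 ^ L - 1) * a + 1 = 2 ^ L * int M - 2 ^ L - int M + 2"
      by (simp add: algebra_simps)
    moreover have "(1::int) \<le> 2 ^ L" by simp
    ultimately show ?thesis using M by linarith
  qed
  ultimately have "card {m. level_filter h L m \<noteq> 0} \<le> nat (2 ^ L * int M)"
    by (auto intro: order_trans nat_mono)
  then have "int (card {m. level_filter h L m \<noteq> 0}) \<le> 2 ^ L * int M" by (simp add: le_nat_iff)
  then have "real_of_int (int (card {m. level_filter h L m \<noteq> 0})) \<le> real_of_int (2 ^ L * int M)" by (simp only: of_int_le_iff)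
  then show ?thesis by simp
qed

text \<open>Cauchy-Schwarz for a vector of norm at most 1 on at most 2^L M points. The growth by
  \<open>sqrt (2 ^ L)\<close> is exactly offset by the factor \<open>sqrt 2 ^ L\<close> of the
  refinement equation and the \<open>1 / 2 ^ L\<close> from rescaling the integral.\<close>

lemma sum_level_filter_le:
  assumes q: "qmf h" and s: "supported_in a M h" and M: "M \<ge> 1"
  shows "(\<Sum>m | level_filter h L m \<noteq> 0. cmod (level_filter h L m)) \<le> sqrt (2 ^ L * real M)"
proof -
  let ?u = "level_filter h L"
  have T: "finite {m. ?u m \<noteq> 0}" using fins_level_filter[OF s] by (simp add: fins_def)
  have "(\<Sum>m | ?u m \<noteq> 0. cmod (?u m)) \<le> L2_set (\<lambda>m. cmod (?u m)) {m. ?u m \<noteq> 0} * L2_set (\<lambda>_. 1) {m. ?u m \<noteq> 0}"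
    using L2_set_mult_ineq[of "\<lambda>m. cmod (?u m)" "\<lambda>_. 1" "{m. ?u m \<noteq> 0}"] by simp
  also have "\<dots> \<le> 1 * sqrt (2 ^ L * real M)"
  proof (rule mult_mono)
    show "L2_set (\<lambda>m. cmod (?u m)) {m. ?u m \<noteq> 0} \<le> 1"
      using l2norm_level_filter[OF q s, of L] l2norm_eq_snorm[OF T order_refl] by (simp add: snorm_def)
    show "L2_set (\<lambda>_. 1) {m. ?u m \<noteq> 0} \<le> sqrt (2 ^ L * real M)"
      using card_level_filter_support[OF s M, of L] by (simp add: L2_set_def)
  qed (auto simp: L2_set_nonneg)
  finally show ?thesis by simp
qed

text \<open>
  The factor \<open>sqrt M\<close> does not depend on \<open>L\<close>, while the mass on the right vanishes as \<open>L\<close> grows; hence the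
  scaling function has compact support.
\<close>

lemma scaling_function_tail_le:
  assumes \<phi>: "scaling_function h \<phi>" and q: "qmf h" and s: "supported_in a M h" and M: "M \<ge> 1"
  defines "d \<equiv> real_of_int (a + int M - 1)"
  shows "(LINT x|lborel. indicator (off_interval a d 1) x * cmod (\<phi> x))
    \<le> sqrt (real M) * (LINT x|lborel. indicator (off_interval a d (2 ^ L)) x * cmod (\<phi> x))"
proof -
  let ?u = "level_filter h L"
  define T where "T = {m. ?u m \<noteq> 0}"
  have T: "finite T" using fins_level_filter[OF s] by (simp add: fins_def T_def)
  have h: "fins h" using q by (simp add: qmf_def)
  have int: "integrable lborel (\<lambda>x. cmod (\<phi> x))" using \<phi> by (auto simp: scaling_function_def)
  define G where "G r x = indicator (off_interval a d r) x * cmod (\<phi> x)" for r x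
  have intG: "integrable lborel (G r)" for r
    unfolding G_def[abs_def] using integrable_mult_indicator[OF _ int, of "off_interval a d r"] by simp
  have Gaff: "integrable lborel (\<lambda>x. G r (2 ^ L * x - real_of_int m))"
    "(LINT x|lborel. G r (2 ^ L * x - real_of_int m)) = (LINT x|lborel. G r x) / 2 ^ L" for r m
    using lborel_integrable_real_affine_iff[of "2 ^ L" "G r" "- real_of_int m"] intG[of r]
      lborel_integral_real_affine[of "2 ^ L" "G r" "- real_of_int m"] by simp_all
  have pw: "AE x in lborel. G 1 x \<le> sqrt 2 ^ L * (\<Sum>m\<in>T. cmod (?u m) * G (2 ^ L) (2 ^ L * x - real_of_int m))"
    using refinement_iterate[OF \<phi> s h, of L]
  proof eventually_elim
    case (elim x)
    show ?case
    proof (cases "x \<in> off_interval a d 1")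
      case False
      then show ?thesis by (simp add: G_def sum_nonneg)
    next
      case True
      have "cmod (?u m * \<phi> (2 ^ L * x - of_int m)) = cmod (?u m) * G (2 ^ L) (2 ^ L * x - real_of_int m)"
        if m: "m \<in> T" for m
      proof -
        have "(2 ^ L - 1) * a \<le> m" "m \<le> (2 ^ L - 1) * (a + int M - 1)"
          using level_filter_support[OF s, of L m] m by (auto simp: T_def)
        then have "real_of_int ((2 ^ L - 1) * a) \<le> real_of_int m" "real_of_int m \<le> real_of_int ((2 ^ L - 1) * (a + int M - 1))"
          unfolding of_int_le_iff by auto
        then have m2: "(2 ^ L - 1) * real_of_int a \<le> m" "m \<le> (2 ^ L - 1) * d" by (auto simp: d_def)
        \<comment> \<open>A distance of more than 1 from the interval with endpoints
          \<open>a\<close> and \<open>d\<close> is magnified to more than 2^L: for instance 2^L (a -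
          1) - (2^L - 1) a = a - 2^L.\<close>
        have "2 ^ L * x - of_int m \<in> off_interval a d (2 ^ L)"
        proof (cases "x < a - 1")
          case True
          then have "2 ^ L * x < 2 ^ L * (a - 1)" by simp
          then show ?thesis using m2(1) by (simp add: off_interval_def algebra_simps)
        next
          case False
          then have "x > d + 1" using \<open>x \<in> off_interval a d 1\<close> by (simp add: off_interval_def)
          then have "2 ^ L * x > 2 ^ L * (d + 1)" by simp
          then show ?thesis using m2(2) by (simp add: off_interval_def algebra_simps)
        qed
        then show ?thesis by (simp add: G_def norm_mult)
      qed
      then have "sqrt 2 ^ L * (\<Sum>m\<in>T. cmod (?u m) * G (2 ^ L) (2 ^ L * x - real_of_int m))
         = sqrt 2 ^ L * (\<Sum>m\<in>T. cmod (?u m * \<phi> (2 ^ L * x - of_int m)))" by simp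
      moreover have "cmod (\<phi> x) \<le> sqrt 2 ^ L * (\<Sum>m\<in>T. cmod (?u m * \<phi> (2 ^ L * x - of_int m)))"
        unfolding elim T_def[symmetric] norm_mult[of "of_real _"]
        by (intro mult_mono norm_sum) (auto simp: norm_power)
      ultimately show ?thesis using True by (simp add: G_def)
    qed
  qed
  have "(LINT x|lborel. G 1 x) \<le> (LINT x|lborel. sqrt 2 ^ L * (\<Sum>m\<in>T. cmod (?u m) * G (2 ^ L) (2 ^ L * x - real_of_int m)))"
    by (intro integral_mono_AE intG pw) (intro integrable_mult_right Bochner_Integration.integrable_sum Gaff)
  also have "\<dots> = sqrt 2 ^ L * (\<Sum>m\<in>T. cmod (?u m) * ((LINT x|lborel. G (2 ^ L) x) / 2 ^ L))"
    by (simp add: Bochner_Integration.integral_sum Gaff integrable_mult_right)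
  also have "\<dots> = (sqrt 2 ^ L / 2 ^ L * (\<Sum>m\<in>T. cmod (?u m))) * (LINT x|lborel. G (2 ^ L) x)"
    by (simp add: sum_distrib_right sum_distrib_left sum_divide_distrib mult_ac)
  also have "\<dots> \<le> sqrt (real M) * (LINT x|lborel. G (2 ^ L) x)"
  proof (rule mult_right_mono)
    have "sqrt 2 ^ L / 2 ^ L * (\<Sum>m\<in>T. cmod (?u m)) \<le> sqrt 2 ^ L / 2 ^ L * sqrt (2 ^ L * real M)"
      unfolding T_def by (intro mult_left_mono sum_level_filter_le[OF q s M]) simp_all
    also have "\<dots> = (sqrt (2 ^ L) * sqrt (2 ^ L)) * sqrt (real M) / 2 ^ L"
      by (simp only: real_sqrt_mult real_sqrt_power times_divide_eq_left mult.assoc)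
    also have "\<dots> = sqrt (real M)"
      by (subst real_sqrt_mult_self) simp
    finally show "sqrt 2 ^ L / 2 ^ L * (\<Sum>m\<in>T. cmod (?u m)) \<le> sqrt (real M)" .
  qed (simp add: G_def integral_nonneg_AE)
  finally show ?thesis by (simp add: G_def[abs_def])
qed

lemma scaling_function_compact_support:
  assumes \<phi>: "scaling_function h \<phi>" and q: "qmf h" and s: "supported_in a M h" and M: "M \<ge> 1"
  defines "d \<equiv> real_of_int (a + int M - 1)"
  shows "AE x in lborel. x \<in> off_interval a d 1 \<longrightarrow> \<phi> x = 0"
proof -
  have int: "integrable lborel (\<lambda>x. cmod (\<phi> x))" using \<phi> by (auto simp: scaling_function_def)
  have meas[measurable]: "\<phi> \<in> borel_measurable borel"
    using \<phi> by (auto simp: scaling_function_def dest: borel_measurable_integrable)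
  have "(\<lambda>L. LINT x|lborel. indicator (off_interval a d (2 ^ L)) x * cmod (\<phi> x)) \<longlonglongrightarrow> (LINT x::real|lborel. (0::real))"
  proof (rule integral_dominated_convergence[where w = "\<lambda>x. cmod (\<phi> x)" and f = "\<lambda>x. 0" and s = "\<lambda>L x. indicator (off_interval a d (2 ^ L)) x * cmod (\<phi> x)"])
    show "AE x in lborel. (\<lambda>L. indicator (off_interval a d (2 ^ L)) x * cmod (\<phi> x)) \<longlonglongrightarrow> 0"
    proof (rule AE_I2)
      fix x :: real
      have "eventually (\<lambda>L. (2::real) ^ L > \<bar>x\<bar> + \<bar>real_of_int a\<bar> + \<bar>d\<bar>) sequentially"
        using filterlim_realpow_sequentially_gt1[of "2::real"]
        by (auto simp: filterlim_at_infinity_imp_norm_at_top filterlim_at_top_dense dest!: filterlim_at_infinity_imp_norm_at_top)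
      then have "eventually (\<lambda>L. indicator (off_interval a d (2 ^ L)) x * cmod (\<phi> x) = 0) sequentially"
        by eventually_elim (auto simp: off_interval_def indicator_def)
      then show "(\<lambda>L. indicator (off_interval a d (2 ^ L)) x * cmod (\<phi> x)) \<longlonglongrightarrow> 0"
        by (rule tendsto_eventually)
    qed
  qed (use int in \<open>auto simp: indicator_def\<close>)
  then have "(\<lambda>L. sqrt (real M) * (LINT x|lborel. indicator (off_interval a d (2 ^ L)) x * cmod (\<phi> x))) \<longlonglongrightarrow> 0"
    by (intro tendsto_mult_right_zero) simp
  then have "(LINT x|lborel. indicator (off_interval a d 1) x * cmod (\<phi> x)) \<le> 0"
    by (rule LIMSEQ_le_const) (use scaling_function_tail_le[OF \<phi> q s M] in \<open>auto simp: d_def\<close>)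
  moreover have "(LINT x|lborel. indicator (off_interval a d 1) x * cmod (\<phi> x)) \<ge> 0"
    by (intro integral_nonneg_AE) simp
  ultimately have "(LINT x|lborel. indicator (off_interval a d 1) x * cmod (\<phi> x)) = 0" by simp
  then have "AE x in lborel. indicator (off_interval a d 1) x * cmod (\<phi> x) = 0"
    using integrable_mult_indicator[OF _ int, of "off_interval a d 1"]
    by (subst (asm) integral_nonneg_eq_0_iff_AE) auto
  then show ?thesis by eventually_elim auto
qed

text \<open>Orthonormality with both translates 0 gives unit L2 norm, and the support lies in an
  interval of length \<open>M + 1\<close>. Cauchy-Schwarz is again done pointwise by a weighted mean
  inequality; \<open>t = sqrt (real M + 1)\<close> is the optimal weight.\<close>

lemma scaling_function_L1:
  assumes \<phi>: "scaling_function h \<phi>" and on: "orthonormal_translates \<phi>"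
    and q: "qmf h" and s: "supported_in a M h" and M: "M \<ge> 1"
  shows "(LINT x|lborel. cmod (\<phi> x)) \<le> sqrt (real M + 1)"
proof -
  define d where "d = real_of_int (a + int M - 1)"
  define t where "t = sqrt (real M + 1)"
  have t: "t > 0" "t * t = real M + 1" by (auto simp: t_def)
  have int: "integrable lborel (\<lambda>x. cmod (\<phi> x))" using \<phi> by (auto simp: scaling_function_def)
  have sq: "integrable lborel (\<lambda>x. complex_of_real ((cmod (\<phi> x))\<^sup>2))" "(LINT x|lborel. complex_of_real ((cmod (\<phi> x))\<^sup>2)) = 1"
    using on[unfolded orthonormal_translates_def, rule_format, of 0 0] unfolding complex_norm_square by simp_all
  have sqi: "integrable lborel (\<lambda>x. (cmod (\<phi> x))\<^sup>2)" using integrable_Re[OF sq(1)] by (simp only: Re_complex_of_real)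
  have sq1: "(LINT x|lborel. (cmod (\<phi> x))\<^sup>2) = 1" using sq(2) unfolding integral_complex_of_real by (simp only: of_real_eq_1_iff)
  have ad: "real_of_int a - 1 \<le> d + 1" "d + 1 - (real_of_int a - 1) = real M + 1" using M by (auto simp: d_def)
  let ?I = "{real_of_int a - 1..d + 1}"
  have I: "integrable lborel (indicat_real ?I)" "(LINT x|lborel. indicat_real ?I x) = real M + 1"
    using ad by (auto simp: integrable_indicator_iff)
  have pw: "AE x in lborel. cmod (\<phi> x) \<le> (t * (cmod (\<phi> x))\<^sup>2 + indicat_real ?I x / t) / 2"
    using scaling_function_compact_support[OF \<phi> q s M]
  proof eventually_elim
    case (elim x)
    show ?case
    proof (cases "x \<in> ?I")
      case True
      have "0 \<le> (t * cmod (\<phi> x) - 1)\<^sup>2 / t" using t by simp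
      also have "\<dots> = t * (cmod (\<phi> x))\<^sup>2 + 1 / t - 2 * cmod (\<phi> x)" using t by (simp add: power2_eq_square field_simps)
      finally show ?thesis using True by simp
    next
      case False
      then have "\<phi> x = 0" using elim by (auto simp: off_interval_def d_def)
      then show ?thesis using t by simp
    qed
  qed
  have "(LINT x|lborel. cmod (\<phi> x)) \<le> (LINT x|lborel. (t * (cmod (\<phi> x))\<^sup>2 + indicat_real ?I x / t) / 2)"
    using int sqi I(1) by (intro integral_mono_AE pw) auto
  also have "\<dots> = (t * 1 + (real M + 1) / t) / 2"
    using sqi I by (simp add: sq1)
  also have "\<dots> = t" unfolding t(2)[symmetric] using t(1) by simp
  finally show ?thesis by (simp add: t_def)
qed

text \<open>Pairing the iterated refinement equation with the translate by \<open>j\<close> isolates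
  entry \<open>j\<close>, by orthonormality, with the factor \<open>sqrt 2 ^ L\<close>. Stretching
  leaves the bound \<open>B\<close> on \<psi> untouched, and the L1 norm of the translate does not
  depend on \<open>L\<close>.\<close>

lemma level_filter_le:
  assumes \<phi>: "scaling_function h \<phi>" and on: "orthonormal_translates \<phi>"
    and q: "qmf h" and s: "supported_in a M h" and M: "M \<ge> 1"
    and B: "AE x in lborel. cmod (\<phi> x) \<le> B" "B \<ge> 0"
  shows "cmod (level_filter h L j) \<le> B * sqrt (real M + 1) / sqrt 2 ^ L"
proof -
  let ?u = "level_filter h L"
  define T where "T = {m. ?u m \<noteq> 0}"
  have T: "finite T" using fins_level_filter[OF s] by (simp add: fins_def T_def)
  have h: "fins h" using q by (simp add: qmf_def)
  have int: "integrable lborel (\<lambda>x. cmod (\<phi> x))" using \<phi> by (auto simp: scaling_function_def)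
  have meas[measurable]: "\<phi> \<in> borel_measurable borel"
    using \<phi> by (auto simp: scaling_function_def dest: borel_measurable_integrable)
  define \<psi> where "\<psi> x = \<phi> (x / 2 ^ L)" for x
  have meas\<psi>[measurable]: "\<psi> \<in> borel_measurable borel" unfolding \<psi>_def by measurable
  have ref: "AE x in lborel. \<psi> x = of_real (sqrt 2 ^ L) * (\<Sum>m\<in>T. ?u m * \<phi> (x - of_int m))"
  proof -
    let ?P = "\<lambda>y. \<phi> y = of_real (sqrt 2 ^ L) * (\<Sum>m\<in>T. ?u m * \<phi> (2 ^ L * y - of_int m))"
    have "AE x in lborel. ?P (0 + 1 / 2 ^ L * x)"
      using refinement_iterate[OF \<phi> s h, of L] by (intro AE_borel_affine) (simp_all add: T_def[symmetric])
    then show ?thesis by (simp add: \<psi>_def)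
  qed
  have bd: "AE x in lborel. cmod (\<psi> x) \<le> B"
  proof -
    have "AE x in lborel. cmod (\<phi> (0 + 1 / 2 ^ L * x)) \<le> B"
      using B(1) by (intro AE_borel_affine) simp_all
    then show ?thesis by (simp add: \<psi>_def)
  qed
  have meas_cnj[measurable]: "(\<lambda>x. cnj (\<phi> (x - of_int j))) \<in> borel_measurable borel"
    by (rule borel_measurable_continuous_on[where f = cnj]) (auto intro!: continuous_intros)
  have shift: "integrable lborel (\<lambda>x. cmod (\<phi> (x - of_int j)))" "(LINT x|lborel. cmod (\<phi> (x - of_int j))) = (LINT x|lborel. cmod (\<phi> x))"
    using lborel_integrable_real_affine_iff[of 1 "\<lambda>x. cmod (\<phi> x)" "- real_of_int j"] int
      lborel_integral_real_affine[of 1 "\<lambda>x. cmod (\<phi> x)" "- real_of_int j"] by simp_all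
  have onj: "integrable lborel (\<lambda>x. \<phi> (x - of_int m) * cnj (\<phi> (x - of_int j)))"
    "(LINT x|lborel. \<phi> (x - of_int m) * cnj (\<phi> (x - of_int j))) = (if m = j then 1 else 0)" for m
    using on by (auto simp: orthonormal_translates_def)
  have "(LINT x|lborel. \<psi> x * cnj (\<phi> (x - of_int j)))
      = (LINT x|lborel. of_real (sqrt 2 ^ L) * (\<Sum>m\<in>T. ?u m * (\<phi> (x - of_int m) * cnj (\<phi> (x - of_int j)))))"
  proof (rule integral_cong_AE)
    show "AE x in lborel. \<psi> x * cnj (\<phi> (x - of_int j)) = of_real (sqrt 2 ^ L) * (\<Sum>m\<in>T. ?u m * (\<phi> (x - of_int m) * cnj (\<phi> (x - of_int j))))"
      using ref by eventually_elim (simp add: sum_distrib_right sum_distrib_left mult.assoc)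
    show "(\<lambda>x. \<psi> x * cnj (\<phi> (x - of_int j))) \<in> borel_measurable lborel" by measurable
    show "(\<lambda>x. of_real (sqrt 2 ^ L) * (\<Sum>m\<in>T. ?u m * (\<phi> (x - of_int m) * cnj (\<phi> (x - of_int j))))) \<in> borel_measurable lborel"
      by (intro borel_measurable_integrable integrable_mult_right Bochner_Integration.integrable_sum onj)
  qed
  also have "\<dots> = of_real (sqrt 2 ^ L) * (\<Sum>m\<in>T. ?u m * (if m = j then 1 else 0))"
    by (simp add: Bochner_Integration.integral_sum onj integrable_mult_right)
  also have "(\<Sum>m\<in>T. ?u m * (if m = j then 1 else 0)) = (\<Sum>m\<in>T. if m = j then ?u m else 0)"
    by (intro sum.cong) auto
  also have "\<dots> = ?u j" using T by (auto simp: T_def)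
  finally have "sqrt 2 ^ L * cmod (?u j) = cmod (LINT x|lborel. \<psi> x * cnj (\<phi> (x - of_int j)))"
    by (simp add: norm_mult norm_power)
  also have "\<dots> \<le> (LINT x|lborel. cmod (\<psi> x * cnj (\<phi> (x - of_int j))))"
    by (rule integral_norm_bound)
  also have "\<dots> \<le> (LINT x|lborel. B * cmod (\<phi> (x - of_int j)))"
  proof (rule integral_mono_AE)
    show i: "integrable lborel (\<lambda>x. B * cmod (\<phi> (x - of_int j)))" using shift(1) by simp
    show le: "AE x in lborel. cmod (\<psi> x * cnj (\<phi> (x - of_int j))) \<le> B * cmod (\<phi> (x - of_int j))"
      using bd by eventually_elim (simp add: norm_mult mult_right_mono)
    show "integrable lborel (\<lambda>x. cmod (\<psi> x * cnj (\<phi> (x - of_int j))))"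
      by (rule Bochner_Integration.integrable_bound[OF i]) (measurable, use le B in \<open>auto simp: norm_mult\<close>)
  qed
  also have "\<dots> \<le> B * sqrt (real M + 1)"
    using scaling_function_L1[OF \<phi> on q s M] B(2) shift by (simp add: mult_left_mono)
  finally show ?thesis by (simp add: field_simps)
qed

section \<open>Norm of the coarse component\<close>

lemma card_dyadic_le:
  fixes p :: int
  assumes "finite N" "\<And>n. n \<in> N \<Longrightarrow> p \<le> 2 ^ L * n \<and> 2 ^ L * n \<le> p + (2 ^ L - 1) * (int M - 1)" "M \<ge> 1"
  shows "card N \<le> M"
proof -
  \<comment> \<open>The ceiling of p / 2^L, hence the smallest admissible \<open>n\<close>; the
    window is short enough that \<open>n\<close> exceeds \<open>r\<close> by at most
    \<open>M - 1\<close>.\<close>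
  define r where "r = - ((- p) div 2 ^ L)"
  have pr: "p \<le> 2 ^ L * r" 
  proof -
    have "(- p) div 2 ^ L * 2 ^ L + (- p) mod 2 ^ L = - p" by (rule div_mult_mod_eq)
    moreover have "(- p) mod 2 ^ L \<ge> 0" by simp
    ultimately have "(- p) div 2 ^ L * 2 ^ L \<le> - p" by linarith
    then show ?thesis by (simp add: r_def mult.commute)
  qed
  have "N \<subseteq> {r..r + int M - 1}"
  proof
    fix n assume "n \<in> N"
    with assms(2) have n: "p \<le> 2 ^ L * n" "2 ^ L * n \<le> p + (2 ^ L - 1) * (int M - 1)" by auto
    have "r \<le> n"
    proof -
      have "(- n) * 2 ^ L \<le> - p" using n(1) by (simp add: mult.commute)
      then have "(- n) * 2 ^ L div 2 ^ L \<le> (- p) div 2 ^ L" by (rule zdiv_mono1) simp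
      moreover have "(- n) * 2 ^ L div 2 ^ L = - n" by (rule nonzero_mult_div_cancel_right) simp
      ultimately have "- n \<le> (- p) div 2 ^ L" by simp
      then show ?thesis by (simp add: r_def)
    qed
    moreover have "n \<le> r + int M - 1"
    proof -
      have "2 ^ L * n \<le> 2 ^ L * r + 2 ^ L * (int M - 1)"
        using n(2) pr assms(3) by (simp add: algebra_simps)
      then have "2 ^ L * n \<le> 2 ^ L * (r + int M - 1)" by (simp add: algebra_simps)
      then show ?thesis by simp
    qed
    ultimately show "n \<in> {r..r + int M - 1}" by simp
  qed
  then have "card N \<le> card {r..r + int M - 1}" by (rule card_mono[rotated]) simp
  then show ?thesis by simp
qed

text \<open>A Hilbert-Schmidt estimate for the analysis matrix restricted to the support of
  \<open>x\<close>: it has at most \<open>D\<close> columns, each meeting at most \<open>M\<close>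
  shifts of the iterated filter, with entries of order \<open>1 / sqrt 2 ^ L\<close>.\<close>

lemma scaling_decay:
  assumes \<phi>: "scaling_function h \<phi>" and on: "orthonormal_translates \<phi>"
    and q: "qmf h" and s: "supported_in a M h" and M: "M \<ge> 1"
    and B: "AE x in lborel. cmod (\<phi> x) \<le> B" "B \<ge> 0"
    and x: "fins x" "card {n. x n \<noteq> 0} \<le> D"
  shows "l2norm ((msup_adj (ft h) ^^ L) x) \<le> sqrt (real D) * B * (sqrt 2 * real M) / sqrt 2 ^ L * l2norm x"
proof -
  let ?u = "level_filter h L" and ?y = "(msup_adj (ft h) ^^ L) x"
  define X where "X = {m. x m \<noteq> 0}"
  have X: "finite X" using x by (simp add: X_def fins_def)
  define U where "U = B * sqrt (real M + 1) / sqrt 2 ^ L"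
  have U0: "U \<ge> 0" using B by (simp add: U_def)
  have U: "cmod (?u j) \<le> U" for j unfolding U_def by (rule level_filter_le[OF \<phi> on q s M B])
  define N where "N = {n. ?y n \<noteq> 0}"
  have N: "finite N" using fins_qmf(5)[OF q x(1)] by (simp add: N_def fins_def)
  have xn: "(\<Sum>m\<in>X. (cmod (x m))\<^sup>2) = (l2norm x)\<^sup>2"
    using l2norm_eq_snorm[OF X, of x] by (simp add: X_def snorm_def L2_set_def sum_nonneg)
  have row: "(cmod (?y n))\<^sup>2 \<le> (\<Sum>m\<in>X. (cmod (?u (m - 2 ^ L * n)))\<^sup>2) * (l2norm x)\<^sup>2" for n
  proof -
    have "?y n = sip X (\<lambda>m. ?u (m - 2 ^ L * n)) x"
      using msup_adj_funpow_eq_sum[OF q x(1), of L n] by (simp add: sip_def X_def)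
    then have "cmod (?y n) \<le> snorm X (\<lambda>m. ?u (m - 2 ^ L * n)) * snorm X x"
      using sip_cauchy_schwarz[of X "\<lambda>m. ?u (m - 2 ^ L * n)" x] by simp
    then have "(cmod (?y n))\<^sup>2 \<le> (snorm X (\<lambda>m. ?u (m - 2 ^ L * n)) * snorm X x)\<^sup>2"
      by (intro power_mono) auto
    also have "\<dots> = (\<Sum>m\<in>X. (cmod (?u (m - 2 ^ L * n)))\<^sup>2) * (l2norm x)\<^sup>2"
      unfolding xn[symmetric] by (simp add: power_mult_distrib snorm_def L2_set_def sum_nonneg)
    finally show ?thesis .
  qed
  have col: "(\<Sum>n\<in>N. (cmod (?u (m - 2 ^ L * n)))\<^sup>2) \<le> real M * U\<^sup>2" for m
  proof -
    define N' where "N' = {n\<in>N. ?u (m - 2 ^ L * n) \<noteq> 0}"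
    have N': "finite N'" using N by (simp add: N'_def)
    have "card N' \<le> M"
    proof (rule card_dyadic_le[OF N' _ M])
      fix n assume "n \<in> N'"
      then have "?u (m - 2 ^ L * n) \<noteq> 0" by (simp add: N'_def)
      from level_filter_support[OF s this]
      show "m - (2 ^ L - 1) * (a + int M - 1) \<le> 2 ^ L * n \<and> 2 ^ L * n \<le> m - (2 ^ L - 1) * (a + int M - 1) + (2 ^ L - 1) * (int M - 1)"
        by (simp add: algebra_simps)
    qed
    have "(\<Sum>n\<in>N. (cmod (?u (m - 2 ^ L * n)))\<^sup>2) = (\<Sum>n\<in>N'. (cmod (?u (m - 2 ^ L * n)))\<^sup>2)"
      unfolding N'_def using N by (intro sum.mono_neutral_right) auto
    also have "\<dots> \<le> (\<Sum>n\<in>N'. U\<^sup>2)" by (intro sum_mono power_mono U) auto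
    also have "\<dots> = real (card N') * U\<^sup>2" by simp
    also have "\<dots> \<le> real M * U\<^sup>2" using \<open>card N' \<le> M\<close> by (intro mult_right_mono) auto
    finally show ?thesis .
  qed
  have "(l2norm ?y)\<^sup>2 = (\<Sum>n\<in>N. (cmod (?y n))\<^sup>2)"
    using l2norm_eq_snorm[OF N, of ?y] by (simp add: N_def snorm_def L2_set_def sum_nonneg)
  also have "\<dots> \<le> (\<Sum>n\<in>N. (\<Sum>m\<in>X. (cmod (?u (m - 2 ^ L * n)))\<^sup>2) * (l2norm x)\<^sup>2)"
    by (intro sum_mono row)
  also have "\<dots> = (\<Sum>m\<in>X. \<Sum>n\<in>N. (cmod (?u (m - 2 ^ L * n)))\<^sup>2) * (l2norm x)\<^sup>2"
    unfolding sum_distrib_right[symmetric] by (subst sum.swap) rule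
  also have "\<dots> \<le> (\<Sum>m\<in>X. real M * U\<^sup>2) * (l2norm x)\<^sup>2"
    by (intro mult_right_mono sum_mono col) auto
  also have "\<dots> \<le> (real D * (real M * U\<^sup>2)) * (l2norm x)\<^sup>2"
    using x(2) by (intro mult_right_mono) (auto simp: X_def intro!: mult_right_mono)
  also have "real D * (real M * U\<^sup>2) = (real M * (real M + 1)) * (sqrt (real D) * B / sqrt 2 ^ L)\<^sup>2"
    by (simp add: U_def power_mult_distrib power_divide)
  also have "(real M * (real M + 1)) * (sqrt (real D) * B / sqrt 2 ^ L)\<^sup>2 * (l2norm x)\<^sup>2
     \<le> (sqrt 2 * real M)\<^sup>2 * (sqrt (real D) * B / sqrt 2 ^ L)\<^sup>2 * (l2norm x)\<^sup>2"
  proof (intro mult_right_mono)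
    \<comment> \<open>The source of the factor \<open>sqrt 2\<close> in the decay constant, and thus
      in \<open>C\<close>; it relies on \<open>M \<ge> 1\<close>.\<close>
    have "real M * (real M + 1) \<le> real M * (2 * real M)" using M by (intro mult_left_mono) auto
    then show "real M * (real M + 1) \<le> (sqrt 2 * real M)\<^sup>2"
      by (simp add: power_mult_distrib) (simp add: power2_eq_square)
  qed auto
  also have "\<dots> = (sqrt (real D) * B * (sqrt 2 * real M) / sqrt 2 ^ L * l2norm x)\<^sup>2"
    by (simp add: power_mult_distrib power_divide)
  finally show ?thesis
    by (rule power2_le_imp_le) (use B in \<open>auto\<close>)
qed

section \<open>The correlation functions\<close>


lemma scaling_filterD:
  assumes "scaling_filter M h"
  shows "qmf h" "M \<ge> 1" "\<exists>a. supported_in a M h" "\<exists>\<phi>. scaling_function h \<phi> \<and> orthonormal_translates \<phi>"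
proof -
  obtain a where s: "supported_in a M h" using assms by (auto simp: scaling_filter_def supported_in_def)
  then show "\<exists>a. supported_in a M h" by blast
  have "{n. h n \<noteq> 0} \<subseteq> {a..<a + int M}" using s by (auto simp: supported_in_def)
  then have "fins h" unfolding fins_def by (rule finite_subset) simp
  then show "qmf h" using assms by (auto simp: scaling_filter_def qmf_def)
  show "\<exists>\<phi>. scaling_function h \<phi> \<and> orthonormal_translates \<phi>" using assms by (auto simp: scaling_filter_def)
  have "ft h 0 \<noteq> 0" using assms by (auto simp: scaling_filter_def)
  then have "h \<noteq> (\<lambda>_. 0)" by (auto simp: ft_def)
  then obtain n where "h n \<noteq> 0" by auto
  then show "M \<ge> 1" using s by (cases M) (auto simp: supported_in_def)
qed

lemma Dsize_support:
  assumes "Dsize f N = enat d" "j \<in> {1..2 * N}"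
  shows "fins (f j)" "card {n. f j n \<noteq> 0} \<le> d"
proof -
  have "(\<Sum>i\<in>{1..2 * N}. (if i = j then 1 else 0) * f i x) = f j x" for x
  proof -
    have "(\<Sum>i\<in>{1..2 * N}. (if i = j then 1 else 0) * f i x) = (\<Sum>i\<in>{1..2 * N}. if i = j then f i x else 0)"
      by (intro sum.cong) auto
    then show ?thesis using assms(2) by simp
  qed
  then have "supp_size (f j) \<le> Dsize f N"
    unfolding Dsize_def by (intro SUP_upper2[of "\<lambda>i. if i = j then 1 else 0"]) auto
  then have "supp_size (f j) \<le> enat d" using assms(1) by simp
  then show "fins (f j)" "card {n. f j n \<noteq> 0} \<le> d"
    by (auto simp: supp_size_def fins_def split: if_splits)
qed

lemma card_v_adj_support:
  assumes "fins f"
  shows "card {n. fst (v_adj f) n \<noteq> 0} \<le> card {n. f n \<noteq> 0}" "card {n. snd (v_adj f) n \<noteq> 0} \<le> card {n. f n \<noteq> 0}"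
proof -
  have F: "finite {n. f n \<noteq> 0}" using assms by (simp add: fins_def)
  show "card {n. fst (v_adj f) n \<noteq> 0} \<le> card {n. f n \<noteq> 0}"
    by (rule card_inj_on_le[of "\<lambda>n. 2 * n", OF _ _ F]) (auto simp: v_adj_def inj_on_def)
  show "card {n. snd (v_adj f) n \<noteq> 0} \<le> card {n. f n \<noteq> 0}"
    by (rule card_inj_on_le[of "\<lambda>n. 2 * n + 1", OF _ _ F]) (auto simp: v_adj_def inj_on_def)
qed

text \<open>The test vector is \<open>z\<close> itself cut down to \<open>S\<close>. This turns the
  form estimates into norm estimates for vectors of possibly infinite support.\<close>

lemma snorm_le_of_form_bound:
  assumes S: "finite S" and bd: "\<And>y. fins y \<Longrightarrow> cmod (l2inner y z) \<le> c * l2norm y" and c: "c \<ge> 0"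
  shows "snorm S z \<le> c"
proof -
  define y where "y = (\<lambda>n. if n \<in> S then z n else 0)"
  have sub: "{n. y n \<noteq> 0} \<subseteq> S" by (auto simp: y_def)
  have "fins y" unfolding fins_def by (rule finite_subset[OF sub S])
  have "snorm S y = snorm S z" unfolding snorm_def by (rule L2_set_cong) (auto simp: y_def)
  then have n: "l2norm y = snorm S z" using l2norm_eq_snorm[OF S sub] by simp
  have "l2inner y z = sip S y z" using l2inner_eq_sip[OF S disjI1[OF sub]] .
  also have "\<dots> = sip S z z" unfolding sip_def by (rule sum.cong) (auto simp: y_def)
  finally have "l2inner y z = of_real ((snorm S z)\<^sup>2)" by (simp only: sip_self)
  with bd[OF \<open>fins y\<close>] have "(snorm S z)\<^sup>2 \<le> c * snorm S z" unfolding n by (simp add: norm_power)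
  then show ?thesis
    using c snorm_nonneg[of S z] by (cases "snorm S z = 0") (auto simp: power2_eq_square less_le)
qed

lemma corr_eq_det:
  assumes S: "finite S" and sub: "\<And>i. i \<in> {1..2 * N} \<Longrightarrow> {n. f i n \<noteq> 0} \<subseteq> S"
  shows "corr \<psi> f N = Determinant.det (cross_gram S N (\<lambda>i. f (i + 1)) (\<lambda>j. \<psi> (f (2 * N - j))))"
proof -
  have "l2inner (f (i + 1)) z = sip S (f (i + 1)) z" if "i < N" for i z
    using l2inner_eq_sip[OF S disjI1[OF sub[of "i + 1"]]] that by auto
  then show ?thesis
    unfolding corr_def cross_gram_def by (intro arg_cong[where f = Determinant.det] eq_matI) auto
qed

lemma sqrt_2_power_eq_powr: "1 / sqrt 2 ^ L = 2 powr (- real L / 2)"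
proof -
  have "2 powr (real L / 2) = (2 powr (1 / 2)) powr real L" by (simp add: powr_powr)
  also have "\<dots> = sqrt 2 ^ L" by (simp add: powr_half_sqrt powr_realpow)
  finally show ?thesis by (simp add: powr_minus_divide)
qed

text \<open>The stopping level balances \<epsilon> per level against the decaying remainder. If
  \<open>L\<close> is small all levels are compared, and the remainder terms sum to three halves of
  \<open>C * 2 powr (- real L / 2)\<close>. Otherwise the stop is at \<open>k\<close>, where the
  remainder is at most \<epsilon>.\<close>

lemma level_choice:
  fixes C \<epsilon> :: real
  assumes C: "C \<ge> 2 powr (3 / 2)" and \<epsilon>: "0 < \<epsilon>" "\<epsilon> < 1"
  obtains m where "m \<le> L"
    "C / 2 * 2 powr (- real L / 2) + 2 * \<epsilon> * real m + 2 * (C / 2 * 2 powr (- real m / 2))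
      \<le> 2 * (C * 2 powr (- real L / 2) + 6 * \<epsilon> * (log 2 (C / \<epsilon>))\<^sup>2)"
proof -
  define x where "x = log 2 (C / \<epsilon>)"
  have "(0::real) < 2 powr (3 / 2)" by simp
  then have C0: "C > 0" using C by linarith
  have "C * \<epsilon> \<le> C * 1" using C0 \<epsilon> by (intro mult_left_mono) auto
  then have "2 powr (3 / 2) \<le> C / \<epsilon>"
  proof -
    have "C \<le> C / \<epsilon>" using \<open>C * \<epsilon> \<le> C * 1\<close> \<epsilon> by (simp only: pos_le_divide_eq mult_1_right)
    then show ?thesis using C by linarith
  qed
  then have "log 2 (2 powr (3 / 2)) \<le> x" unfolding x_def by (subst log_le_cancel_iff) (use C0 \<epsilon> in auto)
  then have x: "x \<ge> 3 / 2" by simp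
  \<comment> \<open>The product expands to 6 x^2 - 4 x - 15/2. The bound
    \<open>x \<ge> 3 / 2\<close> is where the lower bound on \<open>C\<close> is used, and the
    linear cost then fits under the term with constant 6.\<close>
  have "(x - 3 / 2) * (6 * x + 5) \<ge> 0" using x by simp
  then have quad: "4 * x + 3 \<le> 6 * x\<^sup>2" by (simp add: power2_eq_square algebra_simps)
  \<comment> \<open>The least level with
    \<open>2 powr (- real k / 2) \<le> \<epsilon> / C\<close>.\<close>
  define k where "k = nat \<lceil>2 * x\<rceil>"
  have k: "real k \<le> 2 * x + 1" "2 * x \<le> real k" using x by (auto simp: k_def)
  have p: "C * 2 powr (- real L / 2) \<ge> 0" using C0 by simp
  show ?thesis
  proof (cases "L \<le> k")
    case True
    have "2 * \<epsilon> * real L \<le> \<epsilon> * (4 * x + 3)"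
      using k True \<epsilon> by (simp add: mult_left_mono)
    also have "\<dots> \<le> \<epsilon> * (6 * x\<^sup>2)" using quad \<epsilon> by (intro mult_left_mono) auto
    finally have "2 * \<epsilon> * real L \<le> 6 * \<epsilon> * x\<^sup>2" by simp
    moreover have "6 * \<epsilon> * x\<^sup>2 \<ge> 0" using \<epsilon> by simp
    ultimately show ?thesis using p by (intro that[of L]) (simp_all add: x_def[symmetric])
  next
    case False
    have "2 powr (- real k / 2) \<le> 2 powr (- x)" using k by simp
    also have "\<dots> = \<epsilon> / C" using C0 \<epsilon> by (simp add: powr_minus x_def)
    finally have "C * 2 powr (- real k / 2) \<le> \<epsilon>" using C0 by (simp add: field_simps)
    moreover have "\<epsilon> * (2 * real k + 1) \<le> \<epsilon> * (4 * x + 3)"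
      using k \<epsilon> by (intro mult_left_mono) auto
    moreover have "\<epsilon> * (4 * x + 3) \<le> \<epsilon> * (6 * x\<^sup>2)" using quad \<epsilon> by (intro mult_left_mono) auto
    moreover have "6 * \<epsilon> * x\<^sup>2 \<ge> 0" using \<epsilon> by simp
    moreover have "\<epsilon> * (2 * real k + 1) = 2 * \<epsilon> * real k + \<epsilon>" "\<epsilon> * (6 * x\<^sup>2) = 6 * \<epsilon> * x\<^sup>2"
      by (simp_all add: distrib_left)
    ultimately show ?thesis using p False by (intro that[of k]) (simp_all add: x_def[symmetric])
  qed
qed

lemma le_sqrt_of_min_le:
  fixes t n \<delta> :: real
  assumes "t \<le> 2" "t \<le> n * (2 * \<delta>)" "n \<ge> 0" "\<delta> \<ge> 0"
  shows "t \<le> 24 * sqrt n * sqrt \<delta>"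
proof -
  define r where "r = sqrt (n * \<delta>)"
  have r: "r \<ge> 0" "r * r = n * \<delta>" using assms by (simp_all add: r_def)
  have "t \<le> 2 * r"
  proof (cases "r \<le> 1")
    case True
    have "r * r \<le> r * 1" using True r(1) by (intro mult_left_mono)
    then show ?thesis using assms(2) r(2) by simp
  next
    case False
    then show ?thesis using assms(1) by simp
  qed
  then have "t \<le> 24 * r" using r by simp
  then show ?thesis by (simp add: r_def real_sqrt_mult)
qed

theorem theorem1:
  fixes hs gs :: "int \<Rightarrow> complex" and M N L :: nat and B \<epsilon> :: real
    and f :: "nat \<Rightarrow> int \<Rightarrow> complex"
  assumes "scaling_filter M hs" and "scaling_filter M gs"
    and "B \<ge> 1"
    and "\<forall>\<phi>. scaling_function hs \<phi> \<longrightarrow> (AE x in lborel. cmod (\<phi> x) \<le> B)"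
    and "\<forall>\<phi>. scaling_function gs \<phi> \<longrightarrow> (AE x in lborel. cmod (\<phi> x) \<le> B)"
    and "0 < \<epsilon>" and "\<epsilon> < 1"
    and "\<forall>k\<in>{-pi<..<pi}. cmod (ft hs k - exp (\<i> * of_real (k / 2)) * ft gs k) \<le> \<epsilon>"
    and "L \<ge> 1" and "N \<ge> 1"
    and "\<forall>i\<in>{1..2 * N}. (\<lambda>n. (cmod (f i n))\<^sup>2) summable_on UNIV \<and> l2norm (f i) \<le> 1"
    and "Dsize f N \<noteq> \<infinity>"
  shows "let C = 2 powr (3 / 2) * sqrt (real (the_enat (Dsize f N))) * B * real M in
         cmod (corr omega f N - corr (omega_MERA hs gs L) f N)
           \<le> 24 * sqrt (real N) * sqrt (C * 2 powr (- real L / 2) + 6 * \<epsilon> * (log 2 (C / \<epsilon>))\<^sup>2)"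
proof -
  obtain d where d: "Dsize f N = enat d" using assms(12) by auto
  define C where "C = 2 powr (3 / 2) * sqrt (real d) * B * real M"
  define \<delta> where "\<delta> = C * 2 powr (- real L / 2) + 6 * \<epsilon> * (log 2 (C / \<epsilon>))\<^sup>2"
  note H = scaling_filterD[OF assms(1)] and G = scaling_filterD[OF assms(2)]
  have C0: "C \<ge> 0" using assms(3) by (simp add: C_def)
  then have \<delta>0: "\<delta> \<ge> 0" using assms(6) by (simp add: \<delta>_def)
  define S where "S = (\<Union>i\<in>{1..2 * N}. {n. f i n \<noteq> 0})"
  note fin = Dsize_support[OF d]
  have S: "finite S" using fin(1) by (simp add: S_def fins_def)
  have sub: "{n. f i n \<noteq> 0} \<subseteq> S" if "i \<in> {1..2 * N}" for i using that by (auto simp: S_def)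
  have norm: "l2norm (f i) \<le> 1" if "i \<in> {1..2 * N}" for i using assms(11) that by blast
  have ix: "i + 1 \<in> {1..2 * N}" "2 * N - i \<in> {1..2 * N}" if "i < N" for i using that by auto
  have close: "half_shift_close \<epsilon> hs gs" using assms(6,8) by (simp add: half_shift_close_def)
  have "cmod (corr omega f N - corr (omega_MERA hs gs L) f N) \<le> 24 * sqrt (real N) * sqrt \<delta>"
  proof (cases "d = 0")
    \<comment> \<open>Here \<open>C = 0\<close>, so \<open>level_choice\<close> does not apply; but
      all \<open>f i\<close> vanish and the two matrices coincide.\<close>
    case True
    then have "f i = (\<lambda>_. 0)" if "i \<in> {1..2 * N}" for i
      using fin[OF that] by (auto simp: fins_def fun_eq_iff)
    then have "l2inner (f (i + 1)) z = 0" if "i < N" for i z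
      using ix(1)[OF that] by (simp add: l2inner_def)
    then have "corr omega f N = corr (omega_MERA hs gs L) f N"
      unfolding corr_def by (intro arg_cong[where f = Determinant.det] eq_matI) auto
    then show ?thesis using \<delta>0 by simp
  next
    case False
    have "1 * 1 \<le> sqrt (real d) * B" using False assms(3) by (intro mult_mono) auto
    then have "1 * 1 \<le> (sqrt (real d) * B) * real M" using H(2) by (intro mult_mono) auto
    then have "2 powr (3 / 2) * 1 \<le> 2 powr (3 / 2) * ((sqrt (real d) * B) * real M)"
      by (intro mult_left_mono) auto
    then have "C \<ge> 2 powr (3 / 2)" by (simp add: C_def mult.assoc)
    from level_choice[OF this assms(6,7)] obtain m where m: "m \<le> L"
      "C / 2 * 2 powr (- real L / 2) + 2 * \<epsilon> * real m + 2 * (C / 2 * 2 powr (- real m / 2)) \<le> 2 * \<delta>"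
      unfolding \<delta>_def by blast
    \<comment> \<open>\<open>C / 2\<close> is the constant of \<open>scaling_decay\<close>, as
      \<open>2 powr (3 / 2)\<close> is twice \<open>sqrt 2\<close>.\<close>
    have half: "C / 2 = sqrt (real d) * B * (sqrt 2 * real M)"
    proof -
      have "(2::real) powr (3 / 2) = 2 powr 1 * 2 powr (1 / 2)" unfolding powr_add[symmetric] by simp
      then show ?thesis by (simp add: C_def powr_half_sqrt)
    qed
    have decay: "l2norm ((msup_adj (ft h) ^^ l) x) \<le> C / 2 * 2 powr (- real l / 2)"
      if h: "scaling_filter M h" "\<forall>\<phi>. scaling_function h \<phi> \<longrightarrow> (AE x in lborel. cmod (\<phi> x) \<le> B)"
        and x: "fins x" "card {n. x n \<noteq> 0} \<le> d" "l2norm x \<le> 1" for h x l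
    proof -
      note F = scaling_filterD[OF h(1)]
      obtain a where a: "supported_in a M h" using F(3) by blast
      obtain \<phi> where \<phi>: "scaling_function h \<phi>" "orthonormal_translates \<phi>" using F(4) by blast
      have "l2norm ((msup_adj (ft h) ^^ l) x) \<le> sqrt (real d) * B * (sqrt 2 * real M) / sqrt 2 ^ l * l2norm x"
        using h(2) \<phi>(1) assms(3) by (intro scaling_decay[OF \<phi> F(1) a F(2) _ _ x(1,2)]) auto
      also have "\<dots> \<le> sqrt (real d) * B * (sqrt 2 * real M) / sqrt 2 ^ l * 1"
        using x(3) assms(3) by (intro mult_left_mono) auto
      also have "\<dots> = C / 2 * (1 / sqrt 2 ^ l)" unfolding half by simp
      finally show ?thesis unfolding sqrt_2_power_eq_powr .
    qed
    have vec: "fins (fst (v_adj (f i)))" "card {n. fst (v_adj (f i)) n \<noteq> 0} \<le> d" "l2norm (fst (v_adj (f i))) \<le> 1"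
      "fins (snd (v_adj (f i)))" "card {n. snd (v_adj (f i)) n \<noteq> 0} \<le> d" "l2norm (snd (v_adj (f i))) \<le> 1"
      if i: "i \<in> {1..2 * N}" for i
    proof -
      show "fins (fst (v_adj (f i)))" "fins (snd (v_adj (f i)))" using fins_v_adj fin(1)[OF i] by auto
      show "card {n. fst (v_adj (f i)) n \<noteq> 0} \<le> d" "card {n. snd (v_adj (f i)) n \<noteq> 0} \<le> d"
        using card_v_adj_support[OF fin(1)[OF i]] fin(2)[OF i] by linarith+
      have "(l2norm (fst (v_adj (f i))))\<^sup>2 \<le> (l2norm (f i))\<^sup>2" "(l2norm (snd (v_adj (f i))))\<^sup>2 \<le> (l2norm (f i))\<^sup>2"
        unfolding v_adj_norm[OF fin(1)[OF i], symmetric] by simp_all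
      then show "l2norm (fst (v_adj (f i))) \<le> 1" "l2norm (snd (v_adj (f i))) \<le> 1"
        using norm[OF i] power2_le_imp_le[OF _ l2norm_nonneg] order_trans by blast+
    qed
    have eps0: "\<epsilon> \<ge> 0" using assms(6) by simp
    have form: "cmod (l2inner y (\<lambda>n. omega (f i) n - omega_MERA hs gs L (f i) n)) \<le> 2 * \<delta> * l2norm y"
      if i: "i \<in> {1..2 * N}" and y: "fins y" for i y
    proof -
      have "cmod (l2inner y (omega (f i)) - l2inner y (omega_MERA hs gs L (f i)))
          \<le> (C / 2 * 2 powr (- real L / 2) + 2 * \<epsilon> * real m + 2 * (C / 2 * 2 powr (- real m / 2))) * l2norm y"
        using C0 vec[OF i]
        by (intro omega_difference_bound[OF close H(1) G(1) fin(1)[OF i] norm[OF i] y m(1)]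
            decay[OF assms(1,4)] decay[OF assms(2,5)]) auto
      also have "\<dots> \<le> 2 * \<delta> * l2norm y" using m(2) by (rule mult_right_mono) simp
      finally show ?thesis by (simp add: l2inner_diff_right[OF y])
    qed
    let ?x = "\<lambda>i. f (i + 1)" and ?y = "\<lambda>j. omega (f (2 * N - j))" and ?y' = "\<lambda>j. omega_MERA hs gs L (f (2 * N - j))"
    have nx: "snorm S (?x i) \<le> 1" if "i < N" for i
      using norm[OF ix(1)[OF that]] l2norm_eq_snorm[OF S sub[OF ix(1)[OF that]]] by simp
    have ny: "snorm S (?y i) \<le> 1" if "i < N" for i
    proof (rule snorm_le_of_form_bound[OF S])
      fix y assume y: "fins y"
      show "cmod (l2inner y (?y i)) \<le> 1 * l2norm y"
        using omega_form_bound[OF fin(1)[OF ix(2)[OF that]] y]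
          mult_left_mono[OF norm[OF ix(2)[OF that]] l2norm_nonneg[of y]] by simp
    qed simp
    have ny': "snorm S (?y' i) \<le> 1" if "i < N" for i
    proof (rule snorm_le_of_form_bound[OF S])
      fix y assume y: "fins y"
      show "cmod (l2inner y (?y' i)) \<le> 1 * l2norm y"
        using omega_MERA_form_bound[OF H(1) G(1) fin(1)[OF ix(2)[OF that]] y, of L]
          mult_left_mono[OF norm[OF ix(2)[OF that]] l2norm_nonneg[of y]] by simp
    qed simp
    have nd: "snorm S (\<lambda>s. ?y i s - ?y' i s) \<le> 2 * \<delta>" if "i < N" for i
      by (rule snorm_le_of_form_bound[OF S form[OF ix(2)[OF that]]]) (use \<delta>0 in auto)
    have eqs: "corr omega f N = Determinant.det (cross_gram S N ?x ?y)"
      "corr (omega_MERA hs gs L) f N = Determinant.det (cross_gram S N ?x ?y')"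
      by (rule corr_eq_det[OF S sub], assumption)+
    have "cmod (corr omega f N - corr (omega_MERA hs gs L) f N) \<le> 1 + 1"
      unfolding eqs
      by (rule order_trans[OF norm_triangle_ineq4 add_mono[OF cmod_det_cross_gram_le_1[OF nx ny] cmod_det_cross_gram_le_1[OF nx ny']]])
    moreover have "cmod (corr omega f N - corr (omega_MERA hs gs L) f N) \<le> real N * (2 * \<delta>)"
      unfolding eqs by (rule det_cross_gram_perturb[OF nx ny ny' nd])
    ultimately show ?thesis by (intro le_sqrt_of_min_le) (use \<delta>0 in auto)
  qed
  then show ?thesis by (simp add: d C_def \<delta>_def Let_def)
qed

end
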